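(* Let $\mathcal{B}$ be a non-degenerate $\mathrm{B}$-category with countably many isomorphism classes of objects. Then there is a first-countable admissible group $G$ and a stabilizer class $\mathscr{E}$ in $G$ such that $\mathcal{B}$ is equivalent to $\mathbf{S}(G;\mathscr{E})$. Moreover, if equivalence relations in $\mathcal{B}$ are effective (i.e., $\mathcal{B}$ is pre-Galois) then $\mathcal{B}$ is equivalent to $\mathbf{S}(G)$.
   Context: In a category with finite co-products, write $\mathbf{0}$ for the initial object; an object is empty if it is isomorphic to $\mathbf{0}$. An object $X$ is an atom (atomic) if it is non-empty and, whenever $X \cong Y \amalg Z$, either $Y$ or $Z$ is empty. A $\mathrm{B}$-category is an essentially small category $\mathcal{B}$ such that: (a) $\mathcal{B}$ has finite co-products; (b) every object is isomorphic to a finite co-product of atoms; (c) for objects $X,Y,Z$ with $X$ atomic, the natural map $\mathrm{Hom}(X,Y)\amalg \mathrm{Hom}(X,Z)\to \mathrm{Hom}(X,Y\amalg Z)$ is a bijection; (d) $\mathcal{B}$ has fiber products and a final object $\mathbf{1}$; (e) any monomorphism of atoms is an isomorphism. It is non-degenerate if $\mathbf{1}$ is atomic and, for all maps of atoms $X\to Z$ and $Y\to Z$, the fiber product $X\times_Z Y$ is non-empty. Equivalence relations in $\mathcal{B}$ are effective if for every (internal) equivalence relation $R\subset X\times X$, the quotient $X/R$ (the co-equalizer of $R\rightrightarrows X$) exists and the kernel pair $X\times_{X/R}X$ of $X\to X/R$ is $R$. A pre-Galois category is a non-degenerate $\mathrm{B}$-category with effective equivalence relations. An admissible group is a topological group $G$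 that is Hausdorff, non-archimedean (open subgroups form a neighborhood basis of the identity), and Roelcke pre-compact (for all open subgroups $U,V$ the set $V\backslash G/U$ is finite). An action of $G$ on a set is smooth if all stabilizers are open. $\mathbf{S}(G)$ is the category of sets with a smooth $G$-action having finitely many orbits, with $G$-equivariant maps. A stabilizer class in $G$ is a collection $\mathscr{E}$ of open subgroups that contains $G$, is closed under conjugation and finite intersections, and forms a neighborhood basis of the identity. $\mathbf{S}(G;\mathscr{E})$ is the full subcategory of $\mathbf{S}(G)$ on the $G$-sets all of whose stabilizers belong to $\mathscr{E}$. *)

theory Defs
  imports "HOL-Analysis.Analysis" "HOL-Algebra.Group_Action"
begin

section \<open>Categories\<close>

text \<open>
  Objects and arrows are drawn from HOL types, so every category in the sense below is small in
  the set-theoretic sense; ``essentially small'' therefore does not appear as a hypothesis.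
  \<open>g \<cdot> f\<close> is ``\<open>g\<close> after \<open>f\<close>''; it is only meaningful when \<open>Dom g = Cod f\<close>.
\<close>

record ('o, 'a) cat =
  Obj :: "'o set"
  Arr :: "'a set"
  Dom :: "'a \<Rightarrow> 'o"
  Cod :: "'a \<Rightarrow> 'o"
  Idn :: "'o \<Rightarrow> 'a"
  Comp :: "'a \<Rightarrow> 'a \<Rightarrow> 'a"  (infixl \<open>\<cdot>\<index>\<close> 70)

definition Hom :: "('o, 'a) cat \<Rightarrow> 'o \<Rightarrow> 'o \<Rightarrow> 'a set" where
  "Hom C X Y = {f \<in> Arr C. Dom C f = X \<and> Cod C f = Y}"

locale category =
  fixes C :: "('o, 'a) cat" (structure)
  assumes Dom_closed: "f \<in> Arr C \<Longrightarrow> Dom C f \<in> Obj C"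
    and Cod_closed: "f \<in> Arr C \<Longrightarrow> Cod C f \<in> Obj C"
    and Idn_closed: "X \<in> Obj C \<Longrightarrow> Idn C X \<in> Hom C X X"
    and Comp_closed: "f \<in> Hom C X Y \<Longrightarrow> g \<in> Hom C Y Z \<Longrightarrow> g \<cdot> f \<in> Hom C X Z"
    and Comp_Idn: "f \<in> Hom C X Y \<Longrightarrow> f \<cdot> Idn C X = f"
    and Idn_Comp: "f \<in> Hom C X Y \<Longrightarrow> Idn C Y \<cdot> f = f"
    and Comp_assoc: "f \<in> Hom C W X \<Longrightarrow> g \<in> Hom C X Y \<Longrightarrow> h \<in> Hom C Y Z \<Longrightarrow>
      (h \<cdot> g) \<cdot> f = h \<cdot> (g \<cdot> f)"

definition is_iso :: "('o, 'a) cat \<Rightarrow> 'a \<Rightarrow> bool" where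
  "is_iso C f \<longleftrightarrow> f \<in> Arr C \<and>
     (\<exists>g \<in> Hom C (Cod C f) (Dom C f). g \<cdot>\<^bsub>C\<^esub> f = Idn C (Dom C f) \<and> f \<cdot>\<^bsub>C\<^esub> g = Idn C (Cod C f))"

definition is_mono :: "('o, 'a) cat \<Rightarrow> 'a \<Rightarrow> bool" where
  "is_mono C f \<longleftrightarrow> f \<in> Arr C \<and>
     (\<forall>W \<in> Obj C. \<forall>u \<in> Hom C W (Dom C f). \<forall>v \<in> Hom C W (Dom C f). f \<cdot>\<^bsub>C\<^esub> u = f \<cdot>\<^bsub>C\<^esub> v \<longrightarrow> u = v)"

definition isomorphic :: "('o, 'a) cat \<Rightarrow> 'o \<Rightarrow> 'o \<Rightarrow> bool" where
  "isomorphic C X Y \<longleftrightarrow> (\<exists>f \<in> Hom C X Y. is_iso C f)"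

definition iso_classes :: "('o, 'a) cat \<Rightarrow> 'o set set" where
  "iso_classes C = Obj C // {(X, Y). X \<in> Obj C \<and> Y \<in> Obj C \<and> isomorphic C X Y}"

definition full_subcategory :: "('o, 'a) cat \<Rightarrow> ('o \<Rightarrow> bool) \<Rightarrow> ('o, 'a) cat" where
  "full_subcategory C P = C\<lparr>Obj := {X \<in> Obj C. P X}, Arr := {f \<in> Arr C. P (Dom C f) \<and> P (Cod C f)}\<rparr>"


subsection \<open>Limits and colimits\<close>

definition is_initial :: "('o, 'a) cat \<Rightarrow> 'o \<Rightarrow> bool" where
  "is_initial C X \<longleftrightarrow> X \<in> Obj C \<and> (\<forall>Y \<in> Obj C. \<exists>!f. f \<in> Hom C X Y)"

definition is_final :: "('o, 'a) cat \<Rightarrow> 'o \<Rightarrow> bool" where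
  "is_final C X \<longleftrightarrow> X \<in> Obj C \<and> (\<forall>Y \<in> Obj C. \<exists>!f. f \<in> Hom C Y X)"

text \<open>\<open>W\<close> with inclusions \<open>\<iota> 0, \<dots>, \<iota> (n - 1)\<close> is a co-product of \<open>X 0, \<dots>, X (n - 1)\<close>.\<close>

definition is_finite_coproduct ::
    "('o, 'a) cat \<Rightarrow> nat \<Rightarrow> (nat \<Rightarrow> 'o) \<Rightarrow> 'o \<Rightarrow> (nat \<Rightarrow> 'a) \<Rightarrow> bool" where
  "is_finite_coproduct C n X W \<iota> \<longleftrightarrow> W \<in> Obj C \<and> (\<forall>k<n. \<iota> k \<in> Hom C (X k) W) \<and>
     (\<forall>V \<in> Obj C. \<forall>f. (\<forall>k<n. f k \<in> Hom C (X k) V) \<longrightarrow>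
        (\<exists>!h. h \<in> Hom C W V \<and> (\<forall>k<n. h \<cdot>\<^bsub>C\<^esub> \<iota> k = f k)))"

definition is_coproduct :: "('o, 'a) cat \<Rightarrow> 'o \<Rightarrow> 'o \<Rightarrow> 'o \<Rightarrow> 'a \<Rightarrow> 'a \<Rightarrow> bool" where
  "is_coproduct C Y Z W i j \<longleftrightarrow> W \<in> Obj C \<and> i \<in> Hom C Y W \<and> j \<in> Hom C Z W \<and>
     (\<forall>V \<in> Obj C. \<forall>f \<in> Hom C Y V. \<forall>g \<in> Hom C Z V.
        \<exists>!h. h \<in> Hom C W V \<and> h \<cdot>\<^bsub>C\<^esub> i = f \<and> h \<cdot>\<^bsub>C\<^esub> j = g)"

definition is_product :: "('o, 'a) cat \<Rightarrow> 'o \<Rightarrow> 'o \<Rightarrow> 'o \<Rightarrow> 'a \<Rightarrow> 'a \<Rightarrow> bool" where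
  "is_product C Y Z P p q \<longleftrightarrow> P \<in> Obj C \<and> p \<in> Hom C P Y \<and> q \<in> Hom C P Z \<and>
     (\<forall>V \<in> Obj C. \<forall>f \<in> Hom C V Y. \<forall>g \<in> Hom C V Z.
        \<exists>!h. h \<in> Hom C V P \<and> p \<cdot>\<^bsub>C\<^esub> h = f \<and> q \<cdot>\<^bsub>C\<^esub> h = g)"

text \<open>\<open>P\<close> with projections \<open>p\<close>, \<open>q\<close> is a fiber product of \<open>f : X \<rightarrow> Z\<close> and \<open>g : Y \<rightarrow> Z\<close>.\<close>

definition is_fiber_product :: "('o, 'a) cat \<Rightarrow> 'a \<Rightarrow> 'a \<Rightarrow> 'o \<Rightarrow> 'a \<Rightarrow> 'a \<Rightarrow> bool" where
  "is_fiber_product C f g P p q \<longleftrightarrow> P \<in> Obj C \<and> p \<in> Hom C P (Dom C f) \<and> q \<in> Hom C P (Dom C g) \<and>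
     f \<cdot>\<^bsub>C\<^esub> p = g \<cdot>\<^bsub>C\<^esub> q \<and>
     (\<forall>V \<in> Obj C. \<forall>u \<in> Hom C V (Dom C f). \<forall>v \<in> Hom C V (Dom C g). f \<cdot>\<^bsub>C\<^esub> u = g \<cdot>\<^bsub>C\<^esub> v \<longrightarrow>
        (\<exists>!h. h \<in> Hom C V P \<and> p \<cdot>\<^bsub>C\<^esub> h = u \<and> q \<cdot>\<^bsub>C\<^esub> h = v))"

definition is_coequalizer :: "('o, 'a) cat \<Rightarrow> 'a \<Rightarrow> 'a \<Rightarrow> 'o \<Rightarrow> 'a \<Rightarrow> bool" where
  "is_coequalizer C f g Q c \<longleftrightarrow> Q \<in> Obj C \<and> c \<in> Hom C (Cod C f) Q \<and> c \<cdot>\<^bsub>C\<^esub> f = c \<cdot>\<^bsub>C\<^esub> g \<and>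
     (\<forall>V \<in> Obj C. \<forall>u \<in> Hom C (Cod C f) V. u \<cdot>\<^bsub>C\<^esub> f = u \<cdot>\<^bsub>C\<^esub> g \<longrightarrow>
        (\<exists>!h. h \<in> Hom C Q V \<and> h \<cdot>\<^bsub>C\<^esub> c = u))"


subsection \<open>Equivalence of categories\<close>

definition is_functor ::
    "('o, 'a) cat \<Rightarrow> ('p, 'b) cat \<Rightarrow> ('o \<Rightarrow> 'p) \<Rightarrow> ('a \<Rightarrow> 'b) \<Rightarrow> bool" where
  "is_functor C D Fo Fa \<longleftrightarrow>
     (\<forall>X \<in> Obj C. Fo X \<in> Obj D) \<and>
     (\<forall>f \<in> Arr C. Fa f \<in> Hom D (Fo (Dom C f)) (Fo (Cod C f))) \<and>
     (\<forall>X \<in> Obj C. Fa (Idn C X) = Idn D (Fo X)) \<and>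
     (\<forall>f \<in> Arr C. \<forall>g \<in> Arr C. Dom C g = Cod C f \<longrightarrow> Fa (g \<cdot>\<^bsub>C\<^esub> f) = Fa g \<cdot>\<^bsub>D\<^esub> Fa f)"

definition is_natural_iso ::
    "('o, 'a) cat \<Rightarrow> ('p, 'b) cat \<Rightarrow> ('o \<Rightarrow> 'p) \<Rightarrow> ('a \<Rightarrow> 'b) \<Rightarrow> ('o \<Rightarrow> 'p) \<Rightarrow> ('a \<Rightarrow> 'b) \<Rightarrow>
       ('o \<Rightarrow> 'b) \<Rightarrow> bool" where
  "is_natural_iso C D Fo Fa Go Ga \<eta> \<longleftrightarrow>
     (\<forall>X \<in> Obj C. \<eta> X \<in> Hom D (Fo X) (Go X) \<and> is_iso D (\<eta> X)) \<and>
     (\<forall>f \<in> Arr C. \<eta> (Cod C f) \<cdot>\<^bsub>D\<^esub> Fa f = Ga f \<cdot>\<^bsub>D\<^esub> \<eta> (Dom C f))"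

definition equivalent_categories :: "('o, 'a) cat \<Rightarrow> ('p, 'b) cat \<Rightarrow> bool" where
  "equivalent_categories C D \<longleftrightarrow>
     (\<exists>Fo Fa Go Ga \<eta> \<epsilon>. is_functor C D Fo Fa \<and> is_functor D C Go Ga \<and>
        is_natural_iso C C id id (Go \<circ> Fo) (Ga \<circ> Fa) \<eta> \<and>
        is_natural_iso D D (Fo \<circ> Go) (Fa \<circ> Ga) id id \<epsilon>)"


section \<open>B-categories\<close>

definition is_empty :: "('o, 'a) cat \<Rightarrow> 'o \<Rightarrow> bool" where
  "is_empty C X \<longleftrightarrow> X \<in> Obj C \<and> (\<exists>I. is_initial C I \<and> isomorphic C X I)"

definition atom :: "('o, 'a) cat \<Rightarrow> 'o \<Rightarrow> bool" where
  "atom C X \<longleftrightarrow> X \<in> Obj C \<and> \<not> is_empty C X \<and>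
     (\<forall>Y \<in> Obj C. \<forall>Z \<in> Obj C. \<forall>W i j. is_coproduct C Y Z W i j \<and> isomorphic C X W \<longrightarrow>
        is_empty C Y \<or> is_empty C Z)"

locale B_category = category B for B :: "('o, 'a) cat" (structure) +
  assumes finite_coproducts:
      "\<And>n (X :: nat \<Rightarrow> 'o). (\<forall>k<n. X k \<in> Obj B) \<Longrightarrow> \<exists>W \<iota>. is_finite_coproduct B n X W \<iota>"
    and atomic_decomposition:
      "X \<in> Obj B \<Longrightarrow> \<exists>n A W \<iota>. (\<forall>k<n. atom B (A k)) \<and> is_finite_coproduct B n A W \<iota> \<and> isomorphic B X W"
    and Hom_atom_coproduct:
      "\<lbrakk>atom B X; Y \<in> Obj B; Z \<in> Obj B; is_coproduct B Y Z W i j\<rbrakk> \<Longrightarrow>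
        bij_betw (case_sum (\<lambda>f. i \<cdot> f) (\<lambda>g. j \<cdot> g)) (Hom B X Y <+> Hom B X Z) (Hom B X W)"
    and fiber_products:
      "\<lbrakk>f \<in> Arr B; g \<in> Arr B; Cod B f = Cod B g\<rbrakk> \<Longrightarrow> \<exists>P p q. is_fiber_product B f g P p q"
    and final_object: "\<exists>T. is_final B T"
    and mono_atoms_iso: "\<lbrakk>atom B X; atom B Y; f \<in> Hom B X Y; is_mono B f\<rbrakk> \<Longrightarrow> is_iso B f"

locale nondegenerate_B_category = B_category +
  assumes final_atom: "is_final B T \<Longrightarrow> atom B T"
    and fiber_product_nonempty:
      "\<lbrakk>atom B X; atom B Y; atom B Z; f \<in> Hom B X Z; g \<in> Hom B Y Z; is_fiber_product B f g P p q\<rbrakk> \<Longrightarrow>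
        \<not> is_empty B P"

text \<open>
  \<open>m : R \<rightarrow> X \<times> X\<close> is a monomorphism, \<open>\<pi>\<^sub>1 m\<close> and \<open>\<pi>\<^sub>2 m\<close> are the two maps \<open>R \<rightrightarrows> X\<close>. Reflexivity is a
  lift \<open>s\<close> of the diagonal to \<open>R\<close>, symmetry a lift \<open>t\<close> of the swapped inclusion, and transitivity a
  lift of \<open>(x, y, z) \<mapsto> (x, z)\<close> on \<open>R \<times>\<^sub>X R\<close>.
\<close>

definition internal_equivalence_relation :: "('o, 'a) cat \<Rightarrow> 'o \<Rightarrow> 'o \<Rightarrow> 'a \<Rightarrow> 'a \<Rightarrow> bool" where
  "internal_equivalence_relation C X R r\<^sub>1 r\<^sub>2 \<longleftrightarrow> X \<in> Obj C \<and> R \<in> Obj C \<and>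
     (\<exists>P \<pi>\<^sub>1 \<pi>\<^sub>2 m. is_product C X X P \<pi>\<^sub>1 \<pi>\<^sub>2 \<and> m \<in> Hom C R P \<and> is_mono C m \<and>
        r\<^sub>1 = \<pi>\<^sub>1 \<cdot>\<^bsub>C\<^esub> m \<and> r\<^sub>2 = \<pi>\<^sub>2 \<cdot>\<^bsub>C\<^esub> m) \<and>
     (\<exists>s \<in> Hom C X R. r\<^sub>1 \<cdot>\<^bsub>C\<^esub> s = Idn C X \<and> r\<^sub>2 \<cdot>\<^bsub>C\<^esub> s = Idn C X) \<and>
     (\<exists>t \<in> Hom C R R. r\<^sub>1 \<cdot>\<^bsub>C\<^esub> t = r\<^sub>2 \<and> r\<^sub>2 \<cdot>\<^bsub>C\<^esub> t = r\<^sub>1) \<and>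
     (\<forall>Q p q. is_fiber_product C r\<^sub>2 r\<^sub>1 Q p q \<longrightarrow>
        (\<exists>u \<in> Hom C Q R. r\<^sub>1 \<cdot>\<^bsub>C\<^esub> u = r\<^sub>1 \<cdot>\<^bsub>C\<^esub> p \<and> r\<^sub>2 \<cdot>\<^bsub>C\<^esub> u = r\<^sub>2 \<cdot>\<^bsub>C\<^esub> q))"

definition effective_equivalence_relations :: "('o, 'a) cat \<Rightarrow> bool" where
  "effective_equivalence_relations C \<longleftrightarrow>
     (\<forall>X R r\<^sub>1 r\<^sub>2. internal_equivalence_relation C X R r\<^sub>1 r\<^sub>2 \<longrightarrow>
        (\<exists>Q c. is_coequalizer C r\<^sub>1 r\<^sub>2 Q c \<and> is_fiber_product C c c R r\<^sub>1 r\<^sub>2))"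


section \<open>Admissible groups and smooth actions\<close>

locale topological_group = group G for G :: "'g monoid" (structure) +
  fixes T :: "'g topology"
  assumes topspace_eq: "topspace T = carrier G"
    and continuous_mult: "continuous_map (prod_topology T T) T (\<lambda>(x, y). x \<otimes> y)"
    and continuous_inv: "continuous_map T T (\<lambda>x. inv x)"

definition open_subgroup :: "'g monoid \<Rightarrow> 'g topology \<Rightarrow> 'g set \<Rightarrow> bool" where
  "open_subgroup G T U \<longleftrightarrow> subgroup U G \<and> openin T U"

locale admissible_group = topological_group +
  assumes hausdorff: "Hausdorff_space T"
    and non_archimedean: "\<lbrakk>openin T S; \<one> \<in> S\<rbrakk> \<Longrightarrow> \<exists>U. open_subgroup G T U \<and> U \<subseteq> S"
    and Roelcke_precompact:
      "\<lbrakk>open_subgroup G T U; open_subgroup G T V\<rbrakk> \<Longrightarrow> finite {V <#> (g <# U) | g. g \<in> carrier G}"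

locale stabilizer_class = topological_group +
  fixes \<E> :: "'a set set"
  assumes members_open: "U \<in> \<E> \<Longrightarrow> open_subgroup G T U"
    and carrier_mem: "carrier G \<in> \<E>"
    and conjugate_mem: "\<lbrakk>U \<in> \<E>; g \<in> carrier G\<rbrakk> \<Longrightarrow> g <# U #> inv g \<in> \<E>"
    and Int_mem: "\<lbrakk>U \<in> \<E>; V \<in> \<E>\<rbrakk> \<Longrightarrow> U \<inter> V \<in> \<E>"
    and neighborhood_basis: "\<lbrakk>openin T S; \<one> \<in> S\<rbrakk> \<Longrightarrow> \<exists>U \<in> \<E>. U \<subseteq> S"

text \<open>
  A \<open>G\<close>-set is a pair of an underlying set and an action. The action is required to be extensional
  in the group argument so that it carries no information outside \<open>carrier G\<close>.
\<close>

type_synonym ('g, 'x) gset = "'x set \<times> ('g \<Rightarrow> 'x \<Rightarrow> 'x)"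

definition is_smooth_gset :: "'g monoid \<Rightarrow> 'g topology \<Rightarrow> ('g, 'x) gset \<Rightarrow> bool" where
  "is_smooth_gset G T = (\<lambda>(E, \<phi>). group_action G E \<phi> \<and> \<phi> \<in> extensional (carrier G) \<and>
     (\<forall>x \<in> E. openin T (stabilizer G \<phi> x)))"

definition equivariant_maps :: "'g monoid \<Rightarrow> ('g, 'x) gset \<Rightarrow> ('g, 'x) gset \<Rightarrow> ('x \<Rightarrow> 'x) set" where
  "equivariant_maps G = (\<lambda>(E, \<phi>) (F, \<psi>).
     {f \<in> E \<rightarrow>\<^sub>E F. \<forall>g \<in> carrier G. \<forall>x \<in> E. f (\<phi> g x) = \<psi> g (f x)})"

text \<open>
  \<open>S(G)\<close> with the points of all \<open>G\<close>-sets taken from the type \<open>'g set \<times> nat\<close>. This type is large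
  enough for the category to contain, up to isomorphism, every smooth \<open>G\<close>-set with finitely many
  orbits, whatever the type of its points: see \<open>smooth_gset_representable\<close> below.
\<close>

type_synonym 'g point = "'g set \<times> nat"

type_synonym 'g gset_arrow =
  "('g, 'g point) gset \<times> ('g point \<Rightarrow> 'g point) \<times> ('g, 'g point) gset"

definition smooth_gsets ::
    "'g monoid \<Rightarrow> 'g topology \<Rightarrow> (('g, 'g point) gset, 'g gset_arrow) cat" where
  "smooth_gsets G T =
     (let Ob = {X. is_smooth_gset G T X \<and> finite (orbits G (fst X) (snd X))}
      in \<lparr>Obj = Ob,
          Arr = {(X, f, Y). X \<in> Ob \<and> Y \<in> Ob \<and> f \<in> equivariant_maps G X Y},
          Dom = (\<lambda>(X, f, Y). X),
          Cod = (\<lambda>(X, f, Y). Y),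
          Idn = (\<lambda>X. (X, \<lambda>x \<in> fst X. x, X)),
          Comp = (\<lambda>(Y, g, Z) (X, f, Y'). (X, compose (fst X) g f, Z))\<rparr>)"

definition smooth_gsets_class ::
    "'g monoid \<Rightarrow> 'g topology \<Rightarrow> 'g set set \<Rightarrow> (('g, 'g point) gset, 'g gset_arrow) cat" where
  "smooth_gsets_class G T \<E> =
     full_subcategory (smooth_gsets G T) (\<lambda>(E, \<phi>). \<forall>x \<in> E. stabilizer G \<phi> x \<in> \<E>)"


lemma smooth_gset_representable:
  fixes G :: "'g monoid" and E :: "'y set"
  assumes "is_smooth_gset G T (E, \<phi>)" and fin: "finite (orbits G E \<phi>)"
  shows "\<exists>F \<psi> h. (F, \<psi>) \<in> Obj (smooth_gsets G T) \<and> bij_betw h E F \<and>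
           (\<forall>g \<in> carrier G. \<forall>x \<in> E. h (\<phi> g x) = \<psi> g (h x))"
proof -
  have act: "group_action G E \<phi>" and op: "\<And>x. x \<in> E \<Longrightarrow> openin T (stabilizer G \<phi> x)"
    using assms(1) by (auto simp: is_smooth_gset_def)
  interpret group_action G E \<phi> by (fact act)
  interpret group_hom G "BijGroup E" \<phi> by (fact group_hom)
  have Bij: "\<phi> g \<in> Bij E" if "g \<in> carrier G" for g
    using bij_prop0[OF that] .
  have img: "\<phi> g x \<in> E" if "g \<in> carrier G" "x \<in> E" for g x
    using surj_prop[OF that(1)] that(2) by blast
  have mul: "\<phi> (g \<otimes>\<^bsub>G\<^esub> k) x = \<phi> g (\<phi> k x)" if "g \<in> carrier G" "k \<in> carrier G" "x \<in> E" for g k x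
    using hom_mult[OF that(1,2)] Bij that by (simp add: BijGroup_def compose_def)
  obtain ix :: "'y set \<Rightarrow> nat" where ix: "inj_on ix (orbits G E \<phi>)"
    using fin finite_imp_inj_to_nat_seg by metis
  define r where "r A = (SOME x. x \<in> A)" for A :: "'y set"
  have r: "\<exists>g \<in> carrier G. \<phi> g (r (orbit G \<phi> x)) = x" if x: "x \<in> E" for x
  proof -
    have "x \<in> orbit G \<phi> x"
      using orbit_refl[OF x] .
    then have "r (orbit G \<phi> x) \<in> orbit G \<phi> x"
      unfolding r_def by (rule someI)
    moreover have "r (orbit G \<phi> x) \<in> E"
      using calculation x img by (auto simp: orbit_def)
    ultimately have "x \<in> orbit G \<phi> (r (orbit G \<phi> x))"
      using orbit_sym x by blast
    then obtain g where "g \<in> carrier G" "x = \<phi> g (r (orbit G \<phi> x))"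
      unfolding orbit_def[of G \<phi> "r _"] by blast
    then show ?thesis
      by metis
  qed
  define h where "h x = ({g \<in> carrier G. \<phi> g (r (orbit G \<phi> x)) = x}, ix (orbit G \<phi> x))" for x
  have inj: "inj_on h E"
  proof (rule inj_onI)
    fix x y assume x: "x \<in> E" and y: "y \<in> E" and eq: "h x = h y"
    have "orbit G \<phi> x = orbit G \<phi> y"
      using ix eq x y by (auto simp: h_def inj_on_def orbits_def)
    then show "x = y"
      using eq r[OF x] by (auto simp: h_def)
  qed
  define F where "F = h ` E"
  define h' where "h' = inv_into E h"
  have h'h: "h' (h x) = x" if "x \<in> E" for x
    using inj that by (simp add: h'_def)
  have F: "h x \<in> F" if "x \<in> E" for x
    using that by (simp add: F_def)
  define \<psi> where "\<psi> = (\<lambda>g \<in> carrier G. \<lambda>y \<in> F. h (\<phi> g (h' y)))"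
  have \<psi>h: "\<psi> g (h x) = h (\<phi> g x)" if "g \<in> carrier G" "x \<in> E" for g x
    using that by (simp add: \<psi>_def F h'h)
  have \<psi>_Bij: "\<psi> g \<in> Bij F" if g: "g \<in> carrier G" for g
  proof -
    have "inj_on (\<psi> g) F"
      using inj inj_prop[OF g] img[OF g] unfolding F_def inj_on_def by (simp add: \<psi>h[OF g]) metis
    moreover have "\<psi> g ` F = F"
    proof -
      have "\<psi> g ` F = h ` (\<phi> g ` E)"
        by (auto simp: F_def \<psi>h[OF g] image_image)
      then show ?thesis
        using surj_prop[OF g] by (simp add: F_def)
    qed
    ultimately show ?thesis
      using g by (auto simp: Bij_def bij_betw_def \<psi>_def)
  qed
  have stab: "stabilizer G \<psi> (h x) = stabilizer G \<phi> x" if "x \<in> E" for x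
    using that by (auto simp: stabilizer_def \<psi>h inj_on_eq_iff[OF inj] img)
  have "\<psi> (g \<otimes>\<^bsub>G\<^esub> k) = \<psi> g \<otimes>\<^bsub>BijGroup F\<^esub> \<psi> k" if g: "g \<in> carrier G" and k: "k \<in> carrier G" for g k
  proof
    fix y
    show "\<psi> (g \<otimes>\<^bsub>G\<^esub> k) y = (\<psi> g \<otimes>\<^bsub>BijGroup F\<^esub> \<psi> k) y"
    proof (cases "y \<in> F")
      case True
      then obtain x where "x \<in> E" "y = h x" by (auto simp: F_def)
      then show ?thesis
        using g k by (simp add: BijGroup_def \<psi>_Bij Bij compose_def F \<psi>h mul img)
    next
      case False
      then show ?thesis
        using \<psi>_Bij[OF g] \<psi>_Bij[OF k] g k by (simp add: BijGroup_def compose_def) (simp add: \<psi>_def)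
    qed
  qed
  then have "\<psi> \<in> hom G (BijGroup F)"
    by (intro homI) (simp_all add: BijGroup_def \<psi>_Bij)
  then have "group_action G F \<psi>"
    by (simp add: group_action_def group_hom_def group_hom_axioms_def group_BijGroup is_group)
  moreover have "orbits G F \<psi> = (`) h ` orbits G E \<phi>"
  proof -
    have orbit: "orbit G \<psi> (h x) = h ` orbit G \<phi> x" if "x \<in> E" for x
      using that by (simp add: orbit_def \<psi>h setcompr_eq_image image_image)
    have "orbits G F \<psi> = (\<lambda>x. orbit G \<psi> (h x)) ` E"
      by (simp only: orbits_def setcompr_eq_image Collect_mem_eq F_def image_image)
    also have "\<dots> = (\<lambda>x. h ` orbit G \<phi> x) ` E"
      by (rule image_cong) (simp_all add: orbit)
    finally show ?thesis
      by (simp only: orbits_def setcompr_eq_image Collect_mem_eq image_image)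
  qed
  moreover have "\<psi> \<in> extensional (carrier G)"
    by (simp add: \<psi>_def)
  moreover have "openin T (stabilizer G \<psi> y)" if y: "y \<in> F" for y
  proof -
    obtain x where "x \<in> E" "y = h x" using y unfolding F_def by blast
    then show ?thesis using op stab by simp
  qed
  ultimately have "(F, \<psi>) \<in> Obj (smooth_gsets G T)"
    using fin by (simp add: smooth_gsets_def Let_def is_smooth_gset_def)
  moreover have "bij_betw h E F"
    using inj by (simp add: F_def bij_betw_def)
  ultimately show ?thesis
    using \<psi>h by metis
qed

end

theory Submission
  imports Defs
begin

text \<open>
  In a non-degenerate \<open>B\<close>-category the graph of a map \<open>A \<rightarrow> Y\<close> out of an atom is one of the finitely
  many atoms of \<open>A \<times> Y\<close>. Hence such maps form a finite set, maps of atoms are epimorphisms, and with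
  countably many isomorphism classes all amalgamation problems between atoms can be listed and solved
  one after the other along a chain \<open>\<dots> \<rightarrow> X 1 \<rightarrow> X 0\<close> of atoms. The functor \<open>F Y = colim Hom (X n) Y\<close>
  then takes countable values, preserves finite limits and finite co-products, and sends maps of atoms
  to surjections. The last property drives a back-and-forth argument: the group of natural
  automorphisms of \<open>F\<close> is transitive on \<open>F A\<close> for every atom \<open>A\<close>. Consequently orbits on
  \<open>F (X \<times> Y)\<close> are the atoms of \<open>X \<times> Y\<close>, which yields Roelcke pre-compactness, fullness of \<open>F\<close> and,
  when equivalence relations are effective, that every open subgroup is the stabilizer of a point.
\<close>

section \<open>Maps out of atoms\<close>

text \<open>The group has to be given on a fixed type. Countability provides one: \<open>F\<close>
  takes values in sets of natural numbers, and a natural automorphism is stored as one permutation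
  of \<open>nat\<close>, whence the type \<open>(nat \<Rightarrow> nat) monoid\<close> in the
  conclusion.

  An atom may have no endomorphism besides the identity, so homogeneity cannot be read off any
  single stage of the chain; automorphisms of \<open>F\<close> appear only in the limit. The locale
  \<open>fiber_functor\<close> records the properties of the colimit on which the back-and-forth and
  the reconstruction rest, and the chain is not seen again after \<open>fiber_functor_F\<close>.

  The members of \<open>\<E>\<close> are the stabilizers of points of \<open>F\<close>. An open
  subgroup containing the stabilizer of \<open>a \<in> F A\<close> ought to be the stabilizer of a
  point of a quotient of \<open>A\<close>, but such a quotient may be missing from \<open>B\<close>.
  Hence \<open>\<E>\<close> can be smaller than the set of all open subgroups, and effectivity
  supplies the missing quotients.\<close>

context category begin

section \<open>Isomorphisms, co-products and fiber products in a bare category\<close>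

lemma Hom_D: "f \<in> Hom C X Y \<Longrightarrow> f \<in> Arr C \<and> Dom C f = X \<and> Cod C f = Y"
  by (simp add: Hom_def)

lemma Hom_I: "f \<in> Arr C \<Longrightarrow> f \<in> Hom C (Dom C f) (Cod C f)"
  by (simp add: Hom_def)

lemma Hom_obj: "f \<in> Hom C X Y \<Longrightarrow> X \<in> Obj C \<and> Y \<in> Obj C"
  using Dom_closed Cod_closed by (auto simp: Hom_def)

lemma is_iso_Hom:
  "f \<in> Hom C X Y \<Longrightarrow> is_iso C f \<longleftrightarrow> (\<exists>g \<in> Hom C Y X. g \<cdot> f = Idn C X \<and> f \<cdot> g = Idn C Y)"
  by (auto simp: is_iso_def Hom_def)

lemma isomorphicE:
  assumes "isomorphic C X Y"
  obtains f g where "f \<in> Hom C X Y" "g \<in> Hom C Y X" "g \<cdot> f = Idn C X" "f \<cdot> g = Idn C Y"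
proof -
  obtain f where f: "f \<in> Hom C X Y" "is_iso C f" using assms by (auto simp: isomorphic_def)
  then show ?thesis using is_iso_Hom[OF f(1)] that by blast
qed

lemma isomorphicI:
  assumes "f \<in> Hom C X Y" "g \<in> Hom C Y X" "g \<cdot> f = Idn C X" "f \<cdot> g = Idn C Y"
  shows "isomorphic C X Y"
  using is_iso_Hom[OF assms(1)] assms unfolding isomorphic_def by blast

lemma isomorphic_refl:
  assumes "X \<in> Obj C"
  shows "isomorphic C X X"
  by (rule isomorphicI[OF Idn_closed[OF assms] Idn_closed[OF assms]])
    (simp_all add: Idn_Comp[OF Idn_closed[OF assms]])

lemma cancel_section:
  assumes "g \<cdot> f = Idn C X" "f \<in> Hom C X Y" "g \<in> Hom C Y X" "u \<in> Hom C V X"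
  shows "g \<cdot> (f \<cdot> u) = u"
  using Comp_assoc[OF assms(4,2,3)] Idn_Comp[OF assms(4)] assms(1) by simp

lemma cancel_section_right:
  assumes "g \<cdot> f = Idn C X" "f \<in> Hom C X Y" "g \<in> Hom C Y X" "u \<in> Hom C X V"
  shows "(u \<cdot> g) \<cdot> f = u"
  using Comp_assoc[OF assms(2,3,4)] Comp_Idn[OF assms(4)] assms(1) by simp

lemma is_mono_Hom:
  "f \<in> Hom C X Y \<Longrightarrow> is_mono C f \<longleftrightarrow>
    (\<forall>W \<in> Obj C. \<forall>u \<in> Hom C W X. \<forall>v \<in> Hom C W X. f \<cdot> u = f \<cdot> v \<longrightarrow> u = v)"
  by (simp add: is_mono_def Hom_def)

lemma split_mono:
  assumes "f \<in> Hom C X Y" "g \<in> Hom C Y X" "g \<cdot> f = Idn C X"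
  shows "is_mono C f"
  unfolding is_mono_Hom[OF assms(1)]
proof (intro ballI impI)
  fix W u v assume "u \<in> Hom C W X" "v \<in> Hom C W X" "f \<cdot> u = f \<cdot> v"
  then show "u = v" using cancel_section[OF assms(3,1,2)] by metis
qed

text \<open>The decomposition axiom gives an isomorphism onto a co-product of atoms. Composing the
  inclusions with the inverse isomorphism makes the object itself the co-product, so that no
  isomorphism has to be carried along later.\<close>

lemma transport_finite_coproduct:
  assumes "is_finite_coproduct C n A W \<iota>" "isomorphic C X W" 
  shows "\<exists>\<kappa>. is_finite_coproduct C n A X \<kappa>"
proof -
  obtain f g where fg: "f \<in> Hom C X W" "g \<in> Hom C W X" "g \<cdot> f = Idn C X" "f \<cdot> g = Idn C W"
    using assms(2) by (rule isomorphicE)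
  have \<iota>: "\<iota> k \<in> Hom C (A k) W" if "k < n" for k
    using assms(1) that by (auto simp: is_finite_coproduct_def)
  have "is_finite_coproduct C n A X (\<lambda>k. g \<cdot> \<iota> k)"
    unfolding is_finite_coproduct_def
  proof (intro conjI ballI allI impI)
    show "X \<in> Obj C" using fg Hom_obj by blast
    show "g \<cdot> \<iota> k \<in> Hom C (A k) X" if "k < n" for k
      using \<iota>[OF that] fg Comp_closed by blast
    fix V u assume V: "V \<in> Obj C" and u: "\<forall>k<n. u k \<in> Hom C (A k) V"
    then have ex: "\<exists>!h. h \<in> Hom C W V \<and> (\<forall>k<n. h \<cdot> \<iota> k = u k)"
      using assms(1) unfolding is_finite_coproduct_def by blast
    then obtain h where h: "h \<in> Hom C W V" "\<forall>k<n. h \<cdot> \<iota> k = u k" by blast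
    show "\<exists>!h. h \<in> Hom C X V \<and> (\<forall>k<n. h \<cdot> (g \<cdot> \<iota> k) = u k)"
    proof (rule ex1I[of _ "h \<cdot> f"], intro conjI allI impI)
      show "h \<cdot> f \<in> Hom C X V" using h fg Comp_closed by blast
      fix k assume k: "k < n"
      have "(h \<cdot> f) \<cdot> (g \<cdot> \<iota> k) = h \<cdot> (f \<cdot> (g \<cdot> \<iota> k))"
        using Comp_assoc Comp_closed \<iota>[OF k] fg h by blast
      then show "(h \<cdot> f) \<cdot> (g \<cdot> \<iota> k) = u k"
        using cancel_section[OF fg(4,2,1) \<iota>[OF k]] h k by simp
    next
      fix h' assume h': "h' \<in> Hom C X V \<and> (\<forall>k<n. h' \<cdot> (g \<cdot> \<iota> k) = u k)"
      have "(h' \<cdot> g) \<cdot> \<iota> k = u k" if "k < n" for k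
        using Comp_assoc \<iota>[OF that] fg h' that by metis
      moreover have "h' \<cdot> g \<in> Hom C W V" using h' fg Comp_closed by blast
      ultimately have "h' \<cdot> g = h" using ex h by blast
      then show "h' = h \<cdot> f"
        using cancel_section_right[OF fg(3,1,2)] h' by metis
    qed
  qed
  then show ?thesis by blast
qed

lemma finite_coproduct_in: "is_finite_coproduct C n A X w \<Longrightarrow> k < n \<Longrightarrow> w k \<in> Hom C (A k) X"
  by (auto simp: is_finite_coproduct_def)

lemma finite_coproduct_univ:
  assumes "is_finite_coproduct C n A X w" "V \<in> Obj C" "\<forall>k<n. u k \<in> Hom C (A k) V"
  shows "\<exists>!h. h \<in> Hom C X V \<and> (\<forall>k<n. h \<cdot> w k = u k)"
  using assms(1)[unfolded is_finite_coproduct_def, THEN conjunct2, THEN conjunct2, THEN bspec,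
      OF assms(2), THEN spec, THEN mp, OF assms(3)] .

lemma finite_coproduct_ex:
  assumes "is_finite_coproduct C n A X w" "V \<in> Obj C" "\<And>k. k < n \<Longrightarrow> u k \<in> Hom C (A k) V"
  shows "\<exists>h \<in> Hom C X V. \<forall>k<n. h \<cdot> w k = u k"
  using finite_coproduct_univ[OF assms(1,2)] assms(3) by blast

lemma finite_coproduct_eq:
  assumes "is_finite_coproduct C n A X w" "u \<in> Hom C X V" "v \<in> Hom C X V"
    and "\<And>k. k < n \<Longrightarrow> u \<cdot> w k = v \<cdot> w k"
  shows "u = v"
proof -
  have "V \<in> Obj C" using assms(2) Hom_obj by blast
  moreover have "\<forall>k<n. v \<cdot> w k \<in> Hom C (A k) V"
    using finite_coproduct_in[OF assms(1)] assms(3) Comp_closed by blast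
  ultimately have "\<exists>!h. h \<in> Hom C X V \<and> (\<forall>k<n. h \<cdot> w k = v \<cdot> w k)"
    by (rule finite_coproduct_univ[OF assms(1)])
  then show ?thesis using assms by blast
qed

lemma fiber_product_D:
  assumes "is_fiber_product C f g P p q" "f \<in> Hom C X Z" "g \<in> Hom C Y Z"
  shows "P \<in> Obj C" "p \<in> Hom C P X" "q \<in> Hom C P Y" "f \<cdot> p = g \<cdot> q"
  using assms by (auto simp: is_fiber_product_def dest: Hom_D)

lemma fiber_product_lift:
  assumes "is_fiber_product C f g P p q" "f \<in> Hom C X Z" "g \<in> Hom C Y Z"
    and "u \<in> Hom C V X" "v \<in> Hom C V Y" "f \<cdot> u = g \<cdot> v"
  shows "\<exists>h \<in> Hom C V P. p \<cdot> h = u \<and> q \<cdot> h = v"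
proof -
  have "V \<in> Obj C" using Hom_obj assms(4) by blast
  moreover have d: "Dom C f = X" "Dom C g = Y" using assms Hom_D by blast+
  ultimately have "\<exists>!h. h \<in> Hom C V P \<and> p \<cdot> h = u \<and> q \<cdot> h = v"
    using assms(1,4-) unfolding is_fiber_product_def d by blast
  then show ?thesis by blast
qed

lemma final_unique:
  assumes "is_final C T" "u \<in> Hom C X T" "v \<in> Hom C X T"
  shows "u = v"
proof -
  have "X \<in> Obj C" using Hom_obj assms(2) by blast
  then show ?thesis using assms unfolding is_final_def by blast
qed

end

section \<open>Co-products and products seen from an atom\<close>

context B_category begin

lemma atom_obj: "atom B A \<Longrightarrow> A \<in> Obj B"
  by (simp add: atom_def)

lemma decomposition:
  assumes "X \<in> Obj B"
  shows "\<exists>n A w. (\<forall>k<n. atom B (A k)) \<and> is_finite_coproduct B n A X w"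
proof -
  obtain n A W \<iota> where "\<forall>k<n. atom B (A k)" "is_finite_coproduct B n A W \<iota>" "isomorphic B X W"
    using atomic_decomposition[OF assms] by blast
  then show ?thesis using transport_finite_coproduct[of n A W \<iota> X] by blast
qed

text \<open>An initial object \<open>W\<close> is the co-product of \<open>W\<close> with itself
  along identities. A map from an atom into \<open>W\<close> would then have two distinct copies in
  \<open>Hom B A W <+> Hom B A W\<close> with the same image, against
  \<open>Hom_atom_coproduct\<close>.\<close>

lemma no_map_to_empty_coproduct:
  assumes "atom B A" "is_finite_coproduct B 0 X W w"
  shows "Hom B A W = {}"
proof (rule ccontr)
  assume "Hom B A W \<noteq> {}"
  then obtain f where f: "f \<in> Hom B A W" by blast
  have W: "W \<in> Obj B" and ini: "\<And>V. V \<in> Obj B \<Longrightarrow> \<exists>!h. h \<in> Hom B W V"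
    using assms(2) by (auto simp: is_finite_coproduct_def)
  have id: "Idn B W \<in> Hom B W W" using Idn_closed W .
  have "is_coproduct B W W W (Idn B W) (Idn B W)"
    unfolding is_coproduct_def using W id
    by (auto intro!: Comp_Idn) (metis Comp_Idn ini Hom_obj)+
  from Hom_atom_coproduct[OF assms(1) W W this]
  have "inj_on (case_sum (\<lambda>f. Idn B W \<cdot> f) (\<lambda>g. Idn B W \<cdot> g)) (Hom B A W <+> Hom B A W)"
    by (rule bij_betw_imp_inj_on)
  from inj_onD[OF this, of "Inl f" "Inr f"] f show False by auto
qed

text \<open>Splits off the last summand, which reduces finite co-products to the binary ones that
  \<open>Hom_atom_coproduct\<close> speaks of.\<close>

lemma finite_coproduct_Suc:
  assumes "is_finite_coproduct B (Suc n) X W w" "is_finite_coproduct B n X W' w'"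
  obtains i where "i \<in> Hom B W' W" "\<And>k. k < n \<Longrightarrow> i \<cdot> w' k = w k"
    "is_coproduct B W' (X n) W i (w n)"
proof -
  have W: "W \<in> Obj B" using assms(1) by (simp add: is_finite_coproduct_def)
  note w = finite_coproduct_in[OF assms(1)] and w' = finite_coproduct_in[OF assms(2)]
  obtain i where i: "i \<in> Hom B W' W" "\<And>k. k < n \<Longrightarrow> i \<cdot> w' k = w k"
    using finite_coproduct_ex[OF assms(2) W, of w] w by auto
  have "is_coproduct B W' (X n) W i (w n)"
    unfolding is_coproduct_def
  proof (intro conjI ballI)
    show "W \<in> Obj B" "i \<in> Hom B W' W" "w n \<in> Hom B (X n) W" using W i w by auto
    fix V f g assume V: "V \<in> Obj B" and f: "f \<in> Hom B W' V" and g: "g \<in> Hom B (X n) V"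
    let ?u = "\<lambda>k. if k < n then f \<cdot> w' k else g"
    have "?u k \<in> Hom B (X k) V" if "k < Suc n" for k
    proof (cases "k < n")
      case True then show ?thesis using Comp_closed[OF w' f] by simp
    next
      case False then show ?thesis using that g by (simp add: less_Suc_eq)
    qed
    from finite_coproduct_ex[OF assms(1) V this]
    obtain h where h: "h \<in> Hom B W V" "\<And>k. k < Suc n \<Longrightarrow> h \<cdot> w k = ?u k" by blast
    show "\<exists>!h. h \<in> Hom B W V \<and> h \<cdot> i = f \<and> h \<cdot> w n = g"
    proof (rule ex1I[of _ h], intro conjI)
      show "h \<in> Hom B W V" by fact
      show "h \<cdot> w n = g" using h by simp
      show "h \<cdot> i = f"
      proof (rule finite_coproduct_eq[OF assms(2) _ f])
        show "h \<cdot> i \<in> Hom B W' V" using h i Comp_closed by blast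
        fix k assume k: "k < n"
        have "(h \<cdot> i) \<cdot> w' k = h \<cdot> (i \<cdot> w' k)" using Comp_assoc w'[OF k] i h by blast
        then show "(h \<cdot> i) \<cdot> w' k = f \<cdot> w' k" using i h k by simp
      qed
      fix h' assume h': "h' \<in> Hom B W V \<and> h' \<cdot> i = f \<and> h' \<cdot> w n = g"
      show "h' = h"
      proof (rule finite_coproduct_eq[OF assms(1)])
        show "h' \<in> Hom B W V" "h \<in> Hom B W V" using h h' by auto
        fix k assume k: "k < Suc n"
        show "h' \<cdot> w k = h \<cdot> w k"
        proof (cases "k < n")
          case True
          have "h' \<cdot> (i \<cdot> w' k) = (h' \<cdot> i) \<cdot> w' k" using Comp_assoc w'[OF True] i h' by metis
          then show ?thesis using h' h True i by simp
        next
          case False then show ?thesis using h h' k by (auto simp: less_Suc_eq)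
        qed
      qed
    qed
  qed
  then show ?thesis using that i by blast
qed

text \<open>The finitary form of \<open>Hom_atom_coproduct\<close>. Surjectivity and injectivity
  stand in one statement so that a single induction, splitting off the last summand, yields
  both.\<close>

lemma atom_to_finite_coproduct:
  assumes A: "atom B A" and "is_finite_coproduct B n X W w" "\<And>k. k < n \<Longrightarrow> X k \<in> Obj B"
  shows "(\<forall>f \<in> Hom B A W. \<exists>k<n. \<exists>g \<in> Hom B A (X k). f = w k \<cdot> g) \<and>
    (\<forall>k<n. \<forall>l<n. \<forall>g \<in> Hom B A (X k). \<forall>h \<in> Hom B A (X l). w k \<cdot> g = w l \<cdot> h \<longrightarrow> k = l \<and> g = h)"
  using assms(2,3)
proof (induction n arbitrary: W w)
  case 0
  then show ?case using no_map_to_empty_coproduct[OF A 0(1)] by auto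
next
  case (Suc n)
  obtain W' w' where W': "is_finite_coproduct B n X W' w'"
    using finite_coproducts[of n X] Suc.prems(2) by auto
  obtain i where i: "i \<in> Hom B W' W" "\<And>k. k < n \<Longrightarrow> i \<cdot> w' k = w k"
    and cop: "is_coproduct B W' (X n) W i (w n)"
    using finite_coproduct_Suc[OF Suc.prems(1) W'] by blast
  note w' = finite_coproduct_in[OF W']
  have IH1: "\<And>f. f \<in> Hom B A W' \<Longrightarrow> \<exists>k<n. \<exists>g \<in> Hom B A (X k). f = w' k \<cdot> g"
    and IH2: "\<And>k l g h. k < n \<Longrightarrow> l < n \<Longrightarrow> g \<in> Hom B A (X k) \<Longrightarrow> h \<in> Hom B A (X l) \<Longrightarrow>
      w' k \<cdot> g = w' l \<cdot> h \<Longrightarrow> k = l \<and> g = h"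
    using Suc.IH[OF W'] Suc.prems(2) by (simp_all add: less_Suc_eq)
  have "W' \<in> Obj B" "X n \<in> Obj B" using W' Suc.prems(2) by (auto simp: is_finite_coproduct_def)
  from Hom_atom_coproduct[OF A this cop]
  have inj: "inj_on (case_sum (\<lambda>f. i \<cdot> f) (\<lambda>g. w n \<cdot> g)) (Hom B A W' <+> Hom B A (X n))"
    and im: "case_sum (\<lambda>f. i \<cdot> f) (\<lambda>g. w n \<cdot> g) ` (Hom B A W' <+> Hom B A (X n)) = Hom B A W"
    by (auto simp: bij_betw_def)
  have ll: "f = f'" if "f \<in> Hom B A W'" "f' \<in> Hom B A W'" "i \<cdot> f = i \<cdot> f'" for f f'
    using inj_onD[OF inj, of "Inl f" "Inl f'"] that by auto
  have rr: "f = f'" if "f \<in> Hom B A (X n)" "f' \<in> Hom B A (X n)" "w n \<cdot> f = w n \<cdot> f'" for f f'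
    using inj_onD[OF inj, of "Inr f" "Inr f'"] that by auto
  have lr: "i \<cdot> f \<noteq> w n \<cdot> f'" if "f \<in> Hom B A W'" "f' \<in> Hom B A (X n)" for f f'
    using inj_onD[OF inj, of "Inl f" "Inr f'"] that by auto
  have wk: "w k \<cdot> g = i \<cdot> (w' k \<cdot> g)" if "k < n" "g \<in> Hom B A (X k)" for k g
    using Comp_assoc[OF that(2) w'[OF that(1)] i(1)] i(2)[OF that(1)] by simp
  have w'g: "w' k \<cdot> g \<in> Hom B A W'" if "k < n" "g \<in> Hom B A (X k)" for k g
    using Comp_closed[OF that(2) w'[OF that(1)]] .
  show ?case
  proof (intro conjI ballI allI impI)
    fix f assume "f \<in> Hom B A W"
    then have "f \<in> case_sum (\<lambda>f. i \<cdot> f) (\<lambda>g. w n \<cdot> g) ` (Hom B A W' <+> Hom B A (X n))"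
      by (simp add: im)
    then consider g where "g \<in> Hom B A W'" "f = i \<cdot> g" | g where "g \<in> Hom B A (X n)" "f = w n \<cdot> g"
      by auto
    then show "\<exists>k<Suc n. \<exists>g \<in> Hom B A (X k). f = w k \<cdot> g"
    proof cases
      case 1
      with IH1 obtain k h where "k < n" "h \<in> Hom B A (X k)" "g = w' k \<cdot> h" by blast
      with 1 wk show ?thesis by (metis less_SucI)
    next
      case 2 then show ?thesis by blast
    qed
  next
    fix k l g h
    assume k: "k < Suc n" and l: "l < Suc n" and g: "g \<in> Hom B A (X k)" and h: "h \<in> Hom B A (X l)"
      and eq: "w k \<cdot> g = w l \<cdot> h"
    have "k = l \<and> g = h"
    proof (cases "k < n"; cases "l < n")
      assume a: "k < n" "l < n"
      then have "w' k \<cdot> g = w' l \<cdot> h" using eq wk g h w'g ll by metis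
      then show ?thesis using IH2 a g h by blast
    next
      assume a: "k < n" "\<not> l < n"
      then have "l = n" using l by simp
      then show ?thesis using lr wk w'g a g h eq by metis
    next
      assume a: "\<not> k < n" "l < n"
      then have "k = n" using k by simp
      then show ?thesis using lr wk w'g a g h eq by metis
    next
      assume a: "\<not> k < n" "\<not> l < n"
      then have "k = n" "l = n" using k l by auto
      then show ?thesis using rr g h eq by metis
    qed
    then show "k = l" "g = h" by auto
  qed
qed

lemma atom_factor:
  assumes "atom B A" "is_finite_coproduct B n X W w" "f \<in> Hom B A W"
    "\<And>k. k < n \<Longrightarrow> atom B (X k)"
  obtains k g where "k < n" "g \<in> Hom B A (X k)" "f = w k \<cdot> g"
proof -
  have "\<exists>k<n. \<exists>g \<in> Hom B A (X k). f = w k \<cdot> g"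
    by (rule atom_to_finite_coproduct[OF assms(1,2) atom_obj[OF assms(4)], THEN conjunct1, THEN bspec,
          OF _ assms(3)])
  then show ?thesis using that by blast
qed

lemma atom_factor_unique:
  assumes "atom B A" "is_finite_coproduct B n X W w" "\<And>k. k < n \<Longrightarrow> atom B (X k)"
    "k < n" "l < n" "g \<in> Hom B A (X k)" "h \<in> Hom B A (X l)" "w k \<cdot> g = w l \<cdot> h"
  shows "k = l" "g = h"
proof -
  have "k = l \<and> g = h"
    using atom_to_finite_coproduct[OF assms(1,2) atom_obj[OF assms(3)], THEN conjunct2] assms(4-)
    by blast
  then show "k = l" "g = h" by auto
qed

text \<open>A product is a fiber product over the final object. Its decomposition into atoms is
  returned as well, because graphs and orbits are located by the atom of the product that contains
  them.\<close>

lemma products: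
  assumes "X \<in> Obj B" "Y \<in> Obj B"
  shows "\<exists>P p q n D w. P \<in> Obj B \<and> p \<in> Hom B P X \<and> q \<in> Hom B P Y \<and> is_product B X Y P p q \<and>
    (\<forall>k<n. atom B (D k)) \<and> is_finite_coproduct B n D P w"
proof -
  obtain T where T: "is_final B T" using final_object by blast
  obtain f g where fg: "f \<in> Hom B X T" "g \<in> Hom B Y T"
    using T assms unfolding is_final_def by metis
  obtain P p q where P: "is_fiber_product B f g P p q"
    using fiber_products fg Hom_D by metis
  note D = fiber_product_D[OF P fg]
  have "is_product B X Y P p q"
    unfolding is_product_def
  proof (intro conjI ballI)
    fix V u v assume V: "V \<in> Obj B" and u: "u \<in> Hom B V X" and v: "v \<in> Hom B V Y"
    have "f \<cdot> u = g \<cdot> v"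
      using final_unique[OF T Comp_closed[OF u fg(1)] Comp_closed[OF v fg(2)]] .
    moreover have d: "Dom B f = X" "Dom B g = Y" using fg Hom_D by blast+
    ultimately show "\<exists>!h. h \<in> Hom B V P \<and> p \<cdot> h = u \<and> q \<cdot> h = v"
      using P V u v unfolding is_fiber_product_def d by blast
  qed (use D in auto)
  moreover obtain n D w where "\<forall>k<n. atom B (D k)" "is_finite_coproduct B n D P w"
    using decomposition D(1) by blast
  ultimately show ?thesis using D by blast
qed

lemma product_lift:
  assumes "is_product B X Y P p q" "u \<in> Hom B V X" "v \<in> Hom B V Y"
  obtains h where "h \<in> Hom B V P" "p \<cdot> h = u" "q \<cdot> h = v"
proof -
  have "V \<in> Obj B" using Hom_obj assms(2) by blast
  then have "\<exists>!h. h \<in> Hom B V P \<and> p \<cdot> h = u \<and> q \<cdot> h = v"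
    using assms unfolding is_product_def by blast
  then show ?thesis using that by blast
qed

lemma product_eq:
  assumes "is_product B X Y P p q" "h \<in> Hom B V P" "h' \<in> Hom B V P"
    and "p \<cdot> h = p \<cdot> h'" "q \<cdot> h = q \<cdot> h'"
  shows "h = h'"
proof -
  have "p \<in> Hom B P X" "q \<in> Hom B P Y" using assms(1) by (auto simp: is_product_def)
  then have "p \<cdot> h' \<in> Hom B V X" "q \<cdot> h' \<in> Hom B V Y" using assms(3) Comp_closed by blast+
  moreover have "V \<in> Obj B" using assms Hom_obj by blast
  ultimately have "\<exists>!k. k \<in> Hom B V P \<and> p \<cdot> k = p \<cdot> h' \<and> q \<cdot> k = q \<cdot> h'"
    using assms(1) unfolding is_product_def by blast
  then show ?thesis using assms by blast
qed

text \<open>The graph of a map \<open>X \<rightarrow> Y\<close> out of an atom is one of the atoms of \<open>X \<times> Y\<close>: its inclusion of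
  \<open>X\<close> is a split monomorphism of atoms, hence invertible.\<close>

lemma graph_determines_map:
  assumes X: "atom B X" and D: "atom B D" and w: "w \<in> Hom B D P"
    and p: "p \<in> Hom B P X"
    and g: "g \<in> Hom B X D" "p \<cdot> (w \<cdot> g) = Idn B X"
    and h: "h \<in> Hom B X D" "p \<cdot> (w \<cdot> h) = Idn B X"
  shows "g = h"
proof -
  have pw: "p \<cdot> w \<in> Hom B D X" using w p Comp_closed by blast
  have g': "(p \<cdot> w) \<cdot> g = Idn B X" and h': "(p \<cdot> w) \<cdot> h = Idn B X"
    using Comp_assoc w p g h by metis+
  have "is_iso B g"
    using mono_atoms_iso[OF X D g(1)] split_mono[OF g(1) pw g'] by blast
  then obtain k where k: "k \<in> Hom B D X" "g \<cdot> k = Idn B D" using is_iso_Hom g(1) by blast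
  have "k = p \<cdot> w"
    using cancel_section[OF g' g(1) pw k(1)] Comp_Idn[OF pw] k(2) by simp
  then have "g \<cdot> ((p \<cdot> w) \<cdot> h) = h"
    using cancel_section[OF k(2,1) g(1) h(1)] by simp
  then show ?thesis using h' Comp_Idn[OF g(1)] by simp
qed

text \<open>The index \<open>k\<close> of the atom of \<open>X \<times> Y\<close> through which the
  graph of a map passes determines the map, so there are at most \<open>n\<close> maps.\<close>

lemma finite_Hom:
  assumes X: "atom B X" and Y: "Y \<in> Obj B"
  shows "finite (Hom B X Y)"
proof -
  obtain P p q n D w where P: "P \<in> Obj B" "p \<in> Hom B P X" "q \<in> Hom B P Y" "is_product B X Y P p q"
    and "\<forall>k<n. atom B (D k)" and w: "is_finite_coproduct B n D P w"
    using products[OF atom_obj[OF X] Y] by (elim exE conjE) (rule that)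
  then have D: "\<And>k. k < n \<Longrightarrow> atom B (D k)" by blast
  have id: "Idn B X \<in> Hom B X X" using Idn_closed atom_obj X by blast
  \<comment> \<open>\<open>G k\<close> is a section chosen without reference to \<open>f\<close>.
    Where a section exists, \<open>graph_determines_map\<close> says that it is the only one, so
    \<open>f\<close> can be recovered from \<open>k\<close>.\<close>
  define G where "G k = (SOME g. g \<in> Hom B X (D k) \<and> p \<cdot> (w k \<cdot> g) = Idn B X)" for k
  have "f \<in> (\<lambda>k. q \<cdot> (w k \<cdot> G k)) ` {..<n}" if f: "f \<in> Hom B X Y" for f
  proof -
    obtain u where u: "u \<in> Hom B X P" "p \<cdot> u = Idn B X" "q \<cdot> u = f"
      using product_lift[OF P(4) id f] by blast
    obtain k g where k: "k < n" and g: "g \<in> Hom B X (D k)" "u = w k \<cdot> g"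
      using atom_factor[OF X w u(1) D] by blast
    have g': "p \<cdot> (w k \<cdot> g) = Idn B X" using u(2) g(2) by simp
    have G: "G k \<in> Hom B X (D k)" "p \<cdot> (w k \<cdot> G k) = Idn B X"
      unfolding G_def by (rule someI2[of _ g], use g(1) g' in simp, simp)+
    have "g = G k"
      by (rule graph_determines_map[OF X D[OF k] finite_coproduct_in[OF w k] P(2) g(1) g' G])
    then show ?thesis using u(3) g(2) k by (intro image_eqI[of _ _ k]) simp_all
  qed
  then show ?thesis using finite_subset[of "Hom B X Y"] by blast
qed

text \<open>The graphs \<open>a\<close> of \<open>u\<close> and \<open>b\<close> of \<open>v\<close>
  agree after composition with \<open>e\<close>. A map out of the atom \<open>X\<close> lies in one
  atom of \<open>Y \<times> Z\<close> only, so \<open>a\<close> and \<open>b\<close> pass through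
  the same atom, and there \<open>graph_determines_map\<close> leaves room for one section.\<close>

lemma atom_map_epi:
  assumes X: "atom B X" and Y: "atom B Y" and e: "e \<in> Hom B X Y"
    and u: "u \<in> Hom B Y Z" and v: "v \<in> Hom B Y Z" and eq: "u \<cdot> e = v \<cdot> e"
  shows "u = v"
proof -
  have Z: "Z \<in> Obj B" using u Hom_obj by blast
  obtain P p q n D w where P: "P \<in> Obj B" "p \<in> Hom B P Y" "q \<in> Hom B P Z" "is_product B Y Z P p q"
    and "\<forall>k<n. atom B (D k)" and w: "is_finite_coproduct B n D P w"
    using products[OF atom_obj[OF Y] Z] by (elim exE conjE) (rule that)
  then have D: "\<And>k. k < n \<Longrightarrow> atom B (D k)" by blast
  have id: "Idn B Y \<in> Hom B Y Y" using Idn_closed atom_obj Y by blast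
  obtain a where a: "a \<in> Hom B Y P" "p \<cdot> a = Idn B Y" "q \<cdot> a = u"
    using product_lift[OF P(4) id u] by blast
  obtain b where b: "b \<in> Hom B Y P" "p \<cdot> b = Idn B Y" "q \<cdot> b = v"
    using product_lift[OF P(4) id v] by blast
  obtain k g where g: "k < n" "g \<in> Hom B Y (D k)" "a = w k \<cdot> g"
    using atom_factor[OF Y w a(1) D] by blast
  obtain l h where h: "l < n" "h \<in> Hom B Y (D l)" "b = w l \<cdot> h"
    using atom_factor[OF Y w b(1) D] by blast
  have ae: "a \<cdot> e = b \<cdot> e"
  proof (rule product_eq[OF P(4)])
    show "a \<cdot> e \<in> Hom B X P" "b \<cdot> e \<in> Hom B X P" using a b e Comp_closed by blast+
    show "p \<cdot> (a \<cdot> e) = p \<cdot> (b \<cdot> e)" using Comp_assoc[OF e a(1) P(2)] Comp_assoc[OF e b(1) P(2)] a b by simp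
    show "q \<cdot> (a \<cdot> e) = q \<cdot> (b \<cdot> e)" using Comp_assoc[OF e a(1) P(3)] Comp_assoc[OF e b(1) P(3)] a b eq by simp
  qed
  have "w k \<cdot> (g \<cdot> e) = w l \<cdot> (h \<cdot> e)"
    using ae Comp_assoc[OF e g(2) finite_coproduct_in[OF w g(1)]]
      Comp_assoc[OF e h(2) finite_coproduct_in[OF w h(1)]] g h by simp
  then have kl: "k = l"
    using atom_factor_unique(1)[OF X w D g(1) h(1)] Comp_closed[OF e] g(2) h(2) by blast
  have h': "h \<in> Hom B Y (D k)" "b = w k \<cdot> h" using h kl by auto
  have "p \<cdot> (w k \<cdot> g) = Idn B Y" "p \<cdot> (w k \<cdot> h) = Idn B Y"
    using a(2) b(2) g(3) h'(2) by auto
  then have "g = h"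
    by (intro graph_determines_map[OF Y D[OF g(1)] finite_coproduct_in[OF w g(1)] P(2) g(2) _ h'(1)])
  then show ?thesis using a(3) b(3) g(3) h'(2) by simp
qed

text \<open>A decomposition without summands would make the object initial, hence empty.\<close>

lemma nonempty_atom_map:
  assumes "X \<in> Obj B" "\<not> is_empty B X"
  obtains A u where "atom B A" "u \<in> Hom B A X"
proof -
  obtain n A w where A: "\<forall>k<n. atom B (A k)" "is_finite_coproduct B n A X w"
    using decomposition assms(1) by blast
  have "n \<noteq> 0"
  proof
    assume "n = 0"
    then have "is_initial B X" using A(2) by (auto simp: is_finite_coproduct_def is_initial_def)
    then show False using assms isomorphic_refl unfolding is_empty_def by blast
  qed
  then show ?thesis using A that finite_coproduct_in[OF A(2), of 0] by auto
qed

end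

context nondegenerate_B_category begin

text \<open>Any atom that maps to the fiber product will do, and
  \<open>fiber_product_nonempty\<close> guarantees that there is one. The generic chain is built
  from this property.\<close>

lemma amalgamation:
  assumes "atom B X" "atom B Y" "atom B Z" "f \<in> Hom B X Z" "g \<in> Hom B Y Z"
  obtains W p q where "atom B W" "p \<in> Hom B W X" "q \<in> Hom B W Y" "f \<cdot> p = g \<cdot> q"
proof -
  obtain P p q where P: "is_fiber_product B f g P p q"
    using fiber_products assms(4,5) Hom_D by metis
  note D = fiber_product_D[OF P assms(4,5)]
  obtain W u where W: "atom B W" "u \<in> Hom B W P"
    using nonempty_atom_map[OF D(1)] fiber_product_nonempty[OF assms P] by blast
  have "f \<cdot> (p \<cdot> u) = g \<cdot> (q \<cdot> u)"
    using Comp_assoc[OF W(2) D(2) assms(4)] Comp_assoc[OF W(2) D(3) assms(5)] D(4) by simp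
  then show ?thesis using that[OF W(1), of "p \<cdot> u" "q \<cdot> u"] Comp_closed W D by blast
qed

end

section \<open>Fiber functors\<close>

text \<open>An axiomatic form of the colimit functor. \<open>common_atom\<close> says that any two
  points come from one point of an atom, and \<open>rigid\<close> that a map out of an atom is
  determined by its value at one point; together they turn equations between points into equations
  between maps. \<open>M_surj\<close> is the extension property behind the back-and-forth. The atoms
  \<open>s k\<close> represent all atoms up to isomorphism, so that countably many tasks
  suffice.\<close>

locale fiber_functor = nondegenerate_B_category B for B :: "('o, 'a) cat" (structure) +
  fixes F :: "'o \<Rightarrow> nat set" and M :: "'a \<Rightarrow> nat \<Rightarrow> nat" and s :: "nat \<Rightarrow> 'o"
  assumes M_closed: "f \<in> Hom B X Y \<Longrightarrow> x \<in> F X \<Longrightarrow> M f x \<in> F Y"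
    and M_Idn: "X \<in> Obj B \<Longrightarrow> x \<in> F X \<Longrightarrow> M (Idn B X) x = x"
    and M_Comp: "f \<in> Hom B X Y \<Longrightarrow> g \<in> Hom B Y Z \<Longrightarrow> x \<in> F X \<Longrightarrow> M (g \<cdot> f) x = M g (M f x)"
    and common_atom: "X \<in> Obj B \<Longrightarrow> Y \<in> Obj B \<Longrightarrow> x \<in> F X \<Longrightarrow> y \<in> F Y \<Longrightarrow>
      \<exists>A a u v. atom B A \<and> a \<in> F A \<and> u \<in> Hom B A X \<and> v \<in> Hom B A Y \<and> M u a = x \<and> M v a = y"
    and rigid: "atom B A \<Longrightarrow> a \<in> F A \<Longrightarrow> u \<in> Hom B A X \<Longrightarrow> v \<in> Hom B A X \<Longrightarrow> M u a = M v a \<Longrightarrow> u = v"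
    and M_surj: "atom B A \<Longrightarrow> atom B A' \<Longrightarrow> u \<in> Hom B A' A \<Longrightarrow> a \<in> F A \<Longrightarrow> \<exists>a' \<in> F A'. M u a' = a"
    and F_nonempty: "atom B A \<Longrightarrow> \<exists>a. a \<in> F A"
    and s_atom: "atom B (s k)"
    and s_exhaustive: "atom B A \<Longrightarrow> \<exists>k. isomorphic B A (s k)"
begin

section \<open>Points of fiber products, products and co-products\<close>

lemma common_atomE:
  assumes "X \<in> Obj B" "Y \<in> Obj B" "x \<in> F X" "y \<in> F Y"
  obtains A a u v where "atom B A" "a \<in> F A" "u \<in> Hom B A X" "v \<in> Hom B A Y" "M u a = x" "M v a = y"
  using common_atom[OF assms] by (elim exE conjE) (rule that)

text \<open>Both points come from one \<open>a \<in> F A\<close>. By \<open>rigid\<close>, the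
  equality of their images in \<open>F Z\<close> is an equality of maps out of \<open>A\<close>, so
  these maps induce one into \<open>P\<close>, and its value at \<open>a\<close> is the wanted
  point.\<close>

lemma fiber_product_point:
  assumes P: "is_fiber_product B f g P p q" and f: "f \<in> Hom B X Z" and g: "g \<in> Hom B Y Z"
    and x: "x \<in> F X" and y: "y \<in> F Y" and eq: "M f x = M g y"
  shows "\<exists>z \<in> F P. M p z = x \<and> M q z = y"
proof -
  obtain A a u v where A: "atom B A" "a \<in> F A" and u: "u \<in> Hom B A X" and v: "v \<in> Hom B A Y"
    and xy: "M u a = x" "M v a = y"
    using Hom_obj f g by (elim common_atomE[OF _ _ x y, rotated 2]) auto
  note D = fiber_product_D[OF P f g]
  have "M (f \<cdot> u) a = M (g \<cdot> v) a"
    using M_Comp[OF u f A(2)] M_Comp[OF v g A(2)] xy eq by simp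
  then have "f \<cdot> u = g \<cdot> v"
    using rigid[OF A Comp_closed[OF u f] Comp_closed[OF v g]] by simp
  then obtain h where h: "h \<in> Hom B A P" "p \<cdot> h = u" "q \<cdot> h = v"
    using fiber_product_lift[OF P f g u v] by blast
  then show ?thesis
    using M_Comp[OF h(1) D(2) A(2)] M_Comp[OF h(1) D(3) A(2)] xy M_closed[OF h(1) A(2)]
    by (intro bexI[of _ "M h a"]) auto
qed

lemma product_D:
  assumes "is_product B X Y P p q"
  shows "P \<in> Obj B" "p \<in> Hom B P X" "q \<in> Hom B P Y"
  using assms by (auto simp: is_product_def)

lemma product_point:
  assumes P: "is_product B X Y P p q" and x: "x \<in> F X" and y: "y \<in> F Y"
  shows "\<exists>z \<in> F P. M p z = x \<and> M q z = y"
proof -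
  note D = product_D[OF P]
  obtain A a u v where A: "atom B A" "a \<in> F A" and u: "u \<in> Hom B A X" and v: "v \<in> Hom B A Y"
    and xy: "M u a = x" "M v a = y"
    using Hom_obj[OF D(2)] Hom_obj[OF D(3)] by (elim common_atomE[OF _ _ x y, rotated 2]) auto
  obtain h where h: "h \<in> Hom B A P" "p \<cdot> h = u" "q \<cdot> h = v"
    using product_lift[OF P u v] by blast
  then show ?thesis
    using M_Comp[OF h(1) D(2) A(2)] M_Comp[OF h(1) D(3) A(2)] xy M_closed[OF h(1) A(2)]
    by (intro bexI[of _ "M h a"]) auto
qed

text \<open>Two points of \<open>F P\<close> are the values of maps \<open>u\<close> and
  \<open>v\<close> at a common point. If the coordinates of the points agree, \<open>rigid\<close>
  identifies the coordinates of the maps.\<close>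

lemma product_point_unique:
  assumes P: "is_product B X Y P p q" and z: "z \<in> F P" and z': "z' \<in> F P"
    and eq: "M p z = M p z'" "M q z = M q z'"
  shows "z = z'"
proof -
  note D = product_D[OF P]
  obtain A a u v where A: "atom B A" "a \<in> F A" and u: "u \<in> Hom B A P" and v: "v \<in> Hom B A P"
    and zz: "M u a = z" "M v a = z'"
    by (rule common_atomE[OF D(1) D(1) z z'])
  have "p \<cdot> u = p \<cdot> v"
    using rigid[OF A Comp_closed[OF u D(2)] Comp_closed[OF v D(2)]] eq zz
      M_Comp[OF u D(2) A(2)] M_Comp[OF v D(2) A(2)] by simp
  moreover have "q \<cdot> u = q \<cdot> v"
    using rigid[OF A Comp_closed[OF u D(3)] Comp_closed[OF v D(3)]] eq zz
      M_Comp[OF u D(3) A(2)] M_Comp[OF v D(3) A(2)] by simp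
  ultimately have "u = v" by (rule product_eq[OF P u v])
  then show ?thesis using zz by simp
qed

text \<open>Together with \<open>coproduct_point_unique\<close>: \<open>F\<close> turns a co-product
  of atoms into a disjoint union. A point is the value of a map out of an atom, and such a map
  factors through a single summand.\<close>

lemma coproduct_point:
  assumes W: "is_finite_coproduct B n A X w" and A: "\<And>k. k < n \<Longrightarrow> atom B (A k)" and x: "x \<in> F X"
  obtains k a where "k < n" "a \<in> F (A k)" "M (w k) a = x"
proof -
  have X: "X \<in> Obj B" using W by (simp add: is_finite_coproduct_def)
  obtain C c u v where C: "atom B C" "c \<in> F C" and u: "u \<in> Hom B C X" and c: "M u c = x"
    and "v \<in> Hom B C X" "M v c = x"
    by (rule common_atomE[OF X X x x])
  obtain k g where k: "k < n" and g: "g \<in> Hom B C (A k)" and ug: "u = w k \<cdot> g"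
    using atom_factor[OF C(1) W u A] by blast
  have "M (w k) (M g c) = x"
    using M_Comp[OF g finite_coproduct_in[OF W k] C(2)] c ug by simp
  then show ?thesis using that[OF k M_closed[OF g C(2)]] by blast
qed

lemma coproduct_point_unique:
  assumes W: "is_finite_coproduct B n A X w" and A: "\<And>k. k < n \<Longrightarrow> atom B (A k)"
    and k: "k < n" and l: "l < n" and a: "a \<in> F (A k)" and b: "b \<in> F (A l)"
    and eq: "M (w k) a = M (w l) b"
  shows "k = l" "a = b"
proof -
  obtain C c u v where C: "atom B C" "c \<in> F C" and u: "u \<in> Hom B C (A k)" and v: "v \<in> Hom B C (A l)"
    and c: "M u c = a" "M v c = b"
    by (rule common_atomE[OF atom_obj[OF A[OF k]] atom_obj[OF A[OF l]] a b])
  note wk = finite_coproduct_in[OF W k] and wl = finite_coproduct_in[OF W l]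
  have "w k \<cdot> u = w l \<cdot> v"
    using rigid[OF C Comp_closed[OF u wk] Comp_closed[OF v wl]] eq c
      M_Comp[OF u wk C(2)] M_Comp[OF v wl C(2)] by simp
  note kl = atom_factor_unique[OF C(1) W A k l u v this]
  show "k = l" by (rule kl)
  show "a = b" using c kl by simp
qed

text \<open>The atom is the summand containing \<open>x\<close>. Injectivity of its inclusion on
  points is recorded because it allows stabilizers and points of \<open>F X\<close> to be pulled
  back to \<open>F A\<close>.\<close>

lemma atom_point:
  assumes X: "X \<in> Obj B" and x: "x \<in> F X"
  obtains A a w where "atom B A" "a \<in> F A" "w \<in> Hom B A X" "M w a = x" "inj_on (M w) (F A)"
proof -
  obtain n A w where A: "\<forall>k<n. atom B (A k)" and W: "is_finite_coproduct B n A X w"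
    using decomposition[OF X] by blast
  then have A': "\<And>k. k < n \<Longrightarrow> atom B (A k)" by blast
  obtain k a where k: "k < n" "a \<in> F (A k)" "M (w k) a = x"
    using coproduct_point[OF W A' x] by blast
  have "inj_on (M (w k)) (F (A k))"
    using coproduct_point_unique(2)[OF W A' k(1) k(1)] by (rule inj_onI)
  then show ?thesis using that A' finite_coproduct_in[OF W] k by blast
qed

section \<open>Homogeneity by back-and-forth\<close>

definition natural_automorphism :: "('o \<Rightarrow> nat \<Rightarrow> nat) \<Rightarrow> bool" where
  "natural_automorphism \<alpha> \<longleftrightarrow> (\<forall>X \<in> Obj B. bij_betw (\<alpha> X) (F X) (F X)) \<and>
    (\<forall>X Y. \<forall>f \<in> Hom B X Y. \<forall>x \<in> F X. \<alpha> Y (M f x) = M f (\<alpha> X x))"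

text \<open>\<open>(A, a, b)\<close> stands for the partial automorphism sending \<open>a \<in> F A\<close> to \<open>b \<in> F A\<close>.\<close>

definition partial_aut :: "'o \<times> nat \<times> nat \<Rightarrow> bool" where
  "partial_aut = (\<lambda>(A, a, b). atom B A \<and> a \<in> F A \<and> b \<in> F A)"

text \<open>One and the same \<open>u\<close> carries both points down; this makes the larger
  partial automorphism compatible with the smaller one.\<close>

definition extends :: "'o \<times> nat \<times> nat \<Rightarrow> 'o \<times> nat \<times> nat \<Rightarrow> bool" where
  "extends = (\<lambda>(A, a, b) (A', a', b'). \<exists>u \<in> Hom B A' A. M u a' = a \<and> M u b' = b)"

lemma extends_refl: "partial_aut t \<Longrightarrow> extends t t"
  using Idn_closed M_Idn atom_obj by (fastforce simp: partial_aut_def extends_def)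

lemma extends_trans:
  assumes "extends t t'" "extends t' t''" "partial_aut t''"
  shows "extends t t''"
proof -
  obtain A a b A' a' b' A'' a'' b'' where t: "t = (A, a, b)" "t' = (A', a', b')" "t'' = (A'', a'', b'')"
    by (metis prod_cases3)
  obtain u v where u: "u \<in> Hom B A' A" "M u a' = a" "M u b' = b"
    and v: "v \<in> Hom B A'' A'" "M v a'' = a'" "M v b'' = b'"
    using assms by (auto simp: t extends_def)
  have "a'' \<in> F A''" "b'' \<in> F A''" using assms(3) by (auto simp: t partial_aut_def)
  then show ?thesis
    using M_Comp[OF v(1) u(1)] u v Comp_closed[OF v(1) u(1)]
    by (auto simp: t extends_def intro!: bexI[of _ "u \<cdot> v"])
qed

text \<open>The domain grows by passing to an atom \<open>A'\<close> over both \<open>A\<close> and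
  \<open>Z\<close>; along the same map the image \<open>b\<close> lifts to some \<open>b'\<close> by
  \<open>M_surj\<close>. Any lift is good, because \<open>partial_aut\<close> asks nothing of two
  points beyond lying over the same atom.\<close>

lemma forth_step:
  assumes t: "partial_aut t" and Z: "Z \<in> Obj B" and z: "z \<in> F Z"
  obtains A' a' b' v where "partial_aut (A', a', b')" "extends t (A', a', b')"
    "v \<in> Hom B A' Z" "M v a' = z"
proof -
  obtain A a b where [simp]: "t = (A, a, b)" by (cases t)
  have A: "atom B A" "a \<in> F A" "b \<in> F A" using t by (auto simp: partial_aut_def)
  obtain A' a' u v where A': "atom B A'" "a' \<in> F A'" and u: "u \<in> Hom B A' A" "M u a' = a"
    and v: "v \<in> Hom B A' Z" "M v a' = z"
    using common_atom[OF atom_obj[OF A(1)] Z A(2) z] by blast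
  obtain b' where b': "b' \<in> F A'" "M u b' = b" using M_surj[OF A(1) A'(1) u(1) A(3)] by blast
  show ?thesis
    using A A' u v b' by (intro that[of A' a' b' v]) (auto simp: partial_aut_def extends_def)
qed

text \<open>The roles of \<open>a\<close> and \<open>b\<close> are symmetric, so this is
  \<open>forth_step\<close> for the inverse partial automorphism.\<close>

lemma back_step:
  assumes t: "partial_aut t" and Z: "Z \<in> Obj B" and z: "z \<in> F Z"
  obtains A' a' b' v where "partial_aut (A', a', b')" "extends t (A', a', b')"
    "v \<in> Hom B A' Z" "M v b' = z"
proof -
  obtain A a b where [simp]: "t = (A, a, b)" by (cases t)
  have t': "partial_aut (A, b, a)" using t by (auto simp: partial_aut_def)
  obtain A' a' b' v where *: "partial_aut (A', b', a')" "extends (A, b, a) (A', b', a')"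
    "v \<in> Hom B A' Z" "M v b' = z"
    using forth_step[OF t' Z z] by blast
  then show ?thesis by (intro that[of A' a' b' v]) (auto simp: partial_aut_def extends_def)
qed

lemma back_and_forth:
  assumes t: "partial_aut t" and Z: "Z \<in> Obj B" and z: "z \<in> F Z"
  shows "\<exists>A a b. partial_aut (A, a, b) \<and> extends t (A, a, b) \<and>
    (\<exists>v \<in> Hom B A Z. M v a = z) \<and> (\<exists>v \<in> Hom B A Z. M v b = z)"
proof -
  obtain A1 a1 b1 v1 where 1: "partial_aut (A1, a1, b1)" "extends t (A1, a1, b1)"
    "v1 \<in> Hom B A1 Z" "M v1 a1 = z"
    using forth_step[OF t Z z] by blast
  obtain A a b v where 2: "partial_aut (A, a, b)" "extends (A1, a1, b1) (A, a, b)"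
    "v \<in> Hom B A Z" "M v b = z"
    using back_step[OF 1(1) Z z] by blast
  obtain u where u: "u \<in> Hom B A A1" "M u a = a1" using 2(2) by (auto simp: extends_def)
  have a: "a \<in> F A" using 2(1) by (simp add: partial_aut_def)
  have "M (v1 \<cdot> u) a = z" using M_Comp[OF u(1) 1(3) a] u 1(4) by simp
  then show ?thesis
    using 2 extends_trans[OF 1(2) 2(2,1)] Comp_closed[OF u(1) 1(3)] by blast
qed

text \<open>The union of the graphs of all stages, seen in \<open>F X\<close>: the stage
  \<open>(A, a, b)\<close> sends \<open>M v a\<close> to \<open>M v b\<close> for every map
  \<open>v\<close> out of \<open>A\<close>.\<close>

definition limit_rel :: "(nat \<Rightarrow> 'o \<times> nat \<times> nat) \<Rightarrow> 'o \<Rightarrow> nat \<Rightarrow> nat \<Rightarrow> bool" where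
  "limit_rel t X x y \<longleftrightarrow> (\<exists>n. case t n of (A, a, b) \<Rightarrow> \<exists>v \<in> Hom B A X. M v a = x \<and> M v b = y)"

lemma limit_relI:
  assumes "t n = (A, a, b)" "v \<in> Hom B A X"
  shows "limit_rel t X (M v a) (M v b)"
  unfolding limit_rel_def using assms by (intro exI[of _ n]) auto

text \<open>Two witnesses are compared at the later of their stages. There they become maps out of
  one atom that agree at \<open>a\<close>, so \<open>rigid\<close> makes them equal, and they agree
  at \<open>b\<close> too.\<close>

lemma limit_rel_functional:
  assumes t: "\<And>n. partial_aut (t n)" and ext: "\<And>n m. n \<le> m \<Longrightarrow> extends (t n) (t m)"
    and xy: "limit_rel t X x y" and xy': "limit_rel t X x y'"
  shows "y = y'"
proof -
  obtain n An an bn v where n: "t n = (An, an, bn)" "v \<in> Hom B An X" "M v an = x" "M v bn = y"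
    using xy by (auto simp: limit_rel_def)
  obtain m Am am bm v' where m: "t m = (Am, am, bm)" "v' \<in> Hom B Am X" "M v' am = x" "M v' bm = y'"
    using xy' by (auto simp: limit_rel_def)
  obtain A a b where k: "t (max n m) = (A, a, b)" by (cases "t (max n m)")
  obtain u where u: "u \<in> Hom B A An" "M u a = an" "M u b = bn"
    using ext[of n "max n m"] by (auto simp: k n extends_def)
  obtain u' where u': "u' \<in> Hom B A Am" "M u' a = am" "M u' b = bm"
    using ext[of m "max n m"] by (auto simp: k m extends_def)
  have A: "atom B A" "a \<in> F A" "b \<in> F A" using t[of "max n m"] by (auto simp: k partial_aut_def)
  have "M (v \<cdot> u) a = M (v' \<cdot> u') a"
    using M_Comp[OF u(1) n(2) A(2)] M_Comp[OF u'(1) m(2) A(2)] u u' n m by simp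
  then have "v \<cdot> u = v' \<cdot> u'"
    by (rule rigid[OF A(1,2) Comp_closed[OF u(1) n(2)] Comp_closed[OF u'(1) m(2)]])
  then show ?thesis
    using M_Comp[OF u(1) n(2) A(3)] M_Comp[OF u'(1) m(2) A(3)] u u' n m by simp
qed

text \<open>Reaching all points of the listed atoms is enough: a point of \<open>X\<close> comes
  from a point of an atom, and that atom is isomorphic to some \<open>s k\<close>.\<close>

lemma limit_rel_total:
  assumes t: "\<And>n. partial_aut (t n)"
    and cov: "\<And>k z. z \<in> F (s k) \<Longrightarrow> \<exists>n. case t n of (A, a, b) \<Rightarrow> \<exists>v \<in> Hom B A (s k). M v a = z"
    and X: "X \<in> Obj B" and x: "x \<in> F X"
  shows "\<exists>y \<in> F X. limit_rel t X x y"
proof -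
  obtain C c w where C: "atom B C" "c \<in> F C" "w \<in> Hom B C X" "M w c = x"
    using atom_point[OF X x] by blast
  obtain k where "isomorphic B C (s k)" using s_exhaustive[OF C(1)] by blast
  then obtain f g where f: "f \<in> Hom B C (s k)" and g: "g \<in> Hom B (s k) C" and gf: "g \<cdot> f = Idn B C"
    by (rule isomorphicE)
  obtain n A a b v where n: "t n = (A, a, b)" and v: "v \<in> Hom B A (s k)" "M v a = M f c"
    using cov[OF M_closed[OF f C(2)]] by auto
  have A: "a \<in> F A" "b \<in> F A" using t[of n] by (auto simp: n partial_aut_def)
  let ?h = "w \<cdot> (g \<cdot> v)"
  have gv: "g \<cdot> v \<in> Hom B A C" using Comp_closed[OF v(1) g] .
  then have h: "?h \<in> Hom B A X" using Comp_closed C(3) by blast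
  have "M (g \<cdot> v) a = c"
    using M_Comp[OF v(1) g A(1)] M_Comp[OF f g C(2)] v(2) gf M_Idn[OF atom_obj[OF C(1)] C(2)] by simp
  then have "M ?h a = x" using M_Comp[OF gv C(3) A(1)] C(4) by simp
  then have "limit_rel t X x (M ?h b)" using limit_relI[of t, OF n h] by simp
  then show ?thesis using M_closed[OF h A(2)] by blast
qed

lemma limit_rel_swap: "limit_rel (\<lambda>n. case t n of (A, a, b) \<Rightarrow> (A, b, a)) X x y \<longleftrightarrow> limit_rel t X y x"
  unfolding limit_rel_def by (rule ex_cong1) (auto split: prod.split)

lemma limit_rel_in:
  assumes t: "\<And>n. partial_aut (t n)" and "limit_rel t X x y"
  shows "x \<in> F X" "y \<in> F X"
proof -
  obtain n A a b v where n: "t n = (A, a, b)" and v: "v \<in> Hom B A X" "M v a = x" "M v b = y"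
    using assms(2) by (auto simp: limit_rel_def)
  have "a \<in> F A" "b \<in> F A" using t[of n] by (auto simp: n partial_aut_def)
  then show "x \<in> F X" "y \<in> F X" using M_closed[OF v(1)] v by auto
qed

lemma limit_rel_natural:
  assumes t: "\<And>n. partial_aut (t n)" and xy: "limit_rel t X x y" and f: "f \<in> Hom B X Y"
  shows "limit_rel t Y (M f x) (M f y)"
proof -
  obtain n A a b v where n: "t n = (A, a, b)" and v: "v \<in> Hom B A X" "M v a = x" "M v b = y"
    using xy by (auto simp: limit_rel_def)
  have "a \<in> F A" "b \<in> F A" using t[of n] by (auto simp: n partial_aut_def)
  then have "M (f \<cdot> v) a = M f x" "M (f \<cdot> v) b = M f y" using M_Comp[OF v(1) f] v by auto
  then show ?thesis using limit_relI[of t, OF n Comp_closed[OF v(1) f]] by simp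
qed

lemma homogeneous:
  assumes A: "atom B A" and x: "x \<in> F A" and y: "y \<in> F A"
  obtains \<alpha> where "natural_automorphism \<alpha>" "\<alpha> A x = y"
proof -
  \<comment> \<open>Task \<open>n\<close> is a pair \<open>(k, z)\<close>: the point
    \<open>z\<close> of \<open>F (s k)\<close> has to enter both the domain and the range of the
    stage \<open>Suc n\<close>. A number \<open>z\<close> outside \<open>F (s k)\<close> poses no
    task.\<close>
  define covers where "covers n t' \<longleftrightarrow> (case prod_decode n of (k, z) \<Rightarrow> z \<in> F (s k) \<longrightarrow>
    (case t' of (A, a, b) \<Rightarrow> (\<exists>v \<in> Hom B A (s k). M v a = z) \<and> (\<exists>v \<in> Hom B A (s k). M v b = z)))" for n t'
  define P where "P n t \<longleftrightarrow> partial_aut t \<and> (n = 0 \<longrightarrow> t = (A, x, y))" for n :: nat and t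
  define Q where "Q n t t' \<longleftrightarrow> extends t t' \<and> covers n t'" for n t t'
  have "\<exists>t. \<forall>n. P n (t n) \<and> Q n (t n) (t (Suc n))"
  proof (rule dependent_nat_choice)
    show "\<exists>t. P 0 t" using A x y by (auto simp: P_def partial_aut_def)
    fix t n assume "P n t"
    then have t: "partial_aut t" by (simp add: P_def)
    obtain k z where kz: "prod_decode n = (k, z)" by (cases "prod_decode n")
    show "\<exists>t'. P (Suc n) t' \<and> Q n t t'"
    proof (cases "z \<in> F (s k)")
      case True
      from back_and_forth[OF t atom_obj[OF s_atom] True]
      obtain A a b where "partial_aut (A, a, b)" "extends t (A, a, b)"
        "(\<exists>v \<in> Hom B A (s k). M v a = z) \<and> (\<exists>v \<in> Hom B A (s k). M v b = z)" by blast
      then show ?thesis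
        by (intro exI[of _ "(A, a, b)"]) (simp add: P_def Q_def covers_def kz)
    next
      case False
      then show ?thesis
        using t extends_refl[OF t] by (intro exI[of _ t]) (auto simp: P_def Q_def covers_def kz)
    qed
  qed
  then obtain t where tP: "\<And>n. P n (t n)" and tQ: "\<And>n. Q n (t n) (t (Suc n))" by blast
  have t: "partial_aut (t n)" for n using tP[of n] by (simp add: P_def)
  have t0: "t 0 = (A, x, y)" using tP[of 0] by (simp add: P_def)
  have ext: "extends (t n) (t m)" if "n \<le> m" for n m
    using that
  proof (induction m rule: dec_induct)
    case base show ?case using extends_refl t by blast
  next
    case (step m)
    then show ?case using extends_trans[OF step.IH _ t] tQ[of m] by (auto simp: Q_def)
  qed
  have cov: "covers n (t (Suc n))" for n using tQ[of n] by (simp add: Q_def)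
  have cov_a: "\<exists>n. case t n of (A, a, b) \<Rightarrow> \<exists>v \<in> Hom B A (s k). M v a = z"
    and cov_b: "\<exists>n. case t n of (A, a, b) \<Rightarrow> \<exists>v \<in> Hom B A (s k). M v b = z" if "z \<in> F (s k)" for k z
    using cov[of "prod_encode (k, z)"] that
    by (intro exI[of _ "Suc (prod_encode (k, z))"]; auto simp: covers_def)+
  \<comment> \<open>The chain of inverses. Injectivity and surjectivity of the limit are
    functionality and totality of the relation that belongs to this chain.\<close>
  define t' where "t' n = (case t n of (A, a, b) \<Rightarrow> (A, b, a))" for n
  have t': "partial_aut (t' n)" for n
    using t[of n] by (auto simp: t'_def partial_aut_def split: prod.splits)
  have ext': "extends (t' n) (t' m)" if "n \<le> m" for n m
    using ext[OF that] by (auto simp: t'_def extends_def split: prod.splits)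
  have cov': "\<exists>n. case t' n of (A, a, b) \<Rightarrow> \<exists>v \<in> Hom B A (s k). M v a = z" if "z \<in> F (s k)" for k z
    using cov_b[OF that] by (auto simp: t'_def split: prod.splits)
  have swap: "limit_rel t' X u v \<longleftrightarrow> limit_rel t X v u" for X u v
    unfolding t'_def by (rule limit_rel_swap)
  have functional: "v = v'" if "limit_rel t X u v" "limit_rel t X u v'" for X u v v'
    using limit_rel_functional[of t, OF t ext that] by blast
  have functional': "v = v'" if "limit_rel t' X u v" "limit_rel t' X u v'" for X u v v'
    using limit_rel_functional[of t', OF t' ext' that] by blast
  define \<alpha> where "\<alpha> X u = (THE v. limit_rel t X u v)" for X u
  have ex: "\<exists>!v. limit_rel t X u v" if "X \<in> Obj B" "u \<in> F X" for X u
    using limit_rel_total[of t, OF t cov_a that] functional by (intro ex_ex1I) blast+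
  have \<alpha>: "\<alpha> X u = v" if "limit_rel t X u v" for X u v
    unfolding \<alpha>_def by (rule the_equality, rule that) (rule functional[OF _ that])
  have \<alpha>_rel: "limit_rel t X u (\<alpha> X u)" if "X \<in> Obj B" "u \<in> F X" for X u
    unfolding \<alpha>_def by (rule theI'[OF ex[OF that]])
  have "bij_betw (\<alpha> X) (F X) (F X)" if X: "X \<in> Obj B" for X
    unfolding bij_betw_def
  proof (intro conjI inj_onI equalityI subsetI)
    fix u v assume uv: "u \<in> F X" "v \<in> F X" "\<alpha> X u = \<alpha> X v"
    then have "limit_rel t' X (\<alpha> X u) u" "limit_rel t' X (\<alpha> X u) v"
      using \<alpha>_rel[OF X] swap by metis+
    then show "u = v" by (rule functional')
  next
    fix v assume "v \<in> \<alpha> X ` F X"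
    then show "v \<in> F X" using \<alpha>_rel[OF X] limit_rel_in(2)[of t, OF t] by blast
  next
    fix v assume "v \<in> F X"
    then obtain u where "u \<in> F X" "limit_rel t' X v u"
      using limit_rel_total[of t', OF t' cov' X] by blast
    then show "v \<in> \<alpha> X ` F X" using \<alpha> swap by blast
  qed
  moreover have "\<alpha> Y (M f u) = M f (\<alpha> X u)" if f: "f \<in> Hom B X Y" and u: "u \<in> F X" for X Y f u
    using Hom_obj[OF f] u by (intro \<alpha> limit_rel_natural[of t, OF t \<alpha>_rel f]) simp_all
  ultimately have "natural_automorphism \<alpha>" by (simp add: natural_automorphism_def)
  moreover have "\<alpha> A x = y"
  proof (rule \<alpha>)
    have "M (Idn B A) x = x" "M (Idn B A) y = y" using M_Idn atom_obj A x y by auto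
    then show "limit_rel t A x y"
      using limit_relI[of t, OF t0 Idn_closed[OF atom_obj[OF A]]] by simp
  qed
  ultimately show ?thesis by (rule that)
qed

end

section \<open>The automorphism group of a fiber functor\<close>

context fiber_functor begin

lemma natural_automorphismD:
  assumes "natural_automorphism \<alpha>"
  shows "X \<in> Obj B \<Longrightarrow> bij_betw (\<alpha> X) (F X) (F X)"
    and "f \<in> Hom B X Y \<Longrightarrow> x \<in> F X \<Longrightarrow> \<alpha> Y (M f x) = M f (\<alpha> X x)"
    and "X \<in> Obj B \<Longrightarrow> x \<in> F X \<Longrightarrow> \<alpha> X x \<in> F X"
  using assms bij_betwE unfolding natural_automorphism_def by blast+

lemma natural_automorphism_id: "natural_automorphism (\<lambda>X x. x)"
  by (simp add: natural_automorphism_def bij_betw_def)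

lemma natural_automorphism_comp:
  assumes a: "natural_automorphism \<alpha>" and b: "natural_automorphism \<beta>"
  shows "natural_automorphism (\<lambda>X x. \<alpha> X (\<beta> X x))"
  unfolding natural_automorphism_def
proof (intro conjI ballI allI)
  fix X assume X: "X \<in> Obj B"
  show "bij_betw (\<lambda>x. \<alpha> X (\<beta> X x)) (F X) (F X)"
    using bij_betw_trans[OF natural_automorphismD(1)[OF b X] natural_automorphismD(1)[OF a X]]
    by (simp add: comp_def)
next
  fix X Y f x assume f: "f \<in> Hom B X Y" and x: "x \<in> F X"
  have X: "X \<in> Obj B" using Hom_obj[OF f] by simp
  show "\<alpha> Y (\<beta> Y (M f x)) = M f (\<alpha> X (\<beta> X x))"
    using natural_automorphismD(2)[OF b f x] natural_automorphismD(2)[OF a f natural_automorphismD(3)[OF b X x]]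
    by simp
qed

lemma natural_automorphism_inv:
  assumes a: "natural_automorphism \<alpha>"
  shows "natural_automorphism (\<lambda>X. inv_into (F X) (\<alpha> X))"
  unfolding natural_automorphism_def
proof (intro conjI ballI allI)
  fix X assume X: "X \<in> Obj B"
  show "bij_betw (inv_into (F X) (\<alpha> X)) (F X) (F X)"
    by (rule bij_betw_inv_into[OF natural_automorphismD(1)[OF a X]])
next
  fix X Y f x assume f: "f \<in> Hom B X Y" and x: "x \<in> F X"
  have X: "X \<in> Obj B" and Y: "Y \<in> Obj B" using Hom_obj[OF f] by auto
  note bX = natural_automorphismD(1)[OF a X] and bY = natural_automorphismD(1)[OF a Y]
  define y where "y = inv_into (F X) (\<alpha> X) x"
  have y: "y \<in> F X" "\<alpha> X y = x"
    using bij_betwE[OF bij_betw_inv_into[OF bX]] bij_betw_inv_into_right[OF bX x] x by (auto simp: y_def)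
  have "M f x = \<alpha> Y (M f y)" using natural_automorphismD(2)[OF a f y(1)] y(2) by simp
  then show "inv_into (F Y) (\<alpha> Y) (M f x) = M f (inv_into (F X) (\<alpha> X) x)"
    using bij_betw_inv_into_left[OF bY M_closed[OF f y(1)]] by (simp add: y_def)
qed

text \<open>A natural automorphism is encoded by the permutation it induces on the disjoint union of the
  sets \<open>F (s k)\<close>.\<close>

definition rep :: "('o \<Rightarrow> nat \<Rightarrow> nat) \<Rightarrow> nat \<Rightarrow> nat" where
  "rep \<alpha> n = (case prod_decode n of (k, x) \<Rightarrow> if x \<in> F (s k) then prod_encode (k, \<alpha> (s k) x) else n)"

lemma rep_id: "rep (\<lambda>X x. x) = id"
proof
  fix n show "rep (\<lambda>X x. x) n = id n" by (cases "prod_decode n") (simp add: rep_def, metis prod_decode_inverse)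
qed

lemma rep_comp:
  assumes b: "natural_automorphism \<beta>"
  shows "rep (\<lambda>X x. \<alpha> X (\<beta> X x)) = rep \<alpha> \<circ> rep \<beta>"
proof
  fix n
  obtain k x where "prod_decode n = (k, x)" by (cases "prod_decode n")
  then show "rep (\<lambda>X x. \<alpha> X (\<beta> X x)) n = (rep \<alpha> \<circ> rep \<beta>) n"
    using natural_automorphismD(3)[OF b atom_obj[OF s_atom]] by (simp add: rep_def)
qed

lemma s_point:
  assumes X: "X \<in> Obj B" and x: "x \<in> F X"
  obtains k u c where "u \<in> Hom B (s k) X" "c \<in> F (s k)" "M u c = x"
proof -
  obtain A a w where A: "atom B A" "a \<in> F A" "w \<in> Hom B A X" "M w a = x"
    using atom_point[OF X x] by blast
  obtain k where "isomorphic B A (s k)" using s_exhaustive[OF A(1)] by blast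
  then obtain f g where f: "f \<in> Hom B A (s k)" and g: "g \<in> Hom B (s k) A" and gf: "g \<cdot> f = Idn B A"
    by (rule isomorphicE)
  note fa = M_closed[OF f A(2)]
  have "M g (M f a) = a" using M_Comp[OF f g A(2)] M_Idn[OF atom_obj[OF A(1)] A(2)] gf by simp
  then have "M (w \<cdot> g) (M f a) = x" using M_Comp[OF g A(3) fa] A(4) by simp
  then show ?thesis by (rule that[OF Comp_closed[OF g A(3)] fa])
qed

text \<open>By \<open>s_point\<close> every point is the image of a point of some
  \<open>s k\<close>, so naturality determines the automorphism from its code. Off the sets
  \<open>F X\<close> it is an arbitrary function, which is why the codes and not the functions
  \<open>\<alpha>\<close> serve as group elements.\<close>

lemma rep_inject:
  assumes a: "natural_automorphism \<alpha>" and b: "natural_automorphism \<beta>" and eq: "rep \<alpha> = rep \<beta>"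
    and X: "X \<in> Obj B" and x: "x \<in> F X"
  shows "\<alpha> X x = \<beta> X x"
proof -
  obtain k u c where u: "u \<in> Hom B (s k) X" and c: "c \<in> F (s k)" and "M u c = x"
    using s_point[OF X x] by blast
  moreover have "\<alpha> (s k) c = \<beta> (s k) c"
    using fun_cong[OF eq, of "prod_encode (k, c)"] c by (simp add: rep_def)
  ultimately show ?thesis
    using natural_automorphismD(2)[OF a u c] natural_automorphismD(2)[OF b u c] by simp
qed

definition Aut :: "(nat \<Rightarrow> nat) monoid" where
  "Aut = \<lparr>carrier = rep ` Collect natural_automorphism, monoid.mult = (\<circ>), one = id\<rparr>"

text \<open>Decoding by choice. Several natural automorphisms may share a code, but
  \<open>act_rep\<close> shows that the action on points does not depend on the choice.\<close>

definition act :: "(nat \<Rightarrow> nat) \<Rightarrow> 'o \<Rightarrow> nat \<Rightarrow> nat" where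
  "act g = (SOME \<alpha>. natural_automorphism \<alpha> \<and> rep \<alpha> = g)"

lemma Aut_simps: "x \<otimes>\<^bsub>Aut\<^esub> y = x \<circ> y" "\<one>\<^bsub>Aut\<^esub> = id"
  by (simp_all add: Aut_def)

lemma rep_in_Aut: "natural_automorphism \<alpha> \<Longrightarrow> rep \<alpha> \<in> carrier Aut"
  by (simp add: Aut_def)

lemma act_natural_automorphism:
  assumes "g \<in> carrier Aut"
  shows "natural_automorphism (act g)" "rep (act g) = g"
proof -
  have "\<exists>\<alpha>. natural_automorphism \<alpha> \<and> rep \<alpha> = g" using assms by (auto simp: Aut_def)
  then have "natural_automorphism (act g) \<and> rep (act g) = g" unfolding act_def by (rule someI_ex)
  then show "natural_automorphism (act g)" "rep (act g) = g" by auto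
qed

lemma act_rep:
  assumes "natural_automorphism \<alpha>" "X \<in> Obj B" "x \<in> F X"
  shows "act (rep \<alpha>) X x = \<alpha> X x"
  using rep_inject[OF act_natural_automorphism(1) assms(1) act_natural_automorphism(2)]
    rep_in_Aut[OF assms(1)] assms(2,3) by simp

lemma act_closed: "g \<in> carrier Aut \<Longrightarrow> X \<in> Obj B \<Longrightarrow> x \<in> F X \<Longrightarrow> act g X x \<in> F X"
  using natural_automorphismD(3)[OF act_natural_automorphism(1)] .

lemma act_bij: "g \<in> carrier Aut \<Longrightarrow> X \<in> Obj B \<Longrightarrow> bij_betw (act g X) (F X) (F X)"
  using natural_automorphismD(1)[OF act_natural_automorphism(1)] .

lemma act_M: "g \<in> carrier Aut \<Longrightarrow> f \<in> Hom B X Y \<Longrightarrow> x \<in> F X \<Longrightarrow> act g Y (M f x) = M f (act g X x)"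
  using natural_automorphismD(2)[OF act_natural_automorphism(1)] .

lemma Aut_comp_closed: 
  assumes "g \<in> carrier Aut" "h \<in> carrier Aut" 
  shows "g \<circ> h \<in> carrier Aut" "X \<in> Obj B \<Longrightarrow> x \<in> F X \<Longrightarrow> act (g \<circ> h) X x = act g X (act h X x)"
proof -
  note g = act_natural_automorphism[OF assms(1)] and h = act_natural_automorphism[OF assms(2)]
  have gh: "g \<circ> h = rep (\<lambda>X x. act g X (act h X x))"
    using rep_comp[OF h(1), of "act g"] g(2) h(2) by simp
  note na = natural_automorphism_comp[OF g(1) h(1)]
  show "g \<circ> h \<in> carrier Aut" unfolding gh by (rule rep_in_Aut[OF na])
  show "act (g \<circ> h) X x = act g X (act h X x)" if "X \<in> Obj B" "x \<in> F X"
    unfolding gh by (rule act_rep[OF na that])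
qed

lemma id_in_Aut: "id \<in> carrier Aut"
  using rep_in_Aut[OF natural_automorphism_id] rep_id by simp

lemma act_id: "X \<in> Obj B \<Longrightarrow> x \<in> F X \<Longrightarrow> act id X x = x"
  using act_rep[OF natural_automorphism_id, of X x] rep_id by simp

lemma Aut_group: "group Aut"
proof (rule groupI)
  fix g assume g: "g \<in> carrier Aut"
  note na = act_natural_automorphism[OF g]
  let ?\<beta> = "\<lambda>X. inv_into (F X) (act g X)"
  note nb = natural_automorphism_inv[OF na(1)]
  have "rep ?\<beta> \<circ> g = rep (\<lambda>X x. ?\<beta> X (act g X x))" using rep_comp[OF na(1), of ?\<beta>] na(2) by simp
  also have "\<dots> = id"
  proof
    fix n
    obtain k x where kx: "prod_decode n = (k, x)" by (cases "prod_decode n")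
    then have "n = prod_encode (k, x)" by (metis prod_decode_inverse)
    then show "rep (\<lambda>X x. ?\<beta> X (act g X x)) n = id n"
      using bij_betw_inv_into_left[OF act_bij[OF g atom_obj[OF s_atom]]] by (simp add: rep_def)
  qed
  finally have "rep ?\<beta> \<otimes>\<^bsub>Aut\<^esub> g = \<one>\<^bsub>Aut\<^esub>" by (simp add: Aut_simps)
  then show "\<exists>h \<in> carrier Aut. h \<otimes>\<^bsub>Aut\<^esub> g = \<one>\<^bsub>Aut\<^esub>" using rep_in_Aut[OF nb] by blast
qed (auto simp: Aut_simps Aut_comp_closed id_in_Aut comp_assoc)

end

sublocale fiber_functor \<subseteq> G: group Aut
  by (rule Aut_group)

context fiber_functor begin

lemma act_mult:
  assumes "g \<in> carrier Aut" "h \<in> carrier Aut" "X \<in> Obj B" "x \<in> F X"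
  shows "act (g \<otimes>\<^bsub>Aut\<^esub> h) X x = act g X (act h X x)"
  using Aut_comp_closed(2)[OF assms(1,2) assms(3,4)] by (simp add: Aut_simps)

lemma act_one: "X \<in> Obj B \<Longrightarrow> x \<in> F X \<Longrightarrow> act \<one>\<^bsub>Aut\<^esub> X x = x"
  by (simp add: Aut_simps act_id)

lemma act_inv:
  assumes "g \<in> carrier Aut" "X \<in> Obj B" "x \<in> F X"
  shows "act (inv\<^bsub>Aut\<^esub> g) X (act g X x) = x" "act g X (act (inv\<^bsub>Aut\<^esub> g) X x) = x"
  using act_mult[of "inv\<^bsub>Aut\<^esub> g" g X x] act_mult[of g "inv\<^bsub>Aut\<^esub> g" X x] assms by (simp_all add: act_one)

lemma act_inv_eq_iff:
  assumes "g \<in> carrier Aut" "X \<in> Obj B" "x \<in> F X" "y \<in> F X"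
  shows "act (inv\<^bsub>Aut\<^esub> g) X x = y \<longleftrightarrow> x = act g X y"
  using act_inv[OF assms(1,2)] assms(3,4) by metis

lemma Aut_separated:
  assumes g: "g \<in> carrier Aut" and h: "h \<in> carrier Aut" and "g \<noteq> h"
  obtains A a where "atom B A" "a \<in> F A" "act g A a \<noteq> act h A a"
proof -
  have "rep (act g) \<noteq> rep (act h)" using act_natural_automorphism(2) g h assms(3) by simp
  then obtain n where n: "rep (act g) n \<noteq> rep (act h) n" by (auto simp: fun_eq_iff)
  obtain k x where "prod_decode n = (k, x)" by (cases "prod_decode n")
  then have "x \<in> F (s k)" "act g (s k) x \<noteq> act h (s k) x" using n by (auto simp: rep_def split: if_splits)
  then show ?thesis using that s_atom by blast
qed

lemma transitive:
  assumes "atom B A" "x \<in> F A" "y \<in> F A"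
  obtains g where "g \<in> carrier Aut" "act g A x = y"
proof -
  obtain \<alpha> where "natural_automorphism \<alpha>" "\<alpha> A x = y" using homogeneous[OF assms] by blast
  then show ?thesis using that[of "rep \<alpha>"] rep_in_Aut act_rep atom_obj assms by metis
qed

section \<open>The topology of pointwise convergence, and admissibility\<close>

definition Stab :: "'o \<Rightarrow> nat \<Rightarrow> (nat \<Rightarrow> nat) set" where
  "Stab X x = {g \<in> carrier Aut. act g X x = x}"

text \<open>The left coset of \<open>Stab A a\<close> that contains \<open>g\<close>, described
  through the action so that no products of subsets are involved.\<close>

definition coset :: "(nat \<Rightarrow> nat) \<Rightarrow> 'o \<Rightarrow> nat \<Rightarrow> (nat \<Rightarrow> nat) set" where
  "coset g A a = {h \<in> carrier Aut. act h A a = act g A a}"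

definition Top :: "(nat \<Rightarrow> nat) topology" where
  "Top = topology (\<lambda>S. S \<subseteq> carrier Aut \<and> (\<forall>g \<in> S. \<exists>A a. atom B A \<and> a \<in> F A \<and> coset g A a \<subseteq> S))"

text \<open>A point of a common atom over \<open>A\<close> and \<open>A'\<close> controls
  \<open>a\<close> and \<open>a'\<close> at once. So agreement at one point is as good as agreement
  at finitely many, and the sets \<open>coset g A a\<close> form a base.\<close>

lemma coset_Int:
  assumes "atom B A" "a \<in> F A" "atom B A'" "a' \<in> F A'"
  obtains C c where "atom B C" "c \<in> F C" "\<forall>g \<in> carrier Aut. coset g C c \<subseteq> coset g A a \<inter> coset g A' a'"
proof -
  obtain C c u v where C: "atom B C" "c \<in> F C" and u: "u \<in> Hom B C A" and v: "v \<in> Hom B C A'"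
    and eq: "M u c = a" "M v c = a'"
    by (rule common_atomE[OF atom_obj[OF assms(1)] atom_obj[OF assms(3)] assms(2,4)])
  have "coset g C c \<subseteq> coset g A a \<inter> coset g A' a'" if g: "g \<in> carrier Aut" for g
    using act_M[OF _ u C(2)] act_M[OF _ v C(2)] eq g by (auto simp: coset_def)
  then show ?thesis using that[OF C] by blast
qed

lemma istopology_Top:
  "istopology (\<lambda>S. S \<subseteq> carrier Aut \<and> (\<forall>g \<in> S. \<exists>A a. atom B A \<and> a \<in> F A \<and> coset g A a \<subseteq> S))"
  unfolding istopology_def
proof (intro conjI allI impI ballI)
  fix S T g
  assume S: "S \<subseteq> carrier Aut \<and> (\<forall>g \<in> S. \<exists>A a. atom B A \<and> a \<in> F A \<and> coset g A a \<subseteq> S)"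
    and T: "T \<subseteq> carrier Aut \<and> (\<forall>g \<in> T. \<exists>A a. atom B A \<and> a \<in> F A \<and> coset g A a \<subseteq> T)"
    and g: "g \<in> S \<inter> T"
  obtain A a where A: "atom B A" "a \<in> F A" "coset g A a \<subseteq> S" using S g by blast
  obtain A' a' where A': "atom B A'" "a' \<in> F A'" "coset g A' a' \<subseteq> T" using T g by blast
  obtain C c where "atom B C" "c \<in> F C" "\<forall>g \<in> carrier Aut. coset g C c \<subseteq> coset g A a \<inter> coset g A' a'"
    by (rule coset_Int[OF A(1,2) A'(1,2)])
  then show "\<exists>A a. atom B A \<and> a \<in> F A \<and> coset g A a \<subseteq> S \<inter> T"
    using A(3) A'(3) S g by blast
next
  fix K g
  assume K: "\<forall>S \<in> K. S \<subseteq> carrier Aut \<and> (\<forall>g \<in> S. \<exists>A a. atom B A \<and> a \<in> F A \<and> coset g A a \<subseteq> S)"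
    and "g \<in> \<Union> K"
  then obtain S where S: "S \<in> K" "g \<in> S" by blast
  then obtain A a where "atom B A" "a \<in> F A" "coset g A a \<subseteq> S" using K by blast
  then show "\<exists>A a. atom B A \<and> a \<in> F A \<and> coset g A a \<subseteq> \<Union> K" using S by blast
qed blast+

lemma openin_Top:
  "openin Top S \<longleftrightarrow> S \<subseteq> carrier Aut \<and> (\<forall>g \<in> S. \<exists>A a. atom B A \<and> a \<in> F A \<and> coset g A a \<subseteq> S)"
  unfolding Top_def topology_inverse'[OF istopology_Top] ..

lemma coset_self: "g \<in> carrier Aut \<Longrightarrow> g \<in> coset g A a"
  by (simp add: coset_def)

lemma coset_closed: "coset g A a \<subseteq> carrier Aut"
  by (auto simp: coset_def)

lemma openin_coset: "atom B A \<Longrightarrow> a \<in> F A \<Longrightarrow> openin Top (coset g A a)"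
  unfolding openin_Top by (fastforce simp: coset_def)

lemma ex_atom_point: "\<exists>A a. atom B A \<and> a \<in> F A"
  using s_atom F_nonempty by blast

lemma topspace_Top: "topspace Top = carrier Aut"
proof -
  have "openin Top (carrier Aut)"
    unfolding openin_Top using ex_atom_point coset_closed by blast
  moreover have "topspace Top \<subseteq> carrier Aut"
    using openin_topspace[of Top] unfolding openin_Top by blast
  ultimately show ?thesis using openin_subset by blast
qed

lemma topological_group_Aut: "topological_group Aut Top"
proof
  show "topspace Top = carrier Aut" by (rule topspace_Top)
  show "continuous_map (prod_topology Top Top) Top (\<lambda>(x, y). x \<otimes>\<^bsub>Aut\<^esub> y)"
    unfolding continuous_map_def
  proof (intro conjI allI impI funcsetI)
    fix z assume "z \<in> topspace (prod_topology Top Top)"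
    then show "(case z of (x, y) \<Rightarrow> x \<otimes>\<^bsub>Aut\<^esub> y) \<in> topspace Top"
      by (auto simp: topspace_Top)
  next
    fix U assume U: "openin Top U"
    show "openin (prod_topology Top Top)
      {z \<in> topspace (prod_topology Top Top). (case z of (x, y) \<Rightarrow> x \<otimes>\<^bsub>Aut\<^esub> y) \<in> U}"
      unfolding openin_prod_topology_alt
    proof (intro allI impI)
      fix x y
      assume "(x, y) \<in> {z \<in> topspace (prod_topology Top Top). (case z of (x, y) \<Rightarrow> x \<otimes>\<^bsub>Aut\<^esub> y) \<in> U}"
      then have x: "x \<in> carrier Aut" and y: "y \<in> carrier Aut" and "x \<otimes>\<^bsub>Aut\<^esub> y \<in> U"
        by (auto simp: topspace_Top)
      then obtain A a where A: "atom B A" "a \<in> F A" "coset (x \<otimes>\<^bsub>Aut\<^esub> y) A a \<subseteq> U"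
        using U unfolding openin_Top by blast
      note A' = atom_obj[OF A(1)]
      have ya: "act y A a \<in> F A" using act_closed[OF y A' A(2)] .
      \<comment> \<open>If \<open>x'\<close> agrees with \<open>x\<close> at the point
        \<open>act y A a\<close>, and \<open>y'\<close> agrees with \<open>y\<close> at
        \<open>a\<close>, then the two products agree at \<open>a\<close>.\<close>
      have "coset x A (act y A a) \<times> coset y A a \<subseteq>
        {z \<in> topspace (prod_topology Top Top). (case z of (x, y) \<Rightarrow> x \<otimes>\<^bsub>Aut\<^esub> y) \<in> U}"
      proof clarsimp
        fix x' y' assume x': "x' \<in> coset x A (act y A a)" and y': "y' \<in> coset y A a"
        then have c: "x' \<in> carrier Aut" "y' \<in> carrier Aut" by (auto simp: coset_def)
        have "act (x' \<otimes>\<^bsub>Aut\<^esub> y') A a = act (x \<otimes>\<^bsub>Aut\<^esub> y) A a"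
          using x' y' act_mult[OF c A' A(2)] act_mult[OF x y A' A(2)] by (simp add: coset_def)
        then have "x' \<otimes>\<^bsub>Aut\<^esub> y' \<in> U" using A(3) c by (auto simp: coset_def)
        then show "x' \<in> topspace Top \<and> y' \<in> topspace Top \<and> x' \<otimes>\<^bsub>Aut\<^esub> y' \<in> U"
          using c by (simp add: topspace_Top)
      qed
      then show "\<exists>V W. openin Top V \<and> openin Top W \<and> x \<in> V \<and> y \<in> W \<and> V \<times> W \<subseteq>
        {z \<in> topspace (prod_topology Top Top). (case z of (x, y) \<Rightarrow> x \<otimes>\<^bsub>Aut\<^esub> y) \<in> U}"
        using openin_coset[OF A(1,2)] openin_coset[OF A(1) ya] coset_self[OF x] coset_self[OF y]
        by (intro exI[of _ "coset x A (act y A a)"] exI[of _ "coset y A a"]) simp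
    qed
  qed
  show "continuous_map Top Top (\<lambda>x. inv\<^bsub>Aut\<^esub> x)"
    unfolding continuous_map_def
  proof (intro conjI allI impI funcsetI)
    fix x assume "x \<in> topspace Top"
    then show "inv\<^bsub>Aut\<^esub> x \<in> topspace Top" by (simp add: topspace_Top)
  next
    fix U assume U: "openin Top U"
    show "openin Top {x \<in> topspace Top. inv\<^bsub>Aut\<^esub> x \<in> U}"
      unfolding openin_Top
    proof (intro conjI ballI)
      show "{x \<in> topspace Top. inv\<^bsub>Aut\<^esub> x \<in> U} \<subseteq> carrier Aut" by (auto simp: topspace_Top)
      fix x assume "x \<in> {x \<in> topspace Top. inv\<^bsub>Aut\<^esub> x \<in> U}"
      then have x: "x \<in> carrier Aut" and "inv\<^bsub>Aut\<^esub> x \<in> U" by (auto simp: topspace_Top)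
      then obtain A a where A: "atom B A" "a \<in> F A" "coset (inv\<^bsub>Aut\<^esub> x) A a \<subseteq> U"
        using U unfolding openin_Top by blast
      note A' = atom_obj[OF A(1)]
      let ?b = "act (inv\<^bsub>Aut\<^esub> x) A a"
      have b: "?b \<in> F A" using act_closed[OF _ A' A(2)] x by simp
      \<comment> \<open>Since \<open>x\<close> sends \<open>?b\<close> to \<open>a\<close>,
        agreement of \<open>y\<close> and \<open>x\<close> at \<open>?b\<close> says that
        \<open>y\<close> sends \<open>?b\<close> to \<open>a\<close> as well, and hence that the
        inverses agree at \<open>a\<close>.\<close>
      have "coset x A ?b \<subseteq> {x \<in> topspace Top. inv\<^bsub>Aut\<^esub> x \<in> U}"
      proof
        fix y assume "y \<in> coset x A ?b"
        then have y: "y \<in> carrier Aut" "act y A ?b = act x A ?b" by (auto simp: coset_def)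
        then have "act y A ?b = a" using act_inv(2)[OF x A' A(2)] by simp
        then have "act (inv\<^bsub>Aut\<^esub> y) A a = ?b" using act_inv(1)[OF y(1) A' b] by simp
        then have "inv\<^bsub>Aut\<^esub> y \<in> U" using A(3) y(1) by (auto simp: coset_def)
        then show "y \<in> {x \<in> topspace Top. inv\<^bsub>Aut\<^esub> x \<in> U}" using y by (simp add: topspace_Top)
      qed
      then show "\<exists>A a. atom B A \<and> a \<in> F A \<and> coset x A a \<subseteq> {x \<in> topspace Top. inv\<^bsub>Aut\<^esub> x \<in> U}"
        using A(1) b by blast
    qed
  qed
qed

lemma coset_one: "A \<in> Obj B \<Longrightarrow> a \<in> F A \<Longrightarrow> coset \<one>\<^bsub>Aut\<^esub> A a = Stab A a"
  by (simp add: coset_def Stab_def act_one)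

lemma Stab_subgroup:
  assumes "A \<in> Obj B" "a \<in> F A"
  shows "subgroup (Stab A a) Aut"
proof (rule G.subgroupI)
  show "Stab A a \<subseteq> carrier Aut" "Stab A a \<noteq> {}"
    using act_one[OF assms] by (auto simp: Stab_def)
  fix g assume g: "g \<in> Stab A a"
  then show "inv\<^bsub>Aut\<^esub> g \<in> Stab A a" using act_inv(1)[OF _ assms, of g] by (simp add: Stab_def)
  fix h assume "h \<in> Stab A a"
  then show "g \<otimes>\<^bsub>Aut\<^esub> h \<in> Stab A a" using g act_mult[of g h, OF _ _ assms] by (simp add: Stab_def)
qed

lemma openin_Stab: "atom B A \<Longrightarrow> a \<in> F A \<Longrightarrow> openin Top (Stab A a)"
  using openin_coset[of A a "\<one>\<^bsub>Aut\<^esub>"] coset_one[OF atom_obj] by simp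

lemma open_subgroup_Stab: "atom B A \<Longrightarrow> a \<in> F A \<Longrightarrow> open_subgroup Aut Top (Stab A a)"
  using openin_Stab Stab_subgroup atom_obj by (simp add: open_subgroup_def)

lemma open_contains_Stab:
  assumes "openin Top S" "\<one>\<^bsub>Aut\<^esub> \<in> S"
  obtains A a where "atom B A" "a \<in> F A" "Stab A a \<subseteq> S"
proof -
  obtain A a where "atom B A" "a \<in> F A" "coset \<one>\<^bsub>Aut\<^esub> A a \<subseteq> S"
    using assms unfolding openin_Top by blast
  then show ?thesis using that coset_one[OF atom_obj] by simp
qed

text \<open>Points of the atoms \<open>s k\<close> suffice by \<open>s_point\<close>, and such
  points are indexed by pairs of natural numbers.\<close>

lemma first_countable_Top: "first_countable Top"
  unfolding first_countable_def
proof
  fix g assume "g \<in> topspace Top"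
  then have g: "g \<in> carrier Aut" by (simp add: topspace_Top)
  let ?N = "\<lambda>(k, a). coset g (s k) a"
  let ?B = "?N ` {(k, a). a \<in> F (s k)}"
  have "\<exists>V \<in> ?B. g \<in> V \<and> V \<subseteq> U" if U: "openin Top U" "g \<in> U" for U
  proof -
    obtain A a where A: "atom B A" "a \<in> F A" "coset g A a \<subseteq> U" using U unfolding openin_Top by blast
    obtain k u c where u: "u \<in> Hom B (s k) A" and c: "c \<in> F (s k)" and uc: "M u c = a"
      using s_point[OF atom_obj[OF A(1)] A(2)] by blast
    have "coset g (s k) c \<subseteq> coset g A a"
      using act_M[OF _ u c] g by (auto simp: coset_def uc[symmetric])
    then have "g \<in> ?N (k, c) \<and> ?N (k, c) \<subseteq> U" using A(3) coset_self[OF g] by auto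
    moreover have "?N (k, c) \<in> ?B" using c by (intro imageI) simp
    ultimately show ?thesis by (rule bexI)
  qed
  moreover have "countable ?B" by simp
  moreover have "\<forall>V \<in> ?B. openin Top V" using openin_coset[OF s_atom] by auto
  ultimately show "\<exists>\<B>. countable \<B> \<and> (\<forall>V \<in> \<B>. openin Top V) \<and>
      (\<forall>U. openin Top U \<and> g \<in> U \<longrightarrow> (\<exists>V \<in> \<B>. g \<in> V \<and> V \<subseteq> U))"
    by blast
qed

lemma double_coset_eq:
  assumes U: "subgroup U Aut" and V: "subgroup V Aut"
    and g: "g \<in> carrier Aut" and v: "v \<in> V" and u: "u \<in> U" and g': "g' = v \<otimes>\<^bsub>Aut\<^esub> (g \<otimes>\<^bsub>Aut\<^esub> u)"
  shows "V <#>\<^bsub>Aut\<^esub> (g' <#\<^bsub>Aut\<^esub> U) \<subseteq> V <#>\<^bsub>Aut\<^esub> (g <#\<^bsub>Aut\<^esub> U)"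
proof
  fix z assume "z \<in> V <#>\<^bsub>Aut\<^esub> (g' <#\<^bsub>Aut\<^esub> U)"
  then obtain v' u' where v': "v' \<in> V" and u': "u' \<in> U" and z: "z = v' \<otimes>\<^bsub>Aut\<^esub> (g' \<otimes>\<^bsub>Aut\<^esub> u')"
    by (auto simp: set_mult_def l_coset_def)
  note c = subgroup.mem_carrier[OF U u] subgroup.mem_carrier[OF U u']
    subgroup.mem_carrier[OF V v] subgroup.mem_carrier[OF V v']
  have "z = (v' \<otimes>\<^bsub>Aut\<^esub> v) \<otimes>\<^bsub>Aut\<^esub> (g \<otimes>\<^bsub>Aut\<^esub> (u \<otimes>\<^bsub>Aut\<^esub> u'))"
    using c g by (simp add: z g' G.m_assoc)
  moreover have "v' \<otimes>\<^bsub>Aut\<^esub> v \<in> V" "u \<otimes>\<^bsub>Aut\<^esub> u' \<in> U"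
    using subgroup.m_closed[OF V v' v] subgroup.m_closed[OF U u u'] by auto
  ultimately show "z \<in> V <#>\<^bsub>Aut\<^esub> (g <#\<^bsub>Aut\<^esub> U)"
    unfolding set_mult_def l_coset_def by blast
qed

text \<open>The double coset of \<open>g\<close> depends only on the atom of
  \<open>C \<times> A\<close> that contains the pair of \<open>c\<close> and
  \<open>act g A a\<close>, and there are finitely many atoms. If \<open>g\<close> and
  \<open>g'\<close> give the same atom, transitivity supplies some \<open>v\<close> that fixes
  \<open>c\<close> and moves \<open>act g A a\<close> to \<open>act g' A a\<close>. Then
  \<open>v\<close> lies in \<open>V\<close>, and \<open>g'\<close> is \<open>v\<close> times
  \<open>g\<close> times an element of \<open>Stab A a\<close>, hence of \<open>U\<close>.\<close>

lemma finite_double_cosets: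
  assumes U: "open_subgroup Aut Top U" and V: "open_subgroup Aut Top V"
  shows "finite {V <#>\<^bsub>Aut\<^esub> (g <#\<^bsub>Aut\<^esub> U) | g. g \<in> carrier Aut}"
proof -
  have sU: "subgroup U Aut" and sV: "subgroup V Aut" using U V by (auto simp: open_subgroup_def)
  obtain A a where A: "atom B A" "a \<in> F A" "Stab A a \<subseteq> U"
    using open_contains_Stab[of U] U subgroup.one_closed[OF sU] by (auto simp: open_subgroup_def)
  obtain C c where C: "atom B C" "c \<in> F C" "Stab C c \<subseteq> V"
    using open_contains_Stab[of V] V subgroup.one_closed[OF sV] by (auto simp: open_subgroup_def)
  note A' = atom_obj[OF A(1)] and C' = atom_obj[OF C(1)]
  obtain P p q n D w where P: "P \<in> Obj B" "p \<in> Hom B P C" "q \<in> Hom B P A" "is_product B C A P p q"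
    and "\<forall>k<n. atom B (D k)" and w: "is_finite_coproduct B n D P w"
    using products[OF C' A'] by (elim exE conjE) (rule that)
  then have D: "\<And>k. k < n \<Longrightarrow> atom B (D k)" by blast
  define R where "R g k \<longleftrightarrow> k < n \<and> (\<exists>d \<in> F (D k). M p (M (w k) d) = c \<and> M q (M (w k) d) = act g A a)" for g k
  have ex: "\<exists>k. R g k" if g: "g \<in> carrier Aut" for g
  proof -
    obtain z where z: "z \<in> F P" "M p z = c" "M q z = act g A a"
      using product_point[OF P(4) C(2) act_closed[OF g A' A(2)]] by blast
    obtain k d where "k < n" "d \<in> F (D k)" "M (w k) d = z"
      using coproduct_point[OF w D z(1)] by blast
    then show ?thesis using z by (auto simp: R_def)
  qed
  have sub: "V <#>\<^bsub>Aut\<^esub> (g' <#\<^bsub>Aut\<^esub> U) \<subseteq> V <#>\<^bsub>Aut\<^esub> (g <#\<^bsub>Aut\<^esub> U)"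
    if g: "g \<in> carrier Aut" and g': "g' \<in> carrier Aut" and R: "R g k" "R g' k" for g g' k
  proof -
    have k: "k < n" using R by (simp add: R_def)
    note Dk = atom_obj[OF D[OF k]]
    obtain d where d: "d \<in> F (D k)" "M p (M (w k) d) = c" "M q (M (w k) d) = act g A a"
      using R by (auto simp: R_def)
    obtain d' where d': "d' \<in> F (D k)" "M p (M (w k) d') = c" "M q (M (w k) d') = act g' A a"
      using R by (auto simp: R_def)
    obtain v where v: "v \<in> carrier Aut" "act v (D k) d = d'" by (rule transitive[OF D[OF k] d(1) d'(1)])
    note wk = finite_coproduct_in[OF w k]
    note wd = M_closed[OF wk d(1)]
    have "act v P (M (w k) d) = M (w k) d'" using act_M[OF v(1) wk d(1)] v(2) by simp
    then have vc: "act v C c = c" and va: "act v A (act g A a) = act g' A a"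
      using act_M[OF v(1) P(2) wd] act_M[OF v(1) P(3) wd] d d' by auto
    \<comment> \<open>The solution of \<open>g' = v \<otimes> (g \<otimes> ?u)\<close>. It fixes
      \<open>a\<close>, as \<open>g'\<close> and \<open>v \<otimes> g\<close> send \<open>a\<close>
      to the same point.\<close>
    let ?u = "inv\<^bsub>Aut\<^esub> g \<otimes>\<^bsub>Aut\<^esub> (inv\<^bsub>Aut\<^esub> v \<otimes>\<^bsub>Aut\<^esub> g')"
    have ga: "act g A a \<in> F A" using act_closed[OF g A' A(2)] .
    have "act ?u A a = act (inv\<^bsub>Aut\<^esub> g) A (act (inv\<^bsub>Aut\<^esub> v) A (act v A (act g A a)))"
      using g g' v A(2) A' va by (simp add: act_mult act_closed)
    also have "\<dots> = a" using act_inv(1)[OF v(1) A' ga] act_inv(1)[OF g A' A(2)] by simp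
    finally have u: "?u \<in> U" using A(3) g g' v by (auto simp: Stab_def)
    have "v \<in> V" using C(3) v vc by (auto simp: Stab_def)
    moreover have "g' = v \<otimes>\<^bsub>Aut\<^esub> (g \<otimes>\<^bsub>Aut\<^esub> ?u)"
      using g g' v(1) by (simp add: G.m_assoc[symmetric])
    ultimately show ?thesis using double_coset_eq[OF sU sV g _ u] by blast
  qed
  define f where "f k = (SOME g. g \<in> carrier Aut \<and> R g k)" for k
  have "{V <#>\<^bsub>Aut\<^esub> (g <#\<^bsub>Aut\<^esub> U) | g. g \<in> carrier Aut} \<subseteq>
      (\<lambda>k. V <#>\<^bsub>Aut\<^esub> (f k <#\<^bsub>Aut\<^esub> U)) ` {..<n}"
  proof clarify
    fix g assume g: "g \<in> carrier Aut"
    obtain k where k: "R g k" using ex[OF g] by blast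
    have f: "f k \<in> carrier Aut \<and> R (f k) k"
      unfolding f_def by (rule someI[of _ g]) (use g k in simp)
    have "V <#>\<^bsub>Aut\<^esub> (g <#\<^bsub>Aut\<^esub> U) = V <#>\<^bsub>Aut\<^esub> (f k <#\<^bsub>Aut\<^esub> U)"
      using sub[OF g _ k] sub[OF _ g _ k] f by blast
    moreover have "k < n" using k by (simp add: R_def)
    ultimately show "V <#>\<^bsub>Aut\<^esub> (g <#\<^bsub>Aut\<^esub> U) \<in> (\<lambda>k. V <#>\<^bsub>Aut\<^esub> (f k <#\<^bsub>Aut\<^esub> U)) ` {..<n}"
      by blast
  qed
  then show ?thesis using finite_subset by blast
qed

lemma admissible_group_Aut: "admissible_group Aut Top"
proof -
  interpret topological_group Aut Top by (rule topological_group_Aut)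
  show ?thesis
  proof
    show "Hausdorff_space Top"
      unfolding Hausdorff_space_def
    proof (intro allI impI)
      fix g h assume "g \<in> topspace Top \<and> h \<in> topspace Top \<and> g \<noteq> h"
      then have g: "g \<in> carrier Aut" and h: "h \<in> carrier Aut" and ne: "g \<noteq> h" by (auto simp: topspace_Top)
      obtain A a where A: "atom B A" "a \<in> F A" "act g A a \<noteq> act h A a" by (rule Aut_separated[OF g h ne])
      have "disjnt (coset g A a) (coset h A a)" using A(3) by (auto simp: disjnt_def coset_def)
      then show "\<exists>U V. openin Top U \<and> openin Top V \<and> g \<in> U \<and> h \<in> V \<and> disjnt U V"
        using openin_coset[OF A(1,2)] coset_self[OF g] coset_self[OF h]
        by (intro exI[of _ "coset g A a"] exI[of _ "coset h A a"]) simp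
    qed
    show "\<exists>U. open_subgroup Aut Top U \<and> U \<subseteq> S" if S: "openin Top S" "\<one>\<^bsub>Aut\<^esub> \<in> S" for S
    proof -
      obtain A a where A: "atom B A" "a \<in> F A" "Stab A a \<subseteq> S" by (rule open_contains_Stab[OF S])
      then show ?thesis using open_subgroup_Stab[OF A(1,2)] by blast
    qed
  qed (rule finite_double_cosets)
qed

section \<open>The stabilizer class\<close>

definition Stabs :: "(nat \<Rightarrow> nat) set set" where
  "Stabs = {Stab A a | A a. atom B A \<and> a \<in> F A}"

text \<open>Points of arbitrary objects give no new stabilizers: \<open>x\<close> comes from a point
  of an atomic summand, whose inclusion is injective on points and commutes with the action.\<close>

lemma Stab_in_Stabs:
  assumes X: "X \<in> Obj B" and x: "x \<in> F X"
  shows "Stab X x \<in> Stabs"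
proof -
  obtain A a w where A: "atom B A" "a \<in> F A" and w: "w \<in> Hom B A X" "M w a = x" "inj_on (M w) (F A)"
    using atom_point[OF X x] by blast
  have "act g X x = x \<longleftrightarrow> act g A a = a" if g: "g \<in> carrier Aut" for g
    using act_M[OF g w(1) A(2)] inj_onD[OF w(3), of "act g A a" a] act_closed[OF g atom_obj[OF A(1)] A(2)] A(2) w(2)
    by auto
  then have "Stab X x = Stab A a" by (auto simp: Stab_def)
  then show ?thesis using A by (auto simp: Stabs_def)
qed

text \<open>Conjugation moves the point, intersection passes to the point of the product with the
  two given coordinates, and the whole group fixes a point of the final object. The product need not
  be an atom, so \<open>Stab_in_Stabs\<close> is what closes the class under intersection.\<close>

lemma stabilizer_class_Stabs: "stabilizer_class Aut Top Stabs"
proof -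
  interpret topological_group Aut Top by (rule topological_group_Aut)
  show ?thesis
  proof
    fix U assume "U \<in> Stabs"
    then obtain A a where A: "atom B A" "a \<in> F A" "U = Stab A a" by (auto simp: Stabs_def)
    note A' = atom_obj[OF A(1)]
    show "open_subgroup Aut Top U" using open_subgroup_Stab A by simp
    {
      fix g assume g: "g \<in> carrier Aut"
      have "g <#\<^bsub>Aut\<^esub> U #>\<^bsub>Aut\<^esub> inv\<^bsub>Aut\<^esub> g = Stab A (act g A a)"
      proof (intro equalityI subsetI)
        fix z assume "z \<in> g <#\<^bsub>Aut\<^esub> U #>\<^bsub>Aut\<^esub> inv\<^bsub>Aut\<^esub> g"
        then obtain u where u: "u \<in> carrier Aut" "act u A a = a" and z: "z = (g \<otimes>\<^bsub>Aut\<^esub> u) \<otimes>\<^bsub>Aut\<^esub> inv\<^bsub>Aut\<^esub> g"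
          by (auto simp: A(3) Stab_def l_coset_def r_coset_def)
        have "act z A (act g A a) = act g A a"
          using g u A(2) A' by (simp add: z act_mult act_closed act_inv)
        then show "z \<in> Stab A (act g A a)" using g u by (simp add: Stab_def z)
      next
        fix z assume "z \<in> Stab A (act g A a)"
        then have z: "z \<in> carrier Aut" "act z A (act g A a) = act g A a" by (auto simp: Stab_def)
        let ?u = "inv\<^bsub>Aut\<^esub> g \<otimes>\<^bsub>Aut\<^esub> (z \<otimes>\<^bsub>Aut\<^esub> g)"
        have "act ?u A a = a" using g z A(2) A' by (simp add: act_mult act_closed act_inv)
        then have "?u \<in> U" using g z by (simp add: A(3) Stab_def)
        moreover have "z = (g \<otimes>\<^bsub>Aut\<^esub> ?u) \<otimes>\<^bsub>Aut\<^esub> inv\<^bsub>Aut\<^esub> g"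
          using g z by (simp add: G.m_assoc[symmetric]) (simp add: G.m_assoc)
        ultimately show "z \<in> g <#\<^bsub>Aut\<^esub> U #>\<^bsub>Aut\<^esub> inv\<^bsub>Aut\<^esub> g"
          unfolding l_coset_def r_coset_def by blast
      qed
      then show "g <#\<^bsub>Aut\<^esub> U #>\<^bsub>Aut\<^esub> inv\<^bsub>Aut\<^esub> g \<in> Stabs"
        using Stab_in_Stabs[OF A' act_closed[OF g A' A(2)]] by simp
    }
    fix V assume "V \<in> Stabs"
    then obtain C c where C: "atom B C" "c \<in> F C" "V = Stab C c" by (auto simp: Stabs_def)
    obtain P p q where P: "P \<in> Obj B" "p \<in> Hom B P A" "q \<in> Hom B P C" "is_product B A C P p q"
      using products[OF A' atom_obj[OF C(1)]] by (elim exE conjE) (rule that)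
    obtain z where z: "z \<in> F P" "M p z = a" "M q z = c"
      using product_point[OF P(4) A(2) C(2)] by blast
    have "act g P z = z \<longleftrightarrow> act g A a = a \<and> act g C c = c" if g: "g \<in> carrier Aut" for g
      using act_M[OF g P(2) z(1)] act_M[OF g P(3) z(1)] z
        product_point_unique[OF P(4) act_closed[OF g P(1) z(1)] z(1)] by auto
    then have "Stab P z = U \<inter> V" by (auto simp: A(3) C(3) Stab_def)
    then show "U \<inter> V \<in> Stabs" using Stab_in_Stabs[OF P(1) z(1)] by simp
  next
    obtain T where T: "is_final B T" using final_object by blast
    then have T': "T \<in> Obj B" by (simp add: is_final_def)
    obtain x where x: "x \<in> F T" using F_nonempty[OF final_atom[OF T]] by blast
    \<comment> \<open>\<open>F T\<close> has a single point: any two come from one point of an atom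
      along maps to \<open>T\<close>, and these maps coincide.\<close>
    have "act g T x = x" if g: "g \<in> carrier Aut" for g
    proof -
      obtain A a u v where "atom B A" "a \<in> F A" and u: "u \<in> Hom B A T" and v: "v \<in> Hom B A T"
        and eq: "M u a = act g T x" "M v a = x"
        by (rule common_atomE[OF T' T' act_closed[OF g T' x] x])
      show ?thesis using final_unique[OF T u v] eq by simp
    qed
    then have "Stab T x = carrier Aut" by (auto simp: Stab_def)
    then show "carrier Aut \<in> Stabs" using Stab_in_Stabs[OF T' x] by simp
  next
    fix S assume S: "openin Top S" "\<one>\<^bsub>Aut\<^esub> \<in> S"
    obtain A a where "atom B A" "a \<in> F A" "Stab A a \<subseteq> S" by (rule open_contains_Stab[OF S])
    then show "\<exists>U \<in> Stabs. U \<subseteq> S" by (auto simp: Stabs_def)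
  qed
qed

end

section \<open>Full faithfulness and effective quotients\<close>

context fiber_functor begin

text \<open>On each atomic summand \<open>rigid\<close> at one point gives equality, and a map is
  determined by its restrictions to the summands.\<close>

lemma faithful:
  assumes u: "u \<in> Hom B X Y" and v: "v \<in> Hom B X Y" and eq: "\<And>x. x \<in> F X \<Longrightarrow> M u x = M v x"
  shows "u = v"
proof -
  have X: "X \<in> Obj B" using Hom_obj[OF u] by simp
  obtain n A w where A: "\<forall>k<n. atom B (A k)" and W: "is_finite_coproduct B n A X w"
    using decomposition[OF X] by blast
  show ?thesis
  proof (rule finite_coproduct_eq[OF W u v])
    fix k assume k: "k < n"
    then have Ak: "atom B (A k)" using A by blast
    note wk = finite_coproduct_in[OF W k]
    obtain a where a: "a \<in> F (A k)" using F_nonempty[OF Ak] by blast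
    have "M (u \<cdot> w k) a = M (v \<cdot> w k) a"
      using M_Comp[OF wk u a] M_Comp[OF wk v a] eq[OF M_closed[OF wk a]] by simp
    then show "u \<cdot> w k = v \<cdot> w k"
      by (rule rigid[OF Ak a Comp_closed[OF wk u] Comp_closed[OF wk v]])
  qed
qed

lemma mono_if_injective:
  assumes m: "m \<in> Hom B X Y" and inj: "inj_on (M m) (F X)"
  shows "is_mono B m"
  unfolding is_mono_Hom[OF m]
proof (intro ballI impI)
  fix W u v assume u: "u \<in> Hom B W X" and v: "v \<in> Hom B W X" and eq: "m \<cdot> u = m \<cdot> v"
  show "u = v"
  proof (rule faithful[OF u v])
    fix x assume x: "x \<in> F W"
    have "M m (M u x) = M m (M v x)" using M_Comp[OF u m x] M_Comp[OF v m x] eq by simp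
    then show "M u x = M v x" using inj_onD[OF inj] M_closed[OF u x] M_closed[OF v x] by blast
  qed
qed

definition equivariant :: "'o \<Rightarrow> 'o \<Rightarrow> (nat \<Rightarrow> nat) \<Rightarrow> bool" where
  "equivariant X Y \<phi> \<longleftrightarrow> (\<forall>x \<in> F X. \<phi> x \<in> F Y) \<and>
    (\<forall>g \<in> carrier Aut. \<forall>x \<in> F X. \<phi> (act g X x) = act g Y (\<phi> x))"

text \<open>The orbit of \<open>(a, \<phi> a)\<close> in \<open>F (A \<times> Y)\<close> comes from an atom \<open>D\<close> of \<open>A \<times> Y\<close>; as it is the graph
  of \<open>\<phi>\<close>, the projection \<open>D \<rightarrow> A\<close> is a monomorphism of atoms.\<close>

lemma full_atom:
  assumes A: "atom B A" and Y: "Y \<in> Obj B" and \<phi>: "equivariant A Y \<phi>"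
  shows "\<exists>u \<in> Hom B A Y. \<forall>a \<in> F A. M u a = \<phi> a"
proof -
  note A' = atom_obj[OF A]
  have \<phi>_act: "\<phi> (act g A x) = act g Y (\<phi> x)" if "g \<in> carrier Aut" "x \<in> F A" for g x
    using \<phi> that by (simp add: equivariant_def)
  obtain a where a: "a \<in> F A" using F_nonempty[OF A] by blast
  have \<phi>a: "\<phi> a \<in> F Y" using \<phi> a by (simp add: equivariant_def)
  obtain P p q where P: "P \<in> Obj B" "p \<in> Hom B P A" "q \<in> Hom B P Y" "is_product B A Y P p q"
    using products[OF A' Y] by (elim exE conjE) (rule that)
  obtain z where z: "z \<in> F P" "M p z = a" "M q z = \<phi> a"
    using product_point[OF P(4) a \<phi>a] by blast
  obtain D d w where D: "atom B D" and d: "d \<in> F D" and w: "w \<in> Hom B D P" and wd: "M w d = z"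
    and inj: "inj_on (M w) (F D)"
    using atom_point[OF P(1) z(1)] by blast
  note D' = atom_obj[OF D]
  define r where "r = p \<cdot> w"
  define t where "t = q \<cdot> w"
  have r: "r \<in> Hom B D A" and t: "t \<in> Hom B D Y"
    using Comp_closed[OF w P(2)] Comp_closed[OF w P(3)] by (auto simp: r_def t_def)
  have Mr: "M r x = M p (M w x)" and Mt: "M t x = M q (M w x)" if "x \<in> F D" for x
    using M_Comp[OF w P(2) that] M_Comp[OF w P(3) that] by (auto simp: r_def t_def)
  have rd: "M r d = a" "M t d = \<phi> a" using Mr[OF d] Mt[OF d] wd z by auto
  have graph: "M t x = \<phi> (M r x)" if x: "x \<in> F D" for x
  proof -
    obtain g where g: "g \<in> carrier Aut" "act g D d = x" by (rule transitive[OF D d x])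
    show ?thesis using act_M[OF g(1) r d] act_M[OF g(1) t d] g rd \<phi>_act[OF g(1) a] by simp
  qed
  have "inj_on (M r) (F D)"
  proof (rule inj_onI)
    fix x y assume x: "x \<in> F D" and y: "y \<in> F D" and eq: "M r x = M r y"
    have "M w x = M w y"
    proof (rule product_point_unique[OF P(4) M_closed[OF w x] M_closed[OF w y]])
      show "M p (M w x) = M p (M w y)" using eq Mr x y by simp
      show "M q (M w x) = M q (M w y)" using graph[OF x] graph[OF y] eq Mt x y by simp
    qed
    then show "x = y" using inj_onD[OF inj] x y by blast
  qed
  then have "is_iso B r" using mono_atoms_iso[OF D A r] mono_if_injective[OF r] by blast
  then obtain r' where r': "r' \<in> Hom B A D" "r' \<cdot> r = Idn B D" using is_iso_Hom[OF r] by blast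
  have u: "t \<cdot> r' \<in> Hom B A Y" using Comp_closed[OF r'(1) t] .
  have "M r' a = d" using M_Comp[OF r r'(1) d] r'(2) rd M_Idn[OF D' d] by simp
  then have ua: "M (t \<cdot> r') a = \<phi> a" using M_Comp[OF r'(1) t a] rd by simp
  have "M (t \<cdot> r') x = \<phi> x" if x: "x \<in> F A" for x
  proof -
    obtain g where g: "g \<in> carrier Aut" "act g A a = x" by (rule transitive[OF A a x])
    show ?thesis using act_M[OF g(1) u a] g ua \<phi>_act[OF g(1) a] by simp
  qed
  then show ?thesis using u by blast
qed

text \<open>On each summand \<open>full_atom\<close> provides a map; the universal property of the
  co-product glues them.\<close>

lemma full:
  assumes X: "X \<in> Obj B" and Y: "Y \<in> Obj B" and \<phi>: "equivariant X Y \<phi>"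
  shows "\<exists>u \<in> Hom B X Y. \<forall>x \<in> F X. M u x = \<phi> x"
proof -
  obtain n A w where "\<forall>k<n. atom B (A k)" and W: "is_finite_coproduct B n A X w"
    using decomposition[OF X] by blast
  then have A: "\<And>k. k < n \<Longrightarrow> atom B (A k)" by blast
  note w = finite_coproduct_in[OF W]
  have "\<exists>u. u \<in> Hom B (A k) Y \<and> (\<forall>a \<in> F (A k). M u a = \<phi> (M (w k) a))" if k: "k < n" for k
  proof -
    have "equivariant (A k) Y (\<lambda>a. \<phi> (M (w k) a))"
      unfolding equivariant_def
    proof (intro conjI ballI)
      fix a assume a: "a \<in> F (A k)"
      show "\<phi> (M (w k) a) \<in> F Y" using \<phi> M_closed[OF w[OF k] a] by (simp add: equivariant_def)
      fix g assume g: "g \<in> carrier Aut"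
      show "\<phi> (M (w k) (act g (A k) a)) = act g Y (\<phi> (M (w k) a))"
        using \<phi> M_closed[OF w[OF k] a] act_M[OF g w[OF k] a, symmetric] g by (simp add: equivariant_def)
    qed
    from full_atom[OF A[OF k] Y this] show ?thesis by blast
  qed
  then have "\<forall>k. \<exists>u. k < n \<longrightarrow> u \<in> Hom B (A k) Y \<and> (\<forall>a \<in> F (A k). M u a = \<phi> (M (w k) a))" by blast
  then obtain u where u: "\<forall>k. k < n \<longrightarrow> u k \<in> Hom B (A k) Y \<and> (\<forall>a \<in> F (A k). M (u k) a = \<phi> (M (w k) a))"
    by (drule_tac choice) blast
  then obtain h where h: "h \<in> Hom B X Y" "\<forall>k<n. h \<cdot> w k = u k"
    using finite_coproduct_ex[OF W Y, of u] by blast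
  have "M h x = \<phi> x" if x: "x \<in> F X" for x
  proof -
    obtain k a where k: "k < n" "a \<in> F (A k)" "M (w k) a = x" using coproduct_point[OF W A x] by blast
    show ?thesis using M_Comp[OF w[OF k(1)] h(1) k(2)] h(2) u k by simp
  qed
  then show ?thesis using h(1) by blast
qed

section \<open>Invariant relations and their quotients\<close>

lemma lift_through_injective:
  assumes f: "f \<in> Hom B V Y" and m: "m \<in> Hom B X Y" and inj: "inj_on (M m) (F X)"
    and im: "\<And>x. x \<in> F V \<Longrightarrow> M f x \<in> M m ` F X"
  shows "\<exists>h \<in> Hom B V X. m \<cdot> h = f"
proof -
  \<comment> \<open>The pointwise factorization through the injective \<open>M m\<close>. It
    commutes with the group because \<open>M f\<close> and \<open>M m\<close> do, so
    \<open>full\<close> turns it into a map, and \<open>faithful\<close> gives the required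
    equation.\<close>
  define \<phi> where "\<phi> x = inv_into (F X) (M m) (M f x)" for x
  have \<phi>: "\<phi> x \<in> F X" "M m (\<phi> x) = M f x" if "x \<in> F V" for x
    using inv_into_into[OF im[OF that]] f_inv_into_f[OF im[OF that]] by (auto simp: \<phi>_def)
  have V: "V \<in> Obj B" and X: "X \<in> Obj B" using Hom_obj[OF f] Hom_obj[OF m] by auto
  have "equivariant V X \<phi>"
    unfolding equivariant_def
  proof (intro conjI ballI)
    fix x assume x: "x \<in> F V"
    show "\<phi> x \<in> F X" using \<phi> x by blast
    fix g assume g: "g \<in> carrier Aut"
    have "M m (\<phi> (act g V x)) = M m (act g X (\<phi> x))"
      using \<phi>(2)[OF act_closed[OF g V x]] act_M[OF g f x] act_M[OF g m \<phi>(1)[OF x]] \<phi>(2)[OF x] by simp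
    then show "\<phi> (act g V x) = act g X (\<phi> x)"
      using inj_onD[OF inj] \<phi>(1)[OF act_closed[OF g V x]] act_closed[OF g X \<phi>(1)[OF x]] by blast
  qed
  then obtain h where h: "h \<in> Hom B V X" "\<forall>x \<in> F V. M h x = \<phi> x" using full[OF V X] by blast
  have "m \<cdot> h = f"
  proof (rule faithful[OF Comp_closed[OF h(1) m] f])
    fix x assume x: "x \<in> F V"
    show "M (m \<cdot> h) x = M f x" using M_Comp[OF h(1) m x] h(2) \<phi>(2)[OF x] x by simp
  qed
  then show ?thesis using h(1) by blast
qed

text \<open>An invariant subset of \<open>F P\<close> is the image of the co-product of the atoms of \<open>P\<close> that it meets.\<close>

lemma invariant_subobject:
  assumes P: "P \<in> Obj B"
    and inv: "\<And>g z. g \<in> carrier Aut \<Longrightarrow> z \<in> F P \<Longrightarrow> S z \<Longrightarrow> S (act g P z)"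
  obtains R m where "m \<in> Hom B R P" "inj_on (M m) (F R)" "M m ` F R = {z \<in> F P. S z}"
proof -
  obtain n D w where "\<forall>k<n. atom B (D k)" and W: "is_finite_coproduct B n D P w"
    using decomposition[OF P] by blast
  then have D: "\<And>k. k < n \<Longrightarrow> atom B (D k)" by blast
  note w = finite_coproduct_in[OF W]
  \<comment> \<open>The group is transitive on the points of an atom, so an atom that meets the
    invariant set lies in it entirely; this is \<open>KS\<close>.\<close>
  define K where "K = {k. k < n \<and> (\<exists>d \<in> F (D k). S (M (w k) d))}"
  have K: "k < n" if "k \<in> K" for k using that by (simp add: K_def)
  have finK: "finite K" by (simp add: K_def)
  have KS: "S (M (w k) d)" if k: "k \<in> K" and d: "d \<in> F (D k)" for k d
  proof -
    obtain d' where d': "d' \<in> F (D k)" "S (M (w k) d')" using k by (auto simp: K_def)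
    obtain g where g: "g \<in> carrier Aut" "act g (D k) d' = d" by (rule transitive[OF D[OF K[OF k]] d'(1) d])
    show ?thesis
      using inv[OF g(1) M_closed[OF w[OF K[OF k]] d'(1)] d'(2)] act_M[OF g(1) w[OF K[OF k]] d'(1)] g(2) by simp
  qed
  \<comment> \<open>Finite co-products are indexed by initial segments of \<open>nat\<close>, so
    \<open>K\<close> is renumbered.\<close>
  obtain e where e: "bij_betw e {..<card K} K"
    using ex_bij_betw_nat_finite[OF finK] by (auto simp: atLeast0LessThan)
  have eK: "e i \<in> K" if "i < card K" for i using bij_betwE[OF e] that by blast
  have De: "atom B (D (e i))" if "i < card K" for i using D K eK that by blast
  have "\<forall>i<card K. D (e i) \<in> Obj B" using De atom_obj by blast
  then obtain R \<iota> where R: "is_finite_coproduct B (card K) (\<lambda>i. D (e i)) R \<iota>"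
    using finite_coproducts[of "card K" "\<lambda>i. D (e i)"] by blast
  note \<iota> = finite_coproduct_in[OF R]
  obtain m where m: "m \<in> Hom B R P" "\<forall>i<card K. m \<cdot> \<iota> i = w (e i)"
    using finite_coproduct_ex[OF R P, of "\<lambda>i. w (e i)"] w K eK by blast
  have Mm: "M m (M (\<iota> i) d) = M (w (e i)) d" if "i < card K" "d \<in> F (D (e i))" for i d
    using M_Comp[OF \<iota>[OF that(1)] m(1) that(2)] m(2) that by simp
  have "inj_on (M m) (F R)"
  proof (rule inj_onI)
    fix x y assume x: "x \<in> F R" and y: "y \<in> F R" and eq: "M m x = M m y"
    obtain i d where i: "i < card K" "d \<in> F (D (e i))" "M (\<iota> i) d = x"
      using coproduct_point[OF R De x] by blast
    obtain j d' where j: "j < card K" "d' \<in> F (D (e j))" "M (\<iota> j) d' = y"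
      using coproduct_point[OF R De y] by blast
    have "M (w (e i)) d = M (w (e j)) d'" using Mm[OF i(1,2)] Mm[OF j(1,2)] i j eq by simp
    then have *: "e i = e j" "d = d'"
      using coproduct_point_unique[OF W D K[OF eK[OF i(1)]] K[OF eK[OF j(1)]] i(2) j(2)] by blast+
    then have "i = j" using e i(1) j(1) by (auto simp: bij_betw_def dest: inj_onD)
    then show "x = y" using * i j by simp
  qed
  moreover have "M m ` F R = {z \<in> F P. S z}"
  proof (intro equalityI subsetI)
    fix z assume "z \<in> M m ` F R"
    then obtain x where x: "x \<in> F R" "z = M m x" by blast
    obtain i d where i: "i < card K" "d \<in> F (D (e i))" "M (\<iota> i) d = x"
      using coproduct_point[OF R De x(1)] by blast
    have "z = M (w (e i)) d" using Mm[OF i(1,2)] x i by simp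
    then show "z \<in> {z \<in> F P. S z}" using KS[OF eK[OF i(1)] i(2)] M_closed[OF m(1) x(1)] x(2) by simp
  next
    fix z assume "z \<in> {z \<in> F P. S z}"
    then have z: "z \<in> F P" "S z" by auto
    obtain k d where k: "k < n" "d \<in> F (D k)" "M (w k) d = z" using coproduct_point[OF W D z(1)] by blast
    then have "k \<in> e ` {..<card K}" using z bij_betw_imp_surj_on[OF e] by (auto simp: K_def)
    then obtain i where i: "i < card K" "e i = k" by blast
    have "M m (M (\<iota> i) d) = z" using Mm[of i d] i k by simp
    moreover have "M (\<iota> i) d \<in> F R" using M_closed[OF \<iota>[OF i(1)], of d] i k by simp
    ultimately show "z \<in> M m ` F R" by blast
  qed
  ultimately show ?thesis by (rule that[OF m(1)])
qed

text \<open>Each structure map of an internal equivalence relation is a lift to \<open>R\<close> of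
  a pair of parallel maps into \<open>A\<close>. Such a pair lifts as soon as it is related
  pointwise, so the three properties of \<open>rel\<close> on points produce the three maps.\<close>

lemma internal_equivalence_relationI:
  assumes A: "A \<in> Obj B" and P: "is_product B A A P p q" and m: "m \<in> Hom B R P"
    and inj: "inj_on (M m) (F R)" and im: "M m ` F R = {z \<in> F P. rel (M p z) (M q z)}"
    and refl: "\<And>x. x \<in> F A \<Longrightarrow> rel x x"
    and sym: "\<And>x y. x \<in> F A \<Longrightarrow> y \<in> F A \<Longrightarrow> rel x y \<Longrightarrow> rel y x"
    and trans: "\<And>x y z. x \<in> F A \<Longrightarrow> y \<in> F A \<Longrightarrow> z \<in> F A \<Longrightarrow> rel x y \<Longrightarrow> rel y z \<Longrightarrow> rel x z"
  shows "internal_equivalence_relation B A R (p \<cdot> m) (q \<cdot> m)"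
proof -
  note D = product_D[OF P]
  let ?r1 = "p \<cdot> m" and ?r2 = "q \<cdot> m"
  have r1: "?r1 \<in> Hom B R A" and r2: "?r2 \<in> Hom B R A"
    using Comp_closed[OF m D(2)] Comp_closed[OF m D(3)] .
  have M1: "M ?r1 x = M p (M m x)" and M2: "M ?r2 x = M q (M m x)" if "x \<in> F R" for x
    using M_Comp[OF m D(2) that] M_Comp[OF m D(3) that] .
  have rel: "rel (M ?r1 x) (M ?r2 x)" if "x \<in> F R" for x
  proof -
    have "M m x \<in> {z \<in> F P. rel (M p z) (M q z)}" using im that by blast
    then show ?thesis using M1[OF that] M2[OF that] by simp
  qed
  have lift: "\<exists>h \<in> Hom B V R. ?r1 \<cdot> h = u \<and> ?r2 \<cdot> h = v"
    if u: "u \<in> Hom B V A" and v: "v \<in> Hom B V A" and uv: "\<And>x. x \<in> F V \<Longrightarrow> rel (M u x) (M v x)" for V u v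
  proof -
    obtain t where t: "t \<in> Hom B V P" "p \<cdot> t = u" "q \<cdot> t = v" using product_lift[OF P u v] by blast
    have "M t x \<in> M m ` F R" if x: "x \<in> F V" for x
      using M_Comp[OF t(1) D(2) x] M_Comp[OF t(1) D(3) x] uv[OF x] M_closed[OF t(1) x] t by (simp add: im)
    then obtain h where h: "h \<in> Hom B V R" "m \<cdot> h = t"
      using lift_through_injective[OF t(1) m inj] by blast
    then show ?thesis
      using Comp_assoc[OF h(1) m D(2)] Comp_assoc[OF h(1) m D(3)] t by (intro bexI[of _ h]) simp_all
  qed
  have "\<exists>s \<in> Hom B A R. ?r1 \<cdot> s = Idn B A \<and> ?r2 \<cdot> s = Idn B A"
    using refl M_Idn[OF A] by (intro lift Idn_closed[OF A]) simp
  moreover have "\<exists>t \<in> Hom B R R. ?r1 \<cdot> t = ?r2 \<and> ?r2 \<cdot> t = ?r1"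
    using sym rel M_closed[OF r1] M_closed[OF r2] by (intro lift r1 r2) simp
  moreover have "\<exists>u \<in> Hom B Q R. ?r1 \<cdot> u = ?r1 \<cdot> a \<and> ?r2 \<cdot> u = ?r2 \<cdot> b"
    if Q: "is_fiber_product B ?r2 ?r1 Q a b" for Q a b
  proof (rule lift)
    note E = fiber_product_D[OF Q r2 r1]
    show "?r1 \<cdot> a \<in> Hom B Q A" "?r2 \<cdot> b \<in> Hom B Q A" using Comp_closed[OF E(2) r1] Comp_closed[OF E(3) r2] .
    fix x assume x: "x \<in> F Q"
    note ax = M_closed[OF E(2) x] and bx = M_closed[OF E(3) x]
    have "M ?r2 (M a x) = M ?r1 (M b x)"
      using M_Comp[OF E(2) r2 x] M_Comp[OF E(3) r1 x] E(4) by simp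
    then have "rel (M ?r1 (M a x)) (M ?r2 (M b x))"
      using rel[OF ax] rel[OF bx] trans[OF M_closed[OF r1 ax] M_closed[OF r2 ax] M_closed[OF r2 bx]] by simp
    then show "rel (M (?r1 \<cdot> a) x) (M (?r2 \<cdot> b) x)"
      using M_Comp[OF E(2) r1 x] M_Comp[OF E(3) r2 x] by simp
  qed
  moreover have "R \<in> Obj B" using Hom_obj[OF m] by simp
  moreover have "is_mono B m" by (rule mono_if_injective[OF m inj])
  ultimately show ?thesis
    unfolding internal_equivalence_relation_def using A P m by blast
qed

text \<open>By transitivity \<open>F A\<close> is the coset space of \<open>Stab A a\<close>, a
  subgroup of \<open>U\<close>. Its partition into the fibers over the coset space of
  \<open>U\<close> is an invariant equivalence relation, hence an internal one. Effectivity gives a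
  quotient map \<open>c\<close> that identifies exactly the related points, and then the stabilizer
  of \<open>M c a\<close> is \<open>U\<close>.\<close>

lemma open_subgroup_in_Stabs:
  assumes eff: "effective_equivalence_relations B" and U: "open_subgroup Aut Top U"
  shows "U \<in> Stabs"
proof -
  have sU: "subgroup U Aut" using U by (simp add: open_subgroup_def)
  note Uc = subgroup.mem_carrier[OF sU]
  obtain A a where A: "atom B A" and a: "a \<in> F A" and SU: "Stab A a \<subseteq> U"
    using open_contains_Stab[of U] U subgroup.one_closed[OF sU] by (auto simp: open_subgroup_def)
  note A' = atom_obj[OF A]
  \<comment> \<open>The images of \<open>a\<close> under two group elements are related when these
    lie in one left coset of \<open>U\<close>.\<close>
  define rel where "rel x y \<longleftrightarrow> (\<exists>g \<in> carrier Aut. \<exists>u \<in> U. x = act g A a \<and> y = act (g \<otimes>\<^bsub>Aut\<^esub> u) A a)" for x y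
  \<comment> \<open>Two group elements with the same value at \<open>a\<close> differ by an element
    of \<open>Stab A a\<close>, hence of \<open>U\<close>. So representatives can be exchanged, as
    the proof of transitivity requires.\<close>
  have act_eq: "\<exists>v \<in> U. h = g \<otimes>\<^bsub>Aut\<^esub> v"
    if g: "g \<in> carrier Aut" and h: "h \<in> carrier Aut" and eq: "act g A a = act h A a" for g h
  proof -
    have "act (inv\<^bsub>Aut\<^esub> g \<otimes>\<^bsub>Aut\<^esub> h) A a = a"
      using act_inv(1)[OF g A' a] eq g h by (simp add: act_mult A' a)
    then have "inv\<^bsub>Aut\<^esub> g \<otimes>\<^bsub>Aut\<^esub> h \<in> U" using SU g h by (auto simp: Stab_def)
    moreover have "h = g \<otimes>\<^bsub>Aut\<^esub> (inv\<^bsub>Aut\<^esub> g \<otimes>\<^bsub>Aut\<^esub> h)" using g h by (simp add: G.m_assoc[symmetric])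
    ultimately show ?thesis by blast
  qed
  have refl: "rel x x" if x: "x \<in> F A" for x
  proof -
    obtain g where g: "g \<in> carrier Aut" "act g A a = x" by (rule transitive[OF A a x])
    then show ?thesis using subgroup.one_closed[OF sU]
      unfolding rel_def by (intro bexI[of _ g] bexI[of _ "\<one>\<^bsub>Aut\<^esub>"]) simp_all
  qed
  have sym: "rel y x" if "rel x y" for x y
  proof -
    obtain g u where g: "g \<in> carrier Aut" and u: "u \<in> U" and x: "x = act g A a" and y: "y = act (g \<otimes>\<^bsub>Aut\<^esub> u) A a"
      using \<open>rel x y\<close> by (auto simp: rel_def)
    have "g = (g \<otimes>\<^bsub>Aut\<^esub> u) \<otimes>\<^bsub>Aut\<^esub> inv\<^bsub>Aut\<^esub> u" using g Uc[OF u] by (simp add: G.m_assoc)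
    then show ?thesis
      using x y g Uc[OF u] subgroup.m_inv_closed[OF sU u]
      unfolding rel_def by (intro bexI[of _ "g \<otimes>\<^bsub>Aut\<^esub> u"] bexI[of _ "inv\<^bsub>Aut\<^esub> u"]) simp_all
  qed
  have trans: "rel x z" if "rel x y" "rel y z" for x y z
  proof -
    obtain g u where g: "g \<in> carrier Aut" and u: "u \<in> U" and x: "x = act g A a" and y: "y = act (g \<otimes>\<^bsub>Aut\<^esub> u) A a"
      using \<open>rel x y\<close> by (auto simp: rel_def)
    obtain h v where h: "h \<in> carrier Aut" and v: "v \<in> U" and y': "y = act h A a" and z: "z = act (h \<otimes>\<^bsub>Aut\<^esub> v) A a"
      using \<open>rel y z\<close> by (auto simp: rel_def)
    obtain s where s: "s \<in> U" "h = (g \<otimes>\<^bsub>Aut\<^esub> u) \<otimes>\<^bsub>Aut\<^esub> s"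
      using act_eq[of "g \<otimes>\<^bsub>Aut\<^esub> u" h] g Uc[OF u] h y y' by auto
    have "h \<otimes>\<^bsub>Aut\<^esub> v = g \<otimes>\<^bsub>Aut\<^esub> (u \<otimes>\<^bsub>Aut\<^esub> (s \<otimes>\<^bsub>Aut\<^esub> v))"
      using g Uc[OF u] Uc[OF s(1)] Uc[OF v] by (simp add: s(2) G.m_assoc)
    moreover have "u \<otimes>\<^bsub>Aut\<^esub> (s \<otimes>\<^bsub>Aut\<^esub> v) \<in> U"
      using subgroup.m_closed[OF sU] u s(1) v by blast
    ultimately show ?thesis using g x z unfolding rel_def by auto
  qed
  have invar: "rel (act k A x) (act k A y)" if k: "k \<in> carrier Aut" and xy: "rel x y" for k x y
  proof -
    obtain g u where g: "g \<in> carrier Aut" and u: "u \<in> U" and x: "x = act g A a" and y: "y = act (g \<otimes>\<^bsub>Aut\<^esub> u) A a"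
      using xy by (auto simp: rel_def)
    have "act k A x = act (k \<otimes>\<^bsub>Aut\<^esub> g) A a" "act k A y = act ((k \<otimes>\<^bsub>Aut\<^esub> g) \<otimes>\<^bsub>Aut\<^esub> u) A a"
      using act_mult[OF k g A' a] act_mult[OF k _ A' a, of "g \<otimes>\<^bsub>Aut\<^esub> u"] k g Uc[OF u]
      by (simp_all add: x y G.m_assoc)
    then show ?thesis using u k g unfolding rel_def by (intro bexI[of _ "k \<otimes>\<^bsub>Aut\<^esub> g"] bexI[of _ u]) simp_all
  qed
  obtain P p q where P: "P \<in> Obj B" "p \<in> Hom B P A" "q \<in> Hom B P A" "is_product B A A P p q"
    using products[OF A' A'] by (elim exE conjE) (rule that)
  obtain R m where m: "m \<in> Hom B R P" "inj_on (M m) (F R)"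
    and im: "M m ` F R = {z \<in> F P. rel (M p z) (M q z)}"
  proof (rule invariant_subobject[OF P(1), of "\<lambda>z. rel (M p z) (M q z)"])
    fix g z assume "g \<in> carrier Aut" "z \<in> F P" "rel (M p z) (M q z)"
    then show "rel (M p (act g P z)) (M q (act g P z))"
      using act_M[OF _ P(2)] act_M[OF _ P(3)] invar by metis
  qed
  let ?r1 = "p \<cdot> m" and ?r2 = "q \<cdot> m"
  have r: "?r1 \<in> Hom B R A" "?r2 \<in> Hom B R A"
    using Comp_closed[OF m(1) P(2)] Comp_closed[OF m(1) P(3)] .
  have "internal_equivalence_relation B A R ?r1 ?r2"
    by (rule internal_equivalence_relationI[OF A' P(4) m im refl sym trans])
  then obtain Q c where Q: "is_coequalizer B ?r1 ?r2 Q c" and ker: "is_fiber_product B c c R ?r1 ?r2"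
    using eff unfolding effective_equivalence_relations_def by blast
  have c: "c \<in> Hom B A Q" "c \<cdot> ?r1 = c \<cdot> ?r2" "Q \<in> Obj B"
    using Q Hom_D[OF r(1)] by (auto simp: is_coequalizer_def)
  \<comment> \<open>The forward direction rests on effectivity: the kernel pair of \<open>c\<close>
    is \<open>R\<close>, so two points with the same image under \<open>c\<close> come from a point
    of \<open>F R\<close>.\<close>
  have Mc: "M c x = M c y \<longleftrightarrow> rel x y" if x: "x \<in> F A" and y: "y \<in> F A" for x y
  proof
    assume "M c x = M c y"
    then obtain z where z: "z \<in> F R" "M ?r1 z = x" "M ?r2 z = y"
      using fiber_product_point[OF ker c(1) c(1) x y] by blast
    then show "rel x y" using im M_Comp[OF m(1) P(2) z(1)] M_Comp[OF m(1) P(3) z(1)] by auto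
  next
    assume xy: "rel x y"
    obtain z where z: "z \<in> F P" "M p z = x" "M q z = y" using product_point[OF P(4) x y] by blast
    then have "z \<in> M m ` F R" using im xy by simp
    then obtain t where t: "t \<in> F R" "z = M m t" by blast
    have "M ?r1 t = x" "M ?r2 t = y"
      using M_Comp[OF m(1) P(2) t(1)] M_Comp[OF m(1) P(3) t(1)] z t by auto
    then show "M c x = M c y"
      using M_Comp[OF r(1) c(1) t(1)] M_Comp[OF r(2) c(1) t(1)] c(2) by simp
  qed
  have ca: "M c a \<in> F Q" by (rule M_closed[OF c(1) a])
  have "act g Q (M c a) = M c a \<longleftrightarrow> g \<in> U" if g: "g \<in> carrier Aut" for g
  proof -
    have "act g Q (M c a) = M c a \<longleftrightarrow> rel a (act g A a)"
      using act_M[OF g c(1) a] Mc[OF a act_closed[OF g A' a]] by auto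
    also have "\<dots> \<longleftrightarrow> g \<in> U"
    proof
      assume "g \<in> U"
      then show "rel a (act g A a)" using g act_one[OF A' a]
        unfolding rel_def by (intro bexI[of _ "\<one>\<^bsub>Aut\<^esub>"] bexI[of _ g]) simp_all
    next
      assume "rel a (act g A a)"
      then obtain h u where h: "h \<in> carrier Aut" "a = act h A a" and u: "u \<in> U"
        and eq: "act g A a = act (h \<otimes>\<^bsub>Aut\<^esub> u) A a" by (auto simp: rel_def)
      have "h \<in> U" using SU h by (auto simp: Stab_def)
      then have hu: "h \<otimes>\<^bsub>Aut\<^esub> u \<in> U" using subgroup.m_closed[OF sU] u by blast
      obtain v where "v \<in> U" "g = (h \<otimes>\<^bsub>Aut\<^esub> u) \<otimes>\<^bsub>Aut\<^esub> v"
        using act_eq[OF Uc[OF hu] g] eq by auto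
      then show "g \<in> U" using subgroup.m_closed[OF sU hu] by blast
    qed
    finally show ?thesis .
  qed
  then have "Stab Q (M c a) = U" using Uc by (auto simp: Stab_def)
  then show ?thesis using Stab_in_Stabs[OF c(3) ca] by simp
qed

end

section \<open>Categories of smooth sets\<close>

lemma is_functor_Hom:
  assumes "is_functor C D Fo Fa" "f \<in> Hom C X Y"
  shows "Fa f \<in> Hom D (Fo X) (Fo Y)"
  using assms by (auto simp: is_functor_def Hom_def)

lemma is_functor_Comp:
  assumes "is_functor C D Fo Fa" "f \<in> Hom C X Y" "g \<in> Hom C Y Z"
  shows "Fa (g \<cdot>\<^bsub>C\<^esub> f) = Fa g \<cdot>\<^bsub>D\<^esub> Fa f"
  using assms by (auto simp: is_functor_def Hom_def)

text \<open>The quasi-inverse chooses \<open>Go Z\<close> together with mutually inverse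
  \<open>e Z\<close> and \<open>e' Z\<close> between \<open>Fo (Go Z)\<close> and \<open>Z\<close>;
  an arrow is conjugated by these and pulled back along \<open>Fa\<close>. Equations in
  \<open>C\<close> are checked after applying \<open>Fa\<close>, which is injective on Hom
  sets.\<close>

lemma fully_faithful_essentially_surjective_imp_equivalent:
  assumes "category C" "category D" and F: "is_functor C D Fo Fa"
    and ff: "\<And>X Y. X \<in> Obj C \<Longrightarrow> Y \<in> Obj C \<Longrightarrow> bij_betw Fa (Hom C X Y) (Hom D (Fo X) (Fo Y))"
    and es: "\<And>Z. Z \<in> Obj D \<Longrightarrow> \<exists>X \<in> Obj C. isomorphic D (Fo X) Z"
  shows "equivalent_categories C D"
proof -
  interpret C: category C by fact
  interpret D: category D by fact
  note F_Hom = is_functor_Hom[OF F] and F_Comp = is_functor_Comp[OF F]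
  have F_obj: "Fo X \<in> Obj D" if "X \<in> Obj C" for X using F that by (simp add: is_functor_def)
  have F_id: "Fa (Idn C X) = Idn D (Fo X)" if "X \<in> Obj C" for X using F that by (simp add: is_functor_def)
  define Go where "Go Z = (SOME X. X \<in> Obj C \<and> isomorphic D (Fo X) Z)" for Z
  have "\<exists>X. X \<in> Obj C \<and> isomorphic D (Fo X) Z" if "Z \<in> Obj D" for Z using es that by blast
  then have Go: "Go Z \<in> Obj C" "isomorphic D (Fo (Go Z)) Z" if "Z \<in> Obj D" for Z
    using someI_ex[of "\<lambda>X. X \<in> Obj C \<and> isomorphic D (Fo X) Z"] that unfolding Go_def by blast+
  have "\<exists>p. fst p \<in> Hom D (Fo (Go Z)) Z \<and> snd p \<in> Hom D Z (Fo (Go Z)) \<and>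
      snd p \<cdot>\<^bsub>D\<^esub> fst p = Idn D (Fo (Go Z)) \<and> fst p \<cdot>\<^bsub>D\<^esub> snd p = Idn D Z" if "Z \<in> Obj D" for Z
    by (rule D.isomorphicE[OF Go(2)[OF that]]) auto
  then have "\<forall>Z. \<exists>p. Z \<in> Obj D \<longrightarrow> fst p \<in> Hom D (Fo (Go Z)) Z \<and> snd p \<in> Hom D Z (Fo (Go Z)) \<and>
      snd p \<cdot>\<^bsub>D\<^esub> fst p = Idn D (Fo (Go Z)) \<and> fst p \<cdot>\<^bsub>D\<^esub> snd p = Idn D Z" by blast
  from choice[OF this] obtain p where p: "\<forall>Z. Z \<in> Obj D \<longrightarrow>
      fst (p Z) \<in> Hom D (Fo (Go Z)) Z \<and> snd (p Z) \<in> Hom D Z (Fo (Go Z)) \<and>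
      snd (p Z) \<cdot>\<^bsub>D\<^esub> fst (p Z) = Idn D (Fo (Go Z)) \<and> fst (p Z) \<cdot>\<^bsub>D\<^esub> snd (p Z) = Idn D Z" ..
  define e e' where "e Z = fst (p Z)" and "e' Z = snd (p Z)" for Z
  have e: "e Z \<in> Hom D (Fo (Go Z)) Z" and e': "e' Z \<in> Hom D Z (Fo (Go Z))"
    and e'e: "e' Z \<cdot>\<^bsub>D\<^esub> e Z = Idn D (Fo (Go Z))" and ee': "e Z \<cdot>\<^bsub>D\<^esub> e' Z = Idn D Z" if "Z \<in> Obj D" for Z
    using p that by (auto simp: e_def e'_def)
  define lift where "lift X Y f = inv_into (Hom C X Y) Fa f" for X Y f
  have lift: "lift X Y f \<in> Hom C X Y" "Fa (lift X Y f) = f"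
    if "X \<in> Obj C" "Y \<in> Obj C" "f \<in> Hom D (Fo X) (Fo Y)" for X Y f
    using bij_betw_inv_into_right[OF ff[OF that(1,2)] that(3)] bij_betw_imp_surj_on[OF ff[OF that(1,2)]]
      inv_into_into[of f Fa "Hom C X Y"] that(3) by (auto simp: lift_def)
  have inj: "f = g" if "f \<in> Hom C X Y" "g \<in> Hom C X Y" "Fa f = Fa g" for X Y f g
    using bij_betw_imp_inj_on[OF ff] C.Hom_obj[OF that(1)] that by (auto dest: inj_onD)
  define Ga where "Ga f = lift (Go (Dom D f)) (Go (Cod D f)) (e' (Cod D f) \<cdot>\<^bsub>D\<^esub> (f \<cdot>\<^bsub>D\<^esub> e (Dom D f)))" for f
  have mid: "e' Z' \<cdot>\<^bsub>D\<^esub> (f \<cdot>\<^bsub>D\<^esub> e Z) \<in> Hom D (Fo (Go Z)) (Fo (Go Z'))" if f: "f \<in> Hom D Z Z'" for f Z Z'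
  proof -
    have Z: "Z \<in> Obj D" "Z' \<in> Obj D" using D.Hom_obj[OF f] by auto
    show ?thesis by (rule D.Comp_closed[OF D.Comp_closed[OF e[OF Z(1)] f] e'[OF Z(2)]])
  qed
  have Ga: "Ga f \<in> Hom C (Go Z) (Go Z')" "Fa (Ga f) = e' Z' \<cdot>\<^bsub>D\<^esub> (f \<cdot>\<^bsub>D\<^esub> e Z)" if f: "f \<in> Hom D Z Z'" for f Z Z'
  proof -
    have Z: "Z \<in> Obj D" "Z' \<in> Obj D" using D.Hom_obj[OF f] by auto
    show "Ga f \<in> Hom C (Go Z) (Go Z')" "Fa (Ga f) = e' Z' \<cdot>\<^bsub>D\<^esub> (f \<cdot>\<^bsub>D\<^esub> e Z)"
      using lift[OF Go(1)[OF Z(1)] Go(1)[OF Z(2)] mid[OF f]] D.Hom_D[OF f] by (auto simp: Ga_def)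
  qed
  have "is_functor D C Go Ga"
    unfolding is_functor_def
  proof (intro conjI ballI impI)
    fix Z assume Z: "Z \<in> Obj D"
    show "Go Z \<in> Obj C" by (rule Go(1)[OF Z])
    note id = D.Idn_closed[OF Z]
    show "Ga (Idn D Z) = Idn C (Go Z)"
    proof (rule inj[OF Ga(1)[OF id] C.Idn_closed[OF Go(1)[OF Z]]])
      show "Fa (Ga (Idn D Z)) = Fa (Idn C (Go Z))"
        using Ga(2)[OF id] D.Idn_Comp[OF e[OF Z]] e'e[OF Z] F_id[OF Go(1)[OF Z]] by simp
    qed
  next
    fix f assume "f \<in> Arr D"
    then have f: "f \<in> Hom D (Dom D f) (Cod D f)" by (rule D.Hom_I)
    show "Ga f \<in> Hom C (Go (Dom D f)) (Go (Cod D f))" by (rule Ga(1)[OF f])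
    fix g assume "g \<in> Arr D" "Dom D g = Cod D f"
    then have g: "g \<in> Hom D (Cod D f) (Cod D g)" by (simp add: Hom_def)
    let ?X = "Dom D f" and ?Y = "Cod D f" and ?Z = "Cod D g"
    have X: "?X \<in> Obj D" and Y: "?Y \<in> Obj D" and Z: "?Z \<in> Obj D"
      using D.Hom_obj[OF f] D.Hom_obj[OF g] by auto
    note gf = D.Comp_closed[OF f g]
    note fe = D.Comp_closed[OF e[OF X] f] and ge = D.Comp_closed[OF e[OF Y] g]
    show "Ga (g \<cdot>\<^bsub>D\<^esub> f) = Ga g \<cdot>\<^bsub>C\<^esub> Ga f"
    proof (rule inj[OF Ga(1)[OF gf] C.Comp_closed[OF Ga(1)[OF f] Ga(1)[OF g]]])
      have "Fa (Ga g \<cdot>\<^bsub>C\<^esub> Ga f) = (e' ?Z \<cdot>\<^bsub>D\<^esub> (g \<cdot>\<^bsub>D\<^esub> e ?Y)) \<cdot>\<^bsub>D\<^esub> (e' ?Y \<cdot>\<^bsub>D\<^esub> (f \<cdot>\<^bsub>D\<^esub> e ?X))"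
        using F_Comp[OF Ga(1)[OF f] Ga(1)[OF g]] Ga(2)[OF f] Ga(2)[OF g] by simp
      also have "\<dots> = e' ?Z \<cdot>\<^bsub>D\<^esub> ((g \<cdot>\<^bsub>D\<^esub> e ?Y) \<cdot>\<^bsub>D\<^esub> (e' ?Y \<cdot>\<^bsub>D\<^esub> (f \<cdot>\<^bsub>D\<^esub> e ?X)))"
        by (rule D.Comp_assoc[OF mid[OF f] ge e'[OF Z]])
      also have "(g \<cdot>\<^bsub>D\<^esub> e ?Y) \<cdot>\<^bsub>D\<^esub> (e' ?Y \<cdot>\<^bsub>D\<^esub> (f \<cdot>\<^bsub>D\<^esub> e ?X)) = g \<cdot>\<^bsub>D\<^esub> (e ?Y \<cdot>\<^bsub>D\<^esub> (e' ?Y \<cdot>\<^bsub>D\<^esub> (f \<cdot>\<^bsub>D\<^esub> e ?X)))"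
        by (rule D.Comp_assoc[OF mid[OF f] e[OF Y] g])
      also have "e ?Y \<cdot>\<^bsub>D\<^esub> (e' ?Y \<cdot>\<^bsub>D\<^esub> (f \<cdot>\<^bsub>D\<^esub> e ?X)) = f \<cdot>\<^bsub>D\<^esub> e ?X"
        by (rule D.cancel_section[OF ee'[OF Y] e'[OF Y] e[OF Y] fe])
      also have "g \<cdot>\<^bsub>D\<^esub> (f \<cdot>\<^bsub>D\<^esub> e ?X) = (g \<cdot>\<^bsub>D\<^esub> f) \<cdot>\<^bsub>D\<^esub> e ?X"
        by (rule D.Comp_assoc[OF e[OF X] f g, symmetric])
      finally show "Fa (Ga (g \<cdot>\<^bsub>D\<^esub> f)) = Fa (Ga g \<cdot>\<^bsub>C\<^esub> Ga f)" using Ga(2)[OF gf] by simp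
    qed
  qed
  moreover have "is_natural_iso D D (Fo \<circ> Go) (Fa \<circ> Ga) id id e"
    unfolding is_natural_iso_def
  proof (intro conjI ballI)
    fix Z assume Z: "Z \<in> Obj D"
    show "e Z \<in> Hom D ((Fo \<circ> Go) Z) (id Z)" using e[OF Z] by simp
    show "is_iso D (e Z)" using D.is_iso_Hom[OF e[OF Z]] e'[OF Z] e'e[OF Z] ee'[OF Z] by blast
  next
    fix f assume "f \<in> Arr D"
    then have f: "f \<in> Hom D (Dom D f) (Cod D f)" by (rule D.Hom_I)
    let ?X = "Dom D f" and ?Y = "Cod D f"
    have X: "?X \<in> Obj D" and Y: "?Y \<in> Obj D" using D.Hom_obj[OF f] by auto
    show "e ?Y \<cdot>\<^bsub>D\<^esub> (Fa \<circ> Ga) f = id f \<cdot>\<^bsub>D\<^esub> e ?X"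
      using Ga(2)[OF f] D.cancel_section[OF ee'[OF Y] e'[OF Y] e[OF Y] D.Comp_closed[OF e[OF X] f]] by simp
  qed
  \<comment> \<open>The unit is the arrow that \<open>Fa\<close> sends to the inverse of the
    counit.\<close>
  moreover define \<eta> where "\<eta> X = lift X (Go (Fo X)) (e' (Fo X))" for X
  have \<eta>: "\<eta> X \<in> Hom C X (Go (Fo X))" "Fa (\<eta> X) = e' (Fo X)" if X: "X \<in> Obj C" for X
    using lift[OF X Go(1)[OF F_obj[OF X]] e'[OF F_obj[OF X]]] by (auto simp: \<eta>_def)
  have "is_natural_iso C C id id (Go \<circ> Fo) (Ga \<circ> Fa) \<eta>"
    unfolding is_natural_iso_def
  proof (intro conjI ballI)
    fix X assume X: "X \<in> Obj C"
    note FX = F_obj[OF X] and GFX = Go(1)[OF F_obj[OF X]]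
    show "\<eta> X \<in> Hom C (id X) ((Go \<circ> Fo) X)" using \<eta>(1)[OF X] by simp
    let ?\<theta> = "lift (Go (Fo X)) X (e (Fo X))"
    note \<theta> = lift[OF GFX X e[OF FX]]
    have "?\<theta> \<cdot>\<^bsub>C\<^esub> \<eta> X = Idn C X"
      by (rule inj[OF C.Comp_closed[OF \<eta>(1)[OF X] \<theta>(1)] C.Idn_closed[OF X]])
        (simp add: F_Comp[OF \<eta>(1)[OF X] \<theta>(1)] \<eta>(2)[OF X] \<theta>(2) ee'[OF FX] F_id[OF X])
    moreover have "\<eta> X \<cdot>\<^bsub>C\<^esub> ?\<theta> = Idn C (Go (Fo X))"
      by (rule inj[OF C.Comp_closed[OF \<theta>(1) \<eta>(1)[OF X]] C.Idn_closed[OF GFX]])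
        (simp add: F_Comp[OF \<theta>(1) \<eta>(1)[OF X]] \<eta>(2)[OF X] \<theta>(2) e'e[OF FX] F_id[OF GFX])
    ultimately show "is_iso C (\<eta> X)" using C.is_iso_Hom[OF \<eta>(1)[OF X]] \<theta>(1) by blast
  next
    fix f assume "f \<in> Arr C"
    then have f: "f \<in> Hom C (Dom C f) (Cod C f)" by (rule C.Hom_I)
    let ?X = "Dom C f" and ?Y = "Cod C f"
    have X: "?X \<in> Obj C" and Y: "?Y \<in> Obj C" using C.Hom_obj[OF f] by auto
    note FX = F_obj[OF X] and FY = F_obj[OF Y] and Ff = F_Hom[OF f]
    have "\<eta> ?Y \<cdot>\<^bsub>C\<^esub> f = Ga (Fa f) \<cdot>\<^bsub>C\<^esub> \<eta> ?X"
    proof (rule inj[OF C.Comp_closed[OF f \<eta>(1)[OF Y]] C.Comp_closed[OF \<eta>(1)[OF X] Ga(1)[OF Ff]]])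
      have "Fa (Ga (Fa f) \<cdot>\<^bsub>C\<^esub> \<eta> ?X) = (e' (Fo ?Y) \<cdot>\<^bsub>D\<^esub> (Fa f \<cdot>\<^bsub>D\<^esub> e (Fo ?X))) \<cdot>\<^bsub>D\<^esub> e' (Fo ?X)"
        using F_Comp[OF \<eta>(1)[OF X] Ga(1)[OF Ff]] Ga(2)[OF Ff] \<eta>(2)[OF X] by simp
      also have "\<dots> = e' (Fo ?Y) \<cdot>\<^bsub>D\<^esub> ((Fa f \<cdot>\<^bsub>D\<^esub> e (Fo ?X)) \<cdot>\<^bsub>D\<^esub> e' (Fo ?X))"
        by (rule D.Comp_assoc[OF e'[OF FX] D.Comp_closed[OF e[OF FX] Ff] e'[OF FY]])
      also have "(Fa f \<cdot>\<^bsub>D\<^esub> e (Fo ?X)) \<cdot>\<^bsub>D\<^esub> e' (Fo ?X) = Fa f"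
        by (rule D.cancel_section_right[OF ee'[OF FX] e'[OF FX] e[OF FX] Ff])
      finally show "Fa (\<eta> ?Y \<cdot>\<^bsub>C\<^esub> f) = Fa (Ga (Fa f) \<cdot>\<^bsub>C\<^esub> \<eta> ?X)"
        using F_Comp[OF f \<eta>(1)[OF Y]] \<eta>(2)[OF Y] by simp
    qed
    then show "\<eta> ?Y \<cdot>\<^bsub>C\<^esub> id f = (Ga \<circ> Fa) f \<cdot>\<^bsub>C\<^esub> \<eta> ?X" by simp
  qed
  ultimately show ?thesis using F unfolding equivalent_categories_def by blast
qed

section \<open>Full subcategories and the category of smooth sets\<close>

lemma Hom_full_subcategory:
  "Hom (full_subcategory C P) X Y = {f \<in> Hom C X Y. P X \<and> P Y}"
  by (auto simp: Hom_def full_subcategory_def)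

lemma full_subcategory_category:
  assumes "category C"
  shows "category (full_subcategory C P)"
proof -
  interpret category C by fact
  have *: "Dom (full_subcategory C P) = Dom C" "Cod (full_subcategory C P) = Cod C"
    "Idn (full_subcategory C P) = Idn C" "Comp (full_subcategory C P) = Comp C"
    "Obj (full_subcategory C P) = {X \<in> Obj C. P X}"
    "Arr (full_subcategory C P) = {f \<in> Arr C. P (Dom C f) \<and> P (Cod C f)}"
    by (simp_all add: full_subcategory_def)
  show ?thesis
    by unfold_locales
      (auto simp: * Hom_full_subcategory Dom_closed Cod_closed Idn_closed Comp_closed Comp_Idn Idn_Comp
        intro: Comp_assoc)
qed

lemma smooth_gsets_simps:
  "X \<in> Obj (smooth_gsets G T) \<longleftrightarrow> is_smooth_gset G T X \<and> finite (orbits G (fst X) (snd X))"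
  "Idn (smooth_gsets G T) X = (X, \<lambda>x \<in> fst X. x, X)"
  "(Y', g, Z) \<cdot>\<^bsub>smooth_gsets G T\<^esub> (X, f, Y) = (X, compose (fst X) g f, Z)"
  "(X, f, Y) \<in> Arr (smooth_gsets G T) \<longleftrightarrow>
    X \<in> Obj (smooth_gsets G T) \<and> Y \<in> Obj (smooth_gsets G T) \<and> f \<in> equivariant_maps G X Y"
  "Dom (smooth_gsets G T) (X, f, Y) = X"
  "Cod (smooth_gsets G T) (X, f, Y) = Y"
  by (simp_all add: smooth_gsets_def Let_def)

lemma Hom_smooth_gsets:
  "u \<in> Hom (smooth_gsets G T) X Y \<longleftrightarrow> (\<exists>f. u = (X, f, Y) \<and> X \<in> Obj (smooth_gsets G T) \<and>
    Y \<in> Obj (smooth_gsets G T) \<and> f \<in> equivariant_maps G X Y)"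
  by (cases u) (auto simp: Hom_def smooth_gsets_simps)

lemma smooth_gset_action:
  assumes "X \<in> Obj (smooth_gsets G T)"
  shows "group_action G (fst X) (snd X)"
  using assms by (auto simp: smooth_gsets_simps is_smooth_gset_def)

lemma equivariant_maps_iff:
  "f \<in> equivariant_maps G X Y \<longleftrightarrow> f \<in> fst X \<rightarrow>\<^sub>E fst Y \<and>
    (\<forall>g \<in> carrier G. \<forall>x \<in> fst X. f (snd X g x) = snd Y g (f x))"
  by (cases X; cases Y) (simp add: equivariant_maps_def)

lemma equivariant_mapsD:
  assumes "f \<in> equivariant_maps G X Y"
  shows "f \<in> fst X \<rightarrow> fst Y" "f \<in> extensional (fst X)"
    "x \<in> fst X \<Longrightarrow> f x \<in> fst Y"
    "g \<in> carrier G \<Longrightarrow> x \<in> fst X \<Longrightarrow> f (snd X g x) = snd Y g (f x)"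
  using assms by (auto simp: equivariant_maps_iff PiE_def)

lemma compose_equivariant:
  assumes X: "X \<in> Obj (smooth_gsets G T)" and f: "f \<in> equivariant_maps G X Y" and g: "g \<in> equivariant_maps G Y Z"
  shows "compose (fst X) g f \<in> equivariant_maps G X Z"
proof -
  interpret group_action G "fst X" "snd X" by (rule smooth_gset_action[OF X])
  have "snd X k x \<in> fst X" if "k \<in> carrier G" "x \<in> fst X" for k x
    using element_image[OF that] by simp
  note closed = this
  show ?thesis
    unfolding equivariant_maps_iff
  proof (intro conjI ballI)
    show "compose (fst X) g f \<in> fst X \<rightarrow>\<^sub>E fst Z"
      using funcset_compose[OF equivariant_mapsD(1)[OF f] equivariant_mapsD(1)[OF g]]
      by (simp add: PiE_def)
    fix k x assume k: "k \<in> carrier G" and x: "x \<in> fst X"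
    show "compose (fst X) g f (snd X k x) = snd Z k (compose (fst X) g f x)"
      using equivariant_mapsD(4)[OF f k x] equivariant_mapsD(4)[OF g k equivariant_mapsD(3)[OF f x]]
        closed[OF k x] x by (simp add: compose_eq)
  qed
qed

lemma identity_equivariant:
  assumes X: "X \<in> Obj (smooth_gsets G T)"
  shows "(\<lambda>x \<in> fst X. x) \<in> equivariant_maps G X X"
proof -
  interpret group_action G "fst X" "snd X" by (rule smooth_gset_action[OF X])
  have "snd X k x \<in> fst X" if "k \<in> carrier G" "x \<in> fst X" for k x
    using element_image[OF that] by simp
  then show ?thesis by (auto simp: equivariant_maps_iff)
qed

text \<open>Arrows carry extensional functions, so the identity laws hold as equations between
  functions and not only on the underlying sets.\<close>

lemma smooth_gsets_category: "category (smooth_gsets G T)"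
proof
  fix f assume f: "f \<in> Arr (smooth_gsets G T)"
  show "Dom (smooth_gsets G T) f \<in> Obj (smooth_gsets G T)" "Cod (smooth_gsets G T) f \<in> Obj (smooth_gsets G T)"
    using f by (cases f; simp add: smooth_gsets_simps(4-6))+
next
  fix X assume X: "X \<in> Obj (smooth_gsets G T)"
  then show "Idn (smooth_gsets G T) X \<in> Hom (smooth_gsets G T) X X"
    using identity_equivariant[OF X] by (simp add: Hom_smooth_gsets smooth_gsets_simps(2))
next
  fix f g X Y Z assume "f \<in> Hom (smooth_gsets G T) X Y" "g \<in> Hom (smooth_gsets G T) Y Z"
  then obtain u v where f: "f = (X, u, Y)" and g: "g = (Y, v, Z)" and X: "X \<in> Obj (smooth_gsets G T)"
    and Z: "Z \<in> Obj (smooth_gsets G T)" and u: "u \<in> equivariant_maps G X Y" and v: "v \<in> equivariant_maps G Y Z"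
    unfolding Hom_smooth_gsets by blast
  then show "g \<cdot>\<^bsub>smooth_gsets G T\<^esub> f \<in> Hom (smooth_gsets G T) X Z"
    using compose_equivariant[OF X u v] by (simp add: Hom_smooth_gsets smooth_gsets_simps(3))
next
  fix f X Y assume "f \<in> Hom (smooth_gsets G T) X Y"
  then obtain u where u: "f = (X, u, Y)" "u \<in> equivariant_maps G X Y"
    unfolding Hom_smooth_gsets by blast
  show "f \<cdot>\<^bsub>smooth_gsets G T\<^esub> Idn (smooth_gsets G T) X = f"
    "Idn (smooth_gsets G T) Y \<cdot>\<^bsub>smooth_gsets G T\<^esub> f = f"
    using compose_Id[OF equivariant_mapsD(1,2)[OF u(2)]] Id_compose[OF equivariant_mapsD(1,2)[OF u(2)]]
    by (simp_all add: u(1) smooth_gsets_simps(2,3))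
next
  fix f g h W X Y Z
  assume "f \<in> Hom (smooth_gsets G T) W X" "g \<in> Hom (smooth_gsets G T) X Y" "h \<in> Hom (smooth_gsets G T) Y Z"
  then obtain u v w where "f = (W, u, X)" "g = (X, v, Y)" "h = (Y, w, Z)" and u: "u \<in> equivariant_maps G W X"
    unfolding Hom_smooth_gsets by blast
  then show "(h \<cdot>\<^bsub>smooth_gsets G T\<^esub> g) \<cdot>\<^bsub>smooth_gsets G T\<^esub> f = h \<cdot>\<^bsub>smooth_gsets G T\<^esub> (g \<cdot>\<^bsub>smooth_gsets G T\<^esub> f)"
    using compose_assoc[OF equivariant_mapsD(1)[OF u], where h = w and g = v] by (simp add: smooth_gsets_simps(3))
qed

lemma equivariant_bijection_isomorphic:
  assumes X: "X \<in> Obj (smooth_gsets G T)" and Y: "Y \<in> Obj (smooth_gsets G T)"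
    and f: "f \<in> equivariant_maps G X Y" and bij: "bij_betw f (fst X) (fst Y)"
  shows "isomorphic (smooth_gsets G T) X Y"
proof -
  interpret category "smooth_gsets G T" by (rule smooth_gsets_category)
  interpret X: group_action G "fst X" "snd X" by (rule smooth_gset_action[OF X])
  define f' where "f' = (\<lambda>y \<in> fst Y. inv_into (fst X) f y)"
  have f': "f' y \<in> fst X" "f (f' y) = y" if "y \<in> fst Y" for y
    using bij_betw_inv_into_right[OF bij that] bij_betwE[OF bij_betw_inv_into[OF bij]] that by (auto simp: f'_def)
  have "f' \<in> equivariant_maps G Y X"
    unfolding equivariant_maps_iff
  proof (intro conjI ballI)
    show "f' \<in> fst Y \<rightarrow>\<^sub>E fst X" using f'(1) by (auto simp: f'_def)
    fix g y assume g: "g \<in> carrier G" and y: "y \<in> fst Y"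
    have gx: "snd X g (f' y) \<in> fst X" using X.element_image[OF g f'(1)[OF y]] by simp
    have "snd Y g y = f (snd X g (f' y))" using equivariant_mapsD(4)[OF f g f'(1)[OF y]] f'(2)[OF y] by simp
    then show "f' (snd Y g y) = snd X g (f' y)"
      using bij_betw_inv_into_left[OF bij gx] equivariant_mapsD(3)[OF f gx] by (simp add: f'_def)
  qed
  then show ?thesis
    using f X Y compose_inv_into_id[OF bij] compose_id_inv_into[OF bij_betw_imp_surj_on[OF bij]]
    by (intro isomorphicI[of "(X, f, Y)" X Y "(Y, f', X)"])
      (auto simp: Hom_smooth_gsets smooth_gsets_simps(2,3) f'_def)
qed

section \<open>The equivalence\<close>

context fiber_functor begin

text \<open>The points of \<open>F X\<close> are already natural numbers, so the set component of
  \<open>point\<close> is filled with the empty set. The two restrictions make the action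
  extensional in the group element, and each of its values an extensional permutation as
  \<open>Bij\<close> demands.\<close>

definition gset :: "'o \<Rightarrow> (nat \<Rightarrow> nat, (nat \<Rightarrow> nat) point) gset" where
  "gset X = (Pair {} ` F X, \<lambda>g \<in> carrier Aut. \<lambda>p \<in> Pair {} ` F X. ({}, act g X (snd p)))"

lemma fst_gset: "fst (gset X) = Pair {} ` F X"
  by (simp add: gset_def)

lemma snd_gset: "g \<in> carrier Aut \<Longrightarrow> x \<in> F X \<Longrightarrow> snd (gset X) g ({}, x) = ({}, act g X x)"
  by (simp add: gset_def)

lemma gset_action:
  assumes X: "X \<in> Obj B"
  shows "group_action Aut (fst (gset X)) (snd (gset X))"
proof -
  let ?E = "fst (gset X)" and ?\<phi> = "snd (gset X)"
  have Bij: "?\<phi> g \<in> Bij ?E" if g: "g \<in> carrier Aut" for g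
  proof -
    note b = act_bij[OF g X]
    have "inj_on (?\<phi> g) ?E"
      using bij_betw_imp_inj_on[OF b] by (auto simp: inj_on_def fst_gset snd_gset g)
    moreover have "?\<phi> g ` ?E = ?E"
    proof -
      have "?\<phi> g ` ?E = Pair {} ` act g X ` F X" by (auto simp: fst_gset snd_gset g image_image)
      then show ?thesis using bij_betw_imp_surj_on[OF b] by (simp add: fst_gset)
    qed
    ultimately show ?thesis using g by (simp add: Bij_def bij_betw_def) (simp add: gset_def)
  qed
  have "?\<phi> (g \<otimes>\<^bsub>Aut\<^esub> k) = ?\<phi> g \<otimes>\<^bsub>BijGroup ?E\<^esub> ?\<phi> k" if g: "g \<in> carrier Aut" and k: "k \<in> carrier Aut" for g k
  proof
    fix p
    show "?\<phi> (g \<otimes>\<^bsub>Aut\<^esub> k) p = (?\<phi> g \<otimes>\<^bsub>BijGroup ?E\<^esub> ?\<phi> k) p"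
    proof (cases "p \<in> ?E")
      case True
      then obtain x where "x \<in> F X" "p = ({}, x)" by (auto simp: fst_gset)
      then show ?thesis
        using g k True X by (simp add: BijGroup_def Bij compose_def snd_gset act_mult act_closed)
    next
      case False
      then show ?thesis
        using Bij[OF g] Bij[OF k] g k by (simp add: BijGroup_def compose_def) (simp add: gset_def)
    qed
  qed
  then have "?\<phi> \<in> hom Aut (BijGroup ?E)"
    by (intro homI) (simp_all add: BijGroup_def Bij)
  then show ?thesis
    by (simp add: group_action_def group_hom_def group_hom_axioms_def group_BijGroup Aut_group)
qed

lemma stabilizer_gset: "x \<in> F X \<Longrightarrow> stabilizer Aut (snd (gset X)) ({}, x) = Stab X x"
  by (auto simp: stabilizer_def Stab_def snd_gset)

text \<open>Each orbit is the image of one of the sets \<open>F (A k)\<close>, because the group is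
  transitive on the points of an atom.\<close>

lemma orbits_gset_finite:
  assumes X: "X \<in> Obj B"
  shows "finite (orbits Aut (fst (gset X)) (snd (gset X)))"
proof -
  obtain n A w where "\<forall>k<n. atom B (A k)" and W: "is_finite_coproduct B n A X w"
    using decomposition[OF X] by blast
  then have A: "\<And>k. k < n \<Longrightarrow> atom B (A k)" by blast
  have "orbits Aut (fst (gset X)) (snd (gset X)) \<subseteq> (\<lambda>k. Pair ({} :: (nat \<Rightarrow> nat) set) ` M (w k) ` F (A k)) ` {..<n}"
  proof
    fix S assume "S \<in> orbits Aut (fst (gset X)) (snd (gset X))"
    then obtain x where x: "x \<in> F X" and S: "S = orbit Aut (snd (gset X)) ({}, x)"
      by (auto simp: orbits_def fst_gset)
    obtain k a where k: "k < n" "a \<in> F (A k)" "M (w k) a = x" using coproduct_point[OF W A x] by blast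
    note wk = finite_coproduct_in[OF W k(1)]
    have S': "S = {({}, act g X x) | g. g \<in> carrier Aut}" 
      unfolding S orbit_def using x by (intro Collect_cong ex_cong1) (auto simp: snd_gset)
    have gx: "act g X x = M (w k) (act g (A k) a)" if "g \<in> carrier Aut" for g
      using act_M[OF that wk k(2)] k(3) by simp
    have "S = Pair ({} :: (nat \<Rightarrow> nat) set) ` M (w k) ` F (A k)"
    proof (intro equalityI subsetI)
      fix p assume "p \<in> S"
      then obtain g where "g \<in> carrier Aut" "p = ({}, act g X x)" by (auto simp: S')
      then show "p \<in> Pair ({} :: (nat \<Rightarrow> nat) set) ` M (w k) ` F (A k)"
        using gx act_closed[OF _ atom_obj[OF A[OF k(1)]] k(2)] by auto
    next
      fix p assume "p \<in> Pair ({} :: (nat \<Rightarrow> nat) set) ` M (w k) ` F (A k)"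
      then obtain b where b: "b \<in> F (A k)" "p = ({}, M (w k) b)" by blast
      obtain g where g: "g \<in> carrier Aut" "act g (A k) a = b" by (rule transitive[OF A[OF k(1)] k(2) b(1)])
      have "p = ({}, act g X x)" using gx[OF g(1)] g(2) b(2) by simp
      then show "p \<in> S" using g(1) unfolding S' by blast
    qed
    then show "S \<in> (\<lambda>k. Pair ({} :: (nat \<Rightarrow> nat) set) ` M (w k) ` F (A k)) ` {..<n}" using k(1) by blast
  qed
  then show ?thesis using finite_subset by blast
qed

lemma openin_Stabs: "U \<in> Stabs \<Longrightarrow> openin Top U"
  using openin_Stab by (auto simp: Stabs_def)

lemma gset_object:
  assumes X: "X \<in> Obj B"
  shows "gset X \<in> Obj (smooth_gsets Aut Top)" "\<forall>x \<in> fst (gset X). stabilizer Aut (snd (gset X)) x \<in> Stabs"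
proof -
  show *: "\<forall>x \<in> fst (gset X). stabilizer Aut (snd (gset X)) x \<in> Stabs"
    using stabilizer_gset Stab_in_Stabs[OF X] by (auto simp: fst_gset)
  have "is_smooth_gset Aut Top (fst (gset X), snd (gset X))"
    unfolding is_smooth_gset_def using gset_action[OF X] * openin_Stabs by (auto simp: gset_def)
  then show "gset X \<in> Obj (smooth_gsets Aut Top)"
    using orbits_gset_finite[OF X] by (simp add: smooth_gsets_simps(1))
qed

definition gmap :: "'a \<Rightarrow> (nat \<Rightarrow> nat) gset_arrow" where
  "gmap f = (gset (Dom B f), \<lambda>p \<in> fst (gset (Dom B f)). ({}, M f (snd p)), gset (Cod B f))"

lemma gmap_Hom_eq:
  "f \<in> Hom B X Y \<Longrightarrow> gmap f = (gset X, \<lambda>p \<in> fst (gset X). ({}, M f (snd p)), gset Y)"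
  by (auto simp: gmap_def Hom_def)

abbreviation GSets :: "((nat \<Rightarrow> nat, (nat \<Rightarrow> nat) point) gset, (nat \<Rightarrow> nat) gset_arrow) cat" where
  "GSets \<equiv> smooth_gsets_class Aut Top Stabs"

lemma GSets_Obj:
  "X \<in> Obj GSets \<longleftrightarrow> X \<in> Obj (smooth_gsets Aut Top) \<and> (\<forall>x \<in> fst X. stabilizer Aut (snd X) x \<in> Stabs)"
  by (cases X) (simp add: smooth_gsets_class_def full_subcategory_def)

lemma GSets_Hom:
  "u \<in> Hom GSets X Y \<longleftrightarrow> (\<exists>f. u = (X, f, Y) \<and> X \<in> Obj GSets \<and> Y \<in> Obj GSets \<and> f \<in> equivariant_maps Aut X Y)"
  unfolding smooth_gsets_class_def Hom_full_subcategory
  by (cases X; cases Y) (auto simp: Hom_smooth_gsets full_subcategory_def)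

lemma GSets_simps:
  "Idn GSets = Idn (smooth_gsets Aut Top)" "Comp GSets = Comp (smooth_gsets Aut Top)"
  by (simp_all add: smooth_gsets_class_def full_subcategory_def)

lemma GSets_category: "category GSets"
  unfolding smooth_gsets_class_def by (rule full_subcategory_category[OF smooth_gsets_category])

lemma gset_GSets: "X \<in> Obj B \<Longrightarrow> gset X \<in> Obj GSets"
  using gset_object by (simp add: GSets_Obj)

lemma gmap_equivariant:
  assumes f: "f \<in> Hom B X Y"
  shows "(\<lambda>p \<in> fst (gset X). ({}, M f (snd p))) \<in> equivariant_maps Aut (gset X) (gset Y)"
  unfolding equivariant_maps_iff
proof (intro conjI ballI)
  have X: "X \<in> Obj B" using Hom_obj[OF f] by simp
  show "(\<lambda>p \<in> fst (gset X). ({}, M f (snd p))) \<in> fst (gset X) \<rightarrow>\<^sub>E fst (gset Y)"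
    using M_closed[OF f] by (auto simp: fst_gset)
  fix g p assume g: "g \<in> carrier Aut" and "p \<in> fst (gset X)"
  then obtain x where x: "x \<in> F X" "p = ({}, x)" by (auto simp: fst_gset)
  then show "(\<lambda>p \<in> fst (gset X). ({}, M f (snd p))) (snd (gset X) g p) =
      snd (gset Y) g ((\<lambda>p \<in> fst (gset X). ({}, M f (snd p))) p)"
    using g act_closed[OF g X x(1)] M_closed[OF f x(1)] act_M[OF g f x(1)]
    by (simp add: snd_gset fst_gset)
qed

lemma gmap_functor: "is_functor B GSets gset gmap"
  unfolding is_functor_def
proof (intro conjI ballI impI)
  show "gset X \<in> Obj GSets" if "X \<in> Obj B" for X by (rule gset_GSets[OF that])
  show "gmap (Idn B X) = Idn GSets (gset X)" if X: "X \<in> Obj B" for X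
    using gmap_Hom_eq[OF Idn_closed[OF X]] M_Idn[OF X]
    by (auto simp: GSets_simps smooth_gsets_simps(2) fst_gset intro!: restrict_ext)
next
  fix f assume "f \<in> Arr B"
  then have f: "f \<in> Hom B (Dom B f) (Cod B f)" by (rule Hom_I)
  show "gmap f \<in> Hom GSets (gset (Dom B f)) (gset (Cod B f))"
    using gmap_Hom_eq[OF f] gmap_equivariant[OF f] gset_GSets Hom_obj[OF f] by (simp add: GSets_Hom)
  fix g assume "g \<in> Arr B" "Dom B g = Cod B f"
  then have g: "g \<in> Hom B (Cod B f) (Cod B g)" by (simp add: Hom_def)
  show "gmap (g \<cdot> f) = gmap g \<cdot>\<^bsub>GSets\<^esub> gmap f"
    using gmap_Hom_eq[OF f] gmap_Hom_eq[OF g] gmap_Hom_eq[OF Comp_closed[OF f g]] M_Comp[OF f g] M_closed[OF f]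
    by (auto simp: GSets_simps smooth_gsets_simps(3) compose_def fst_gset intro!: restrict_ext)
qed

text \<open>A map between these sets has the form \<open>({}, x) \<mapsto> ({}, \<phi> x)\<close>,
  so equivariance of the map is equivariance of \<open>\<phi>\<close>, and \<open>faithful\<close>
  and \<open>full\<close> apply.\<close>

lemma gmap_fully_faithful:
  assumes X: "X \<in> Obj B" and Y: "Y \<in> Obj B"
  shows "bij_betw gmap (Hom B X Y) (Hom GSets (gset X) (gset Y))"
  unfolding bij_betw_def
proof (intro conjI equalityI subsetI inj_onI)
  fix f g assume f: "f \<in> Hom B X Y" and g: "g \<in> Hom B X Y" and eq: "gmap f = gmap g"
  show "f = g"
  proof (rule faithful[OF f g])
    fix x assume x: "x \<in> F X"
    have "(\<lambda>p \<in> fst (gset X). ({} :: (nat \<Rightarrow> nat) set, M f (snd p))) = (\<lambda>p \<in> fst (gset X). ({}, M g (snd p)))"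
      using eq gmap_Hom_eq[OF f] gmap_Hom_eq[OF g] by simp
    from fun_cong[OF this, of "({}, x)"] show "M f x = M g x" using x by (simp add: fst_gset)
  qed
next
  fix u assume "u \<in> gmap ` Hom B X Y"
  then obtain f where f: "f \<in> Hom B X Y" "u = gmap f" by blast
  then show "u \<in> Hom GSets (gset X) (gset Y)"
    using gmap_Hom_eq[OF f(1)] gmap_equivariant[OF f(1)] gset_GSets[OF X] gset_GSets[OF Y]
    by (simp add: GSets_Hom)
next
  fix u assume "u \<in> Hom GSets (gset X) (gset Y)"
  then obtain h where u: "u = (gset X, h, gset Y)" and h: "h \<in> equivariant_maps Aut (gset X) (gset Y)"
    unfolding GSets_Hom by blast
  define \<phi> where "\<phi> x = snd (h ({}, x))" for x
  have h\<phi>: "h ({}, x) = ({}, \<phi> x)" "\<phi> x \<in> F Y" if "x \<in> F X" for x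
    using equivariant_mapsD(3)[OF h, of "({}, x)"] that by (auto simp: fst_gset \<phi>_def)
  have "equivariant X Y \<phi>"
    unfolding equivariant_def
  proof (intro conjI ballI)
    show "\<phi> x \<in> F Y" if "x \<in> F X" for x using h\<phi>(2)[OF that] .
    fix g x assume g: "g \<in> carrier Aut" and x: "x \<in> F X"
    have "h (snd (gset X) g ({}, x)) = snd (gset Y) g (h ({}, x))"
      by (rule equivariant_mapsD(4)[OF h g]) (use x in \<open>simp add: fst_gset\<close>)
    then show "\<phi> (act g X x) = act g Y (\<phi> x)"
      using h\<phi> g x act_closed[OF g X x] by (simp add: snd_gset)
  qed
  then obtain f where f: "f \<in> Hom B X Y" "\<forall>x \<in> F X. M f x = \<phi> x" using full[OF X Y] by blast
  have "h = (\<lambda>p \<in> fst (gset X). ({}, M f (snd p)))"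
  proof (rule extensionalityI[OF equivariant_mapsD(2)[OF h]])
    fix p assume "p \<in> fst (gset X)"
    then obtain x where "x \<in> F X" "p = ({}, x)" by (auto simp: fst_gset)
    then show "h p = (\<lambda>p \<in> fst (gset X). ({}, M f (snd p))) p" using h\<phi> f(2) by (simp add: fst_gset)
  qed simp
  then have "u = gmap f" using gmap_Hom_eq[OF f(1)] u by simp
  then show "u \<in> gmap ` Hom B X Y" using f(1) by blast
qed

text \<open>An orbit is determined by the stabilizer of one of its points, and that stabilizer is
  \<open>Stab A a\<close> for a point of some atom. The co-product of these atoms, one for each
  orbit, has \<open>Z\<close> as its set of points up to an equivariant bijection.\<close>

lemma gset_essentially_surjective:
  assumes Z: "Z \<in> Obj GSets"
  shows "\<exists>X \<in> Obj B. isomorphic GSets (gset X) Z"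
proof -
  obtain E \<psi> where [simp]: "Z = (E, \<psi>)" by (cases Z)
  have Z': "(E, \<psi>) \<in> Obj (smooth_gsets Aut Top)" and stabs: "\<And>y. y \<in> E \<Longrightarrow> stabilizer Aut \<psi> y \<in> Stabs"
    using Z by (auto simp: GSets_Obj)
  interpret Z: group_action Aut E \<psi> using smooth_gset_action[OF Z'] by simp
  have fin: "finite (orbits Aut E \<psi>)" using Z' by (simp add: smooth_gsets_simps(1))
  define n where "n = card (orbits Aut E \<psi>)"
  obtain orb where orb: "bij_betw orb {..<n} (orbits Aut E \<psi>)"
    using ex_bij_betw_nat_finite[OF fin] by (auto simp: n_def atLeast0LessThan)
  have "\<exists>y. i < n \<longrightarrow> y \<in> E \<and> orb i = orbit Aut \<psi> y" for i
    using bij_betwE[OF orb] unfolding orbits_def by blast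
  then have "\<forall>i. \<exists>y. i < n \<longrightarrow> y \<in> E \<and> orb i = orbit Aut \<psi> y" ..
  from choice[OF this] obtain r where r: "\<And>i. i < n \<Longrightarrow> r i \<in> E" "\<And>i. i < n \<Longrightarrow> orb i = orbit Aut \<psi> (r i)"
    by blast
  have "\<exists>p. i < n \<longrightarrow> atom B (fst p) \<and> snd p \<in> F (fst p) \<and> stabilizer Aut \<psi> (r i) = Stab (fst p) (snd p)" for i
  proof (cases "i < n")
    case True
    then obtain A a where "atom B A" "a \<in> F A" "stabilizer Aut \<psi> (r i) = Stab A a"
      using stabs[OF r(1)[OF True]] by (auto simp: Stabs_def)
    then show ?thesis by (intro exI[of _ "(A, a)"]) simp
  qed simp
  then have "\<forall>i. \<exists>p. i < n \<longrightarrow> atom B (fst p) \<and> snd p \<in> F (fst p) \<and>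
      stabilizer Aut \<psi> (r i) = Stab (fst p) (snd p)" ..
  from choice[OF this] obtain p where p: "\<And>i. i < n \<Longrightarrow> atom B (fst (p i)) \<and> snd (p i) \<in> F (fst (p i)) \<and>
      stabilizer Aut \<psi> (r i) = Stab (fst (p i)) (snd (p i))" by blast
  define A a where "A i = fst (p i)" and "a i = snd (p i)" for i
  have A: "atom B (A i)" and a: "a i \<in> F (A i)" and st: "stabilizer Aut \<psi> (r i) = Stab (A i) (a i)"
    if "i < n" for i
    using p[OF that] by (auto simp: A_def a_def)
  obtain X w where W: "is_finite_coproduct B n A X w"
    using finite_coproducts[of n A] atom_obj[OF A] by blast
  have X: "X \<in> Obj B" using W by (simp add: is_finite_coproduct_def)
  note w = finite_coproduct_in[OF W]
  \<comment> \<open>Every point of \<open>F X\<close> is some \<open>pt i g\<close>, just as every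
    point of \<open>E\<close> is some \<open>\<psi> g (r i)\<close>. The bijection sends the former
    to the latter, and \<open>key\<close> makes it well defined and injective.\<close>
  define pt where "pt i g = M (w i) (act g (A i) (a i))" for i g
  have pt_in: "pt i g \<in> F X" if "i < n" "g \<in> carrier Aut" for i g
    using M_closed[OF w[OF that(1)]] act_closed[OF that(2) atom_obj[OF A] a] that by (simp add: pt_def)
  have pt_act: "act k X (pt i g) = pt i (k \<otimes>\<^bsub>Aut\<^esub> g)" if "i < n" "g \<in> carrier Aut" "k \<in> carrier Aut" for i g k
    using act_M[OF that(3) w[OF that(1)] act_closed[OF that(2) atom_obj[OF A] a]] that
      act_mult[OF that(3,2) atom_obj[OF A] a] by (simp add: pt_def)
  have pt_ex: "\<exists>i g. i < n \<and> g \<in> carrier Aut \<and> x = pt i g" if x: "x \<in> F X" for x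
  proof -
    obtain i b where i: "i < n" "b \<in> F (A i)" "M (w i) b = x" using coproduct_point[OF W A x] by blast
    obtain g where "g \<in> carrier Aut" "act g (A i) (a i) = b" by (rule transitive[OF A[OF i(1)] a[OF i(1)] i(2)])
    then show ?thesis using i by (auto simp: pt_def)
  qed
  have \<psi>_ex: "\<exists>i g. i < n \<and> g \<in> carrier Aut \<and> y = \<psi> g (r i)" if y: "y \<in> E" for y
  proof -
    have "orbit Aut \<psi> y \<in> orb ` {..<n}" 
      using y unfolding bij_betw_imp_surj_on[OF orb] orbits_def by blast
    then obtain i where i: "i < n" "orbit Aut \<psi> y = orbit Aut \<psi> (r i)" using r(2) by auto
    then have "y \<in> orbit Aut \<psi> (r i)" using Z.orbit_refl[OF y] by simp
    then show ?thesis using i(1) by (auto simp: orbit_def)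
  qed
  have stab_iff: "act g (A i) (a i) = act h (A i) (a i) \<longleftrightarrow> \<psi> g (r i) = \<psi> h (r i)"
    if i: "i < n" and g: "g \<in> carrier Aut" and h: "h \<in> carrier Aut" for i g h
  proof -
    let ?k = "inv\<^bsub>Aut\<^esub> h \<otimes>\<^bsub>Aut\<^esub> g"
    have ih: "inv\<^bsub>Aut\<^esub> h \<in> carrier Aut" using h by simp
    have k: "?k \<in> carrier Aut" using g h by simp
    note Ai = atom_obj[OF A[OF i]]
    have "act g (A i) (a i) = act h (A i) (a i) \<longleftrightarrow> act ?k (A i) (a i) = a i"
      using act_inv_eq_iff[OF h Ai act_closed[OF g Ai a[OF i]] a[OF i]] act_mult[OF ih g Ai a[OF i]] by simp
    also have "\<dots> \<longleftrightarrow> ?k \<in> stabilizer Aut \<psi> (r i)" using k by (simp add: st[OF i] Stab_def)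
    also have "\<dots> \<longleftrightarrow> \<psi> (inv\<^bsub>Aut\<^esub> h) (\<psi> g (r i)) = r i"
      using k Z.composition_rule[OF r(1)[OF i] ih g] by (simp add: stabilizer_def)
    also have "\<dots> \<longleftrightarrow> \<psi> g (r i) = \<psi> h (r i)"
    proof
      assume "\<psi> (inv\<^bsub>Aut\<^esub> h) (\<psi> g (r i)) = r i"
      then have "\<psi> (inv\<^bsub>Aut\<^esub> (inv\<^bsub>Aut\<^esub> h)) (r i) = \<psi> g (r i)"
        by (rule Z.orbit_sym_aux[OF ih Z.element_image[OF g r(1)[OF i] refl]])
      then show "\<psi> g (r i) = \<psi> h (r i)" using h by simp
    next
      assume "\<psi> g (r i) = \<psi> h (r i)"
      then show "\<psi> (inv\<^bsub>Aut\<^esub> h) (\<psi> g (r i)) = r i" using Z.orbit_sym_aux[OF h r(1)[OF i]] by simp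
    qed
    finally show ?thesis .
  qed
  have key: "pt i g = pt j h \<longleftrightarrow> \<psi> g (r i) = \<psi> h (r j)"
    if i: "i < n" and j: "j < n" and g: "g \<in> carrier Aut" and h: "h \<in> carrier Aut" for i j g h
  proof
    note ga = act_closed[OF g atom_obj[OF A[OF i]] a[OF i]] and ha = act_closed[OF h atom_obj[OF A[OF j]] a[OF j]]
    assume "pt i g = pt j h"
    then have "M (w i) (act g (A i) (a i)) = M (w j) (act h (A j) (a j))" by (simp add: pt_def)
    note ij = coproduct_point_unique[OF W A i j ga ha this]
    then show "\<psi> g (r i) = \<psi> h (r j)" using stab_iff[OF i g h] by simp
  next
    assume eq: "\<psi> g (r i) = \<psi> h (r j)"
    note gE = Z.element_image[OF g r(1)[OF i] refl]
    have "\<psi> g (r i) \<in> orbit Aut \<psi> (r i)" "\<psi> g (r i) \<in> orbit Aut \<psi> (r j)"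
      unfolding orbit_def using g h eq by blast+
    then have "orb i \<inter> orb j \<noteq> {}" using r(2) i j by auto
    moreover have "orb i \<in> orbits Aut E \<psi>" "orb j \<in> orbits Aut E \<psi>" using bij_betwE[OF orb] i j by auto
    ultimately have "orb i = orb j" using Z.disjoint_union by blast
    then have "i = j" using inj_onD[OF bij_betw_imp_inj_on[OF orb]] i j by simp
    then show "pt i g = pt j h" using stab_iff[OF i g h] eq by (simp add: pt_def)
  qed
  \<comment> \<open>A choice of coordinates for each point of \<open>F X\<close>; by
    \<open>key\<close> the value of \<open>h\<close> does not depend on it.\<close>
  have "\<forall>x. \<exists>q. x \<in> F X \<longrightarrow> fst q < n \<and> snd q \<in> carrier Aut \<and> x = pt (fst q) (snd q)"
    using pt_ex by fastforce
  from choice[OF this] obtain q where q: "\<And>x. x \<in> F X \<Longrightarrow> fst (q x) < n \<and> snd (q x) \<in> carrier Aut \<and>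
      x = pt (fst (q x)) (snd (q x))" by blast
  define h where "h = (\<lambda>z \<in> fst (gset X). \<psi> (snd (q (snd z))) (r (fst (q (snd z)))))"
  have h_pt: "h ({}, pt i g) = \<psi> g (r i)" if i: "i < n" and g: "g \<in> carrier Aut" for i g
  proof -
    let ?x = "pt i g"
    have "pt (fst (q ?x)) (snd (q ?x)) = pt i g" using q[OF pt_in[OF i g]] by simp
    then have "\<psi> (snd (q ?x)) (r (fst (q ?x))) = \<psi> g (r i)"
      using key[of "fst (q ?x)" i "snd (q ?x)" g] q[OF pt_in[OF i g]] i g by blast
    then show ?thesis using pt_in[OF i g] by (simp add: h_def fst_gset)
  qed
  have point: "\<exists>i g. i < n \<and> g \<in> carrier Aut \<and> z = ({}, pt i g)" if "z \<in> fst (gset X)" for z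
    using that pt_ex by (auto simp: fst_gset)
  have "h \<in> equivariant_maps Aut (gset X) (E, \<psi>)"
    unfolding equivariant_maps_iff fst_conv snd_conv
  proof (intro conjI ballI)
    show "h \<in> fst (gset X) \<rightarrow>\<^sub>E E"
    proof (rule PiE_I)
      fix z assume "z \<in> fst (gset X)"
      then obtain i g where "i < n" "g \<in> carrier Aut" "z = ({}, pt i g)" using point by blast
      then show "h z \<in> E" using h_pt Z.element_image[OF _ r(1) refl] by simp
    qed (simp add: h_def)
    fix k z assume k: "k \<in> carrier Aut" and "z \<in> fst (gset X)"
    then obtain i g where i: "i < n" and g: "g \<in> carrier Aut" and z: "z = ({}, pt i g)" using point by blast
    show "h (snd (gset X) k z) = \<psi> k (h z)"
      using h_pt[OF i g] h_pt[OF i, of "k \<otimes>\<^bsub>Aut\<^esub> g"] pt_act[OF i g k] pt_in[OF i g] k g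
        Z.composition_rule[OF r(1)[OF i] k g] by (simp add: z snd_gset)
  qed
  moreover have "bij_betw h (fst (gset X)) E"
    unfolding bij_betw_def
  proof (intro conjI inj_onI equalityI subsetI)
    fix y z assume y: "y \<in> fst (gset X)" and z: "z \<in> fst (gset X)" and eq: "h y = h z"
    obtain i g where i: "i < n" "g \<in> carrier Aut" "y = ({}, pt i g)" using point[OF y] by blast
    obtain j k where j: "j < n" "k \<in> carrier Aut" "z = ({}, pt j k)" using point[OF z] by blast
    show "y = z" using key[OF i(1) j(1) i(2) j(2)] h_pt[OF i(1,2)] h_pt[OF j(1,2)] eq i(3) j(3) by simp
  next
    fix y assume "y \<in> h ` fst (gset X)"
    then obtain z where z: "z \<in> fst (gset X)" "y = h z" by blast
    obtain i g where "i < n" "g \<in> carrier Aut" "z = ({}, pt i g)" using point[OF z(1)] by blast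
    then show "y \<in> E" using h_pt Z.element_image[OF _ r(1) refl] z(2) by simp
  next
    fix y assume y: "y \<in> E"
    obtain i g where i: "i < n" "g \<in> carrier Aut" "y = \<psi> g (r i)" using \<psi>_ex[OF y] by blast
    have "({}, pt i g) \<in> fst (gset X)" using pt_in[OF i(1,2)] by (simp add: fst_gset)
    then show "y \<in> h ` fst (gset X)" using h_pt[OF i(1,2)] i(3) by (intro image_eqI) auto
  qed
  ultimately have "isomorphic (smooth_gsets Aut Top) (gset X) (E, \<psi>)"
    by (intro equivariant_bijection_isomorphic[OF gset_object(1)[OF X] Z']) simp_all
  then have "isomorphic GSets (gset X) Z"
    using gset_GSets[OF X] Z
    by (elim category.isomorphicE[OF smooth_gsets_category], intro category.isomorphicI[OF GSets_category])
      (auto simp: GSets_Hom Hom_smooth_gsets GSets_simps)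
  then show ?thesis using X by blast
qed

lemma equivalent_GSets: "equivalent_categories B GSets"
  by (rule fully_faithful_essentially_surjective_imp_equivalent[OF category_axioms GSets_category
        gmap_functor gmap_fully_faithful gset_essentially_surjective])

text \<open>The categories coincide on the nose: stabilizers in a smooth set are open subgroups, and
  by \<open>open_subgroup_in_Stabs\<close> these all belong to \<open>Stabs\<close>.\<close>

lemma GSets_eq_smooth_gsets:
  assumes "effective_equivalence_relations B"
  shows "GSets = smooth_gsets Aut Top"
proof -
  have stab: "stabilizer Aut (snd X) x \<in> Stabs" if X: "X \<in> Obj (smooth_gsets Aut Top)" and x: "x \<in> fst X" for X x
  proof -
    interpret group_action Aut "fst X" "snd X" by (rule smooth_gset_action[OF X])
    have "openin Top (stabilizer Aut (snd X) x)"
      using X x by (auto simp: smooth_gsets_simps(1) is_smooth_gset_def)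
    then show ?thesis
      using open_subgroup_in_Stabs[OF assms] stabilizer_subgroup[OF x] by (simp add: open_subgroup_def)
  qed
  have "{X \<in> Obj (smooth_gsets Aut Top). case X of (E, \<phi>) \<Rightarrow> \<forall>x \<in> E. stabilizer Aut \<phi> x \<in> Stabs} =
      Obj (smooth_gsets Aut Top)" using stab by fastforce
  moreover have "{f \<in> Arr (smooth_gsets Aut Top).
      (case Dom (smooth_gsets Aut Top) f of (E, \<phi>) \<Rightarrow> \<forall>x \<in> E. stabilizer Aut \<phi> x \<in> Stabs) \<and>
      (case Cod (smooth_gsets Aut Top) f of (E, \<phi>) \<Rightarrow> \<forall>x \<in> E. stabilizer Aut \<phi> x \<in> Stabs)} =
      Arr (smooth_gsets Aut Top)"
    using stab category.Dom_closed[OF smooth_gsets_category] category.Cod_closed[OF smooth_gsets_category] by fastforce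
  ultimately show ?thesis by (simp add: smooth_gsets_class_def full_subcategory_def)
qed

lemma fiber_functor_reconstruction:
  "\<exists>(G :: (nat \<Rightarrow> nat) monoid) T \<E>.
    admissible_group G T \<and> first_countable T \<and> stabilizer_class G T \<E> \<and>
    equivalent_categories B (smooth_gsets_class G T \<E>) \<and>
    (effective_equivalence_relations B \<longrightarrow> equivalent_categories B (smooth_gsets G T))"
  using admissible_group_Aut first_countable_Top stabilizer_class_Stabs equivalent_GSets GSets_eq_smooth_gsets
  by (intro exI[of _ Aut] exI[of _ Top] exI[of _ Stabs]) auto

end

section \<open>Existence of a fiber functor\<close>

text \<open>The chain is generic in the sense of Fraisse limits: for each arrow \<open>f\<close>
  between listed atoms there are arbitrarily late stages \<open>m\<close> at which every map from
  \<open>X m\<close> to the target of \<open>f\<close> lifts along \<open>f\<close> one step further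
  down. Late stages are demanded because a lifting problem may first arise at any stage.\<close>

locale generic_chain = nondegenerate_B_category B for B :: "('o, 'a) cat" (structure) +
  fixes X :: "nat \<Rightarrow> 'o" and \<pi> :: "nat \<Rightarrow> 'a" and s :: "nat \<Rightarrow> 'o"
  assumes X_atom: "atom B (X n)"
    and \<pi>_Hom: "\<pi> n \<in> Hom B (X (Suc n)) (X n)"
    and s_atom: "atom B (s k)"
    and s_exhaustive: "atom B A \<Longrightarrow> \<exists>k. isomorphic B A (s k)"
    and generic: "f \<in> Hom B (s k) (s l) \<Longrightarrow>
      \<exists>m\<ge>n. \<forall>g \<in> Hom B (X m) (s l). \<exists>h \<in> Hom B (X (Suc m)) (s k). f \<cdot> h = g \<cdot> \<pi> m"
begin

text \<open>The transition map from \<open>X m\<close> to \<open>X n\<close> when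
  \<open>n \<le> m\<close>. For \<open>m < n\<close> the value is the identity of
  \<open>X m\<close>, a mere default.\<close>

primrec tr :: "nat \<Rightarrow> nat \<Rightarrow> 'a" where
  "tr n 0 = Idn B (X 0)"
| "tr n (Suc m) = (if n \<le> m then tr n m \<cdot> \<pi> m else Idn B (X (Suc m)))"

lemma tr_self: "tr n n = Idn B (X n)"
  by (cases n) simp_all

lemma tr_Hom: "n \<le> m \<Longrightarrow> tr n m \<in> Hom B (X m) (X n)"
proof (induction m rule: dec_induct)
  case base
  then show ?case using Idn_closed[OF atom_obj[OF X_atom]] by (simp add: tr_self)
next
  case (step m)
  then show ?case using Comp_closed[OF \<pi>_Hom step.IH] by simp
qed

lemma tr_comp:
  assumes "n \<le> m" "m \<le> k"
  shows "tr n m \<cdot> tr m k = tr n k"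
  using assms(2)
proof (induction k rule: dec_induct)
  case base
  then show ?case using Comp_Idn[OF tr_Hom[OF assms(1)]] by (simp add: tr_self)
next
  case (step k)
  then show ?case using Comp_assoc[OF \<pi>_Hom tr_Hom[of m k] tr_Hom[OF assms(1)]] assms(1) by simp
qed

lemma comp_tr_Hom: "f \<in> Hom B (X n) Y \<Longrightarrow> n \<le> k \<Longrightarrow> f \<cdot> tr n k \<in> Hom B (X k) Y"
  using Comp_closed[OF tr_Hom] .

lemma comp_tr_tr: "f \<in> Hom B (X n) Y \<Longrightarrow> n \<le> m \<Longrightarrow> m \<le> k \<Longrightarrow> (f \<cdot> tr n m) \<cdot> tr m k = f \<cdot> tr n k"
  using Comp_assoc[OF tr_Hom[of m k] tr_Hom[of n m]] tr_comp by simp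

lemma comp_comp_tr: "f \<in> Hom B (X n) Y \<Longrightarrow> u \<in> Hom B Y Z \<Longrightarrow> n \<le> k \<Longrightarrow> (u \<cdot> f) \<cdot> tr n k = u \<cdot> (f \<cdot> tr n k)"
  using Comp_assoc[OF tr_Hom] .

text \<open>The problem is moved to listed atoms by isomorphisms, solved there by
  \<open>generic\<close>, and moved back. Beforehand \<open>g\<close> is pulled back to the stage
  \<open>m\<close> that \<open>generic\<close> supplies; the lift then lives at the stage
  \<open>Suc m\<close>.\<close>

lemma chain_lift:
  assumes Y: "atom B Y" and Z: "atom B Z" and f: "f \<in> Hom B Y Z" and g: "g \<in> Hom B (X n) Z"
  shows "\<exists>m\<ge>n. \<exists>h \<in> Hom B (X m) Y. f \<cdot> h = g \<cdot> tr n m"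
proof -
  obtain k where "isomorphic B Y (s k)" using s_exhaustive[OF Y] by blast
  then obtain a a' where a: "a \<in> Hom B Y (s k)" "a' \<in> Hom B (s k) Y" by (rule isomorphicE)
  obtain l where "isomorphic B Z (s l)" using s_exhaustive[OF Z] by blast
  then obtain b b' where b: "b \<in> Hom B Z (s l)" "b' \<in> Hom B (s l) Z" and b'b: "b' \<cdot> b = Idn B Z"
    by (rule isomorphicE)
  note fa' = Comp_closed[OF a(2) f]
  have "b \<cdot> (f \<cdot> a') \<in> Hom B (s k) (s l)" by (rule Comp_closed[OF fa' b(1)])
  from generic[OF this, of n] obtain m where m: "n \<le> m"
    and lift: "\<forall>g \<in> Hom B (X m) (s l). \<exists>h \<in> Hom B (X (Suc m)) (s k). (b \<cdot> (f \<cdot> a')) \<cdot> h = g \<cdot> \<pi> m" by blast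
  note gm = comp_tr_Hom[OF g m]
  obtain h where h: "h \<in> Hom B (X (Suc m)) (s k)" and eq: "(b \<cdot> (f \<cdot> a')) \<cdot> h = (b \<cdot> (g \<cdot> tr n m)) \<cdot> \<pi> m"
    using lift Comp_closed[OF gm b(1)] by blast
  note a'h = Comp_closed[OF h a(2)]
  have g\<pi>: "(g \<cdot> tr n m) \<cdot> \<pi> m = g \<cdot> tr n (Suc m)"
    using Comp_assoc[OF \<pi>_Hom tr_Hom[OF m] g] m by simp
  have "b \<cdot> (f \<cdot> (a' \<cdot> h)) = (b \<cdot> (f \<cdot> a')) \<cdot> h"
    using Comp_assoc[OF h a(2) f] Comp_assoc[OF h fa' b(1)] by simp
  also have "\<dots> = b \<cdot> (g \<cdot> tr n (Suc m))" using eq Comp_assoc[OF \<pi>_Hom gm b(1)] g\<pi> by simp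
  finally have "b' \<cdot> (b \<cdot> (f \<cdot> (a' \<cdot> h))) = b' \<cdot> (b \<cdot> (g \<cdot> tr n (Suc m)))" by simp
  then have "f \<cdot> (a' \<cdot> h) = g \<cdot> tr n (Suc m)"
    using cancel_section[OF b'b b Comp_closed[OF a'h f]] cancel_section[OF b'b b comp_tr_Hom[OF g, of "Suc m"]] m
    by simp
  then show ?thesis using a'h m by (intro exI[of _ "Suc m"]) auto
qed

section \<open>The colimit along the chain\<close>

definition germ_eq :: "nat \<Rightarrow> 'a \<Rightarrow> nat \<Rightarrow> 'a \<Rightarrow> bool" where
  "germ_eq n f m g \<longleftrightarrow> (\<exists>k. n \<le> k \<and> m \<le> k \<and> f \<cdot> tr n k = g \<cdot> tr m k)"

lemma germ_eq_trans:
  assumes f: "f \<in> Hom B (X n) Y" and g: "g \<in> Hom B (X m) Y" and h: "h \<in> Hom B (X l) Y"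
    and fg: "germ_eq n f m g" and gh: "germ_eq m g l h"
  shows "germ_eq n f l h"
proof -
  obtain i where i: "n \<le> i" "m \<le> i" "f \<cdot> tr n i = g \<cdot> tr m i" using fg by (auto simp: germ_eq_def)
  obtain j where j: "m \<le> j" "l \<le> j" "g \<cdot> tr m j = h \<cdot> tr l j" using gh by (auto simp: germ_eq_def)
  let ?k = "max i j"
  have "f \<cdot> tr n ?k = g \<cdot> tr m ?k"
    using comp_tr_tr[OF f i(1), of ?k] comp_tr_tr[OF g i(2), of ?k] i(3) by simp
  also have "\<dots> = h \<cdot> tr l ?k"
    using comp_tr_tr[OF g j(1), of ?k] comp_tr_tr[OF h j(2), of ?k] j(3) by simp
  finally show ?thesis using i(1) j(2) unfolding germ_eq_def by (intro exI[of _ ?k]) (simp add: le_max_iff_disj)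
qed

lemma germ_eq_refl: "germ_eq n f n f"
  by (auto simp: germ_eq_def)

lemma germ_eq_sym: "germ_eq n f m g \<Longrightarrow> germ_eq m g n f"
  by (auto simp: germ_eq_def)

definition germ :: "'o \<Rightarrow> nat \<Rightarrow> 'a \<Rightarrow> (nat \<times> 'a) set" where
  "germ Y n f = {(m, g). g \<in> Hom B (X m) Y \<and> germ_eq n f m g}"

definition germs :: "'o \<Rightarrow> (nat \<times> 'a) set set" where
  "germs Y = (\<lambda>(n, f). germ Y n f) ` (SIGMA n:UNIV. Hom B (X n) Y)"

text \<open>The points of the colimit of the sets \<open>Hom (X n) Y\<close>, numbered.\<close>

definition pt :: "'o \<Rightarrow> nat \<Rightarrow> 'a \<Rightarrow> nat" where
  "pt Y n f = to_nat_on (germs Y) (germ Y n f)"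

text \<open>There are countably many stages with finitely many maps each, by
  \<open>finite_Hom\<close>; hence points can be natural numbers.\<close>

lemma countable_germs: "Y \<in> Obj B \<Longrightarrow> countable (germs Y)"
  unfolding germs_def using finite_Hom[OF X_atom] by (intro countable_image countable_SIGMA) (auto intro: countable_finite)

lemma pt_eq_iff:
  assumes f: "f \<in> Hom B (X n) Y" and g: "g \<in> Hom B (X m) Y"
  shows "pt Y n f = pt Y m g \<longleftrightarrow> germ_eq n f m g"
proof -
  have Y: "Y \<in> Obj B" using Hom_obj[OF f] by simp
  have "germ Y n f \<in> germs Y" "germ Y m g \<in> germs Y" using f g by (auto simp: germs_def)
  then have "pt Y n f = pt Y m g \<longleftrightarrow> germ Y n f = germ Y m g"
    using inj_on_to_nat_on[OF countable_germs[OF Y]] by (auto simp: pt_def inj_on_def)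
  also have "\<dots> \<longleftrightarrow> germ_eq n f m g"
  proof
    assume "germ Y n f = germ Y m g"
    moreover have "(m, g) \<in> germ Y m g" using g germ_eq_refl by (simp add: germ_def)
    ultimately have "(m, g) \<in> germ Y n f" by simp
    then show "germ_eq n f m g" by (simp add: germ_def)
  next
    assume fg: "germ_eq n f m g"
    show "germ Y n f = germ Y m g"
      using germ_eq_trans[OF g f _ germ_eq_sym[OF fg]] germ_eq_trans[OF f g _ fg] by (auto simp: germ_def)
  qed
  finally show ?thesis .
qed

lemma pt_tr: "f \<in> Hom B (X n) Y \<Longrightarrow> n \<le> k \<Longrightarrow> pt Y k (f \<cdot> tr n k) = pt Y n f"
  using pt_eq_iff[OF comp_tr_Hom[of f n Y k], of f n] Comp_Idn[OF comp_tr_Hom[of f n Y k]]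
  by (auto simp: germ_eq_def tr_self intro!: exI[of _ k])

definition F :: "'o \<Rightarrow> nat set" where
  "F Y = {pt Y n f | n f. f \<in> Hom B (X n) Y}"

text \<open>Computed on a chosen representative; \<open>M_pt\<close> shows independence of the
  choice. A number does not reveal of which object it is a point, so \<open>Dom B u\<close> supplies
  the object.\<close>

definition M :: "'a \<Rightarrow> nat \<Rightarrow> nat" where
  "M u x = (case SOME (n, f). f \<in> Hom B (X n) (Dom B u) \<and> pt (Dom B u) n f = x of
    (n, f) \<Rightarrow> pt (Cod B u) n (u \<cdot> f))"

lemma M_pt:
  assumes u: "u \<in> Hom B Y Z" and f: "f \<in> Hom B (X n) Y"
  shows "M u (pt Y n f) = pt Z n (u \<cdot> f)"
proof -
  let ?P = "\<lambda>(m, g). g \<in> Hom B (X m) Y \<and> pt Y m g = pt Y n f"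
  obtain m g where mg: "Eps ?P = (m, g)" by (cases "Eps ?P")
  have "?P (n, f)" using f by simp
  then have "?P (Eps ?P)" by (rule someI)
  then have g: "g \<in> Hom B (X m) Y" and "pt Y m g = pt Y n f" by (auto simp: mg)
  then obtain k where k: "m \<le> k" "n \<le> k" "g \<cdot> tr m k = f \<cdot> tr n k"
    using pt_eq_iff[OF g f] by (auto simp: germ_eq_def)
  have "germ_eq m (u \<cdot> g) n (u \<cdot> f)"
    using k comp_comp_tr[OF g u k(1)] comp_comp_tr[OF f u k(2)] by (auto simp: germ_eq_def)
  then have "pt Z m (u \<cdot> g) = pt Z n (u \<cdot> f)"
    using pt_eq_iff[OF Comp_closed[OF g u] Comp_closed[OF f u]] by simp
  then show ?thesis using mg Hom_D[OF u] by (simp add: M_def)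
qed

lemma F_E:
  assumes "x \<in> F Y"
  obtains n f where "f \<in> Hom B (X n) Y" "x = pt Y n f"
  using assms by (auto simp: F_def)

lemma pt_in_F: "f \<in> Hom B (X n) Y \<Longrightarrow> pt Y n f \<in> F Y"
  by (auto simp: F_def)

lemma fiber_functor_F: "fiber_functor B F M s"
proof
  fix f Y Z x assume f: "f \<in> Hom B Y Z" and "x \<in> F Y"
  then obtain n h where h: "h \<in> Hom B (X n) Y" "x = pt Y n h" by (elim F_E)
  then show "M f x \<in> F Z" using M_pt[OF f h(1)] pt_in_F[OF Comp_closed[OF h(1) f]] by simp
next
  fix Y x assume Y: "Y \<in> Obj B" and "x \<in> F Y"
  then obtain n h where h: "h \<in> Hom B (X n) Y" "x = pt Y n h" by (elim F_E)
  then show "M (Idn B Y) x = x" using M_pt[OF Idn_closed[OF Y] h(1)] Idn_Comp[OF h(1)] by simp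
next
  fix f Y Z g W x assume f: "f \<in> Hom B Y Z" and g: "g \<in> Hom B Z W" and "x \<in> F Y"
  then obtain n h where h: "h \<in> Hom B (X n) Y" "x = pt Y n h" by (elim F_E)
  then show "M (g \<cdot> f) x = M g (M f x)"
    using M_pt[OF Comp_closed[OF f g] h(1)] M_pt[OF f h(1)] M_pt[OF g Comp_closed[OF h(1) f]]
      Comp_assoc[OF h(1) f g] by simp
next
  fix Y Z x y assume "x \<in> F Y" "y \<in> F Z"
  then obtain n f m g where f: "f \<in> Hom B (X n) Y" "x = pt Y n f" and g: "g \<in> Hom B (X m) Z" "y = pt Z m g"
    by (elim F_E)
  \<comment> \<open>Both points are represented at the common stage \<open>?k\<close>, so they are
    images of the germ of the identity of the atom \<open>X ?k\<close>.\<close>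
  let ?k = "max n m"
  note id = Idn_closed[OF atom_obj[OF X_atom[of ?k]]]
  have u: "f \<cdot> tr n ?k \<in> Hom B (X ?k) Y" and v: "g \<cdot> tr m ?k \<in> Hom B (X ?k) Z"
    using comp_tr_Hom[OF f(1)] comp_tr_Hom[OF g(1)] by auto
  have "M (f \<cdot> tr n ?k) (pt (X ?k) ?k (Idn B (X ?k))) = x"
    using M_pt[OF u id] Comp_Idn[OF u] pt_tr[OF f(1), of ?k] f(2) by simp
  moreover have "M (g \<cdot> tr m ?k) (pt (X ?k) ?k (Idn B (X ?k))) = y"
    using M_pt[OF v id] Comp_Idn[OF v] pt_tr[OF g(1), of ?k] g(2) by simp
  ultimately show "\<exists>A a u v. atom B A \<and> a \<in> F A \<and> u \<in> Hom B A Y \<and> v \<in> Hom B A Z \<and> M u a = x \<and> M v a = y"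
    using X_atom pt_in_F[OF id] u v by blast
next
  fix A a u v Y assume A: "atom B A" and a: "a \<in> F A" and u: "u \<in> Hom B A Y" and v: "v \<in> Hom B A Y"
    and eq: "M u a = M v a"
  obtain n f where f: "f \<in> Hom B (X n) A" "a = pt A n f" using a by (rule F_E)
  have "pt Y n (u \<cdot> f) = pt Y n (v \<cdot> f)" using eq M_pt[OF u f(1)] M_pt[OF v f(1)] f(2) by simp
  then obtain k where k: "n \<le> k" "(u \<cdot> f) \<cdot> tr n k = (v \<cdot> f) \<cdot> tr n k"
    using pt_eq_iff[OF Comp_closed[OF f(1) u] Comp_closed[OF f(1) v]] by (auto simp: germ_eq_def)
  then have "u \<cdot> (f \<cdot> tr n k) = v \<cdot> (f \<cdot> tr n k)"
    using comp_comp_tr[OF f(1) u k(1)] comp_comp_tr[OF f(1) v k(1)] by simp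
  \<comment> \<open>Equal points mean equal composites with some map of atoms
    \<open>X k \<rightarrow> A\<close>, and such a map is an epimorphism.\<close>
  then show "u = v" by (rule atom_map_epi[OF X_atom A comp_tr_Hom[OF f(1) k(1)] u v])
next
  fix A A' u a assume A: "atom B A" and A': "atom B A'" and u: "u \<in> Hom B A' A" and a: "a \<in> F A"
  obtain n f where f: "f \<in> Hom B (X n) A" "a = pt A n f" using a by (rule F_E)
  obtain m h where h: "n \<le> m" "h \<in> Hom B (X m) A'" "u \<cdot> h = f \<cdot> tr n m"
    using chain_lift[OF A' A u f(1)] by blast
  have "M u (pt A' m h) = a" using M_pt[OF u h(2)] h(3) pt_tr[OF f(1) h(1)] f(2) by simp
  then show "\<exists>a' \<in> F A'. M u a' = a" using pt_in_F[OF h(2)] by blast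
next
  fix A assume A: "atom B A"
  \<comment> \<open>The final object is an atom, so the map from \<open>X 0\<close> to it lifts
    along the map from \<open>A\<close> at some later stage; the lift is a germ of a map into
    \<open>A\<close>.\<close>
  obtain T where T: "is_final B T" using final_object by blast
  obtain f where f: "f \<in> Hom B A T" using T atom_obj[OF A] unfolding is_final_def by blast
  obtain g where g: "g \<in> Hom B (X 0) T" using T atom_obj[OF X_atom] unfolding is_final_def by blast
  obtain m h where "h \<in> Hom B (X m) A" using chain_lift[OF A final_atom[OF T] f g] by blast
  then show "\<exists>a. a \<in> F A" using pt_in_F by blast
qed (rule s_atom s_exhaustive; assumption?)+

end

section \<open>Construction of the generic chain\<close>

context nondegenerate_B_category begin

text \<open>The maps in \<open>H\<close> are treated one after the other: amalgamation solves the
  new problem over a further atom \<open>W\<close>, and earlier solutions survive composition with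
  \<open>p\<close>.\<close>

lemma finite_lift:
  assumes X: "atom B X" and Y: "atom B Y" and Z: "atom B Z" and f: "f \<in> Hom B Y Z"
    and "finite H" "H \<subseteq> Hom B X Z"
  shows "\<exists>X' u. atom B X' \<and> u \<in> Hom B X' X \<and> (\<forall>g \<in> H. \<exists>h \<in> Hom B X' Y. f \<cdot> h = g \<cdot> u)"
  using assms(5,6)
proof (induction H)
  case empty
  then show ?case using X Idn_closed[OF atom_obj[OF X]] by blast
next
  case (insert g H)
  then obtain X' u where X': "atom B X'" and u: "u \<in> Hom B X' X"
    and H: "\<forall>g \<in> H. \<exists>h \<in> Hom B X' Y. f \<cdot> h = g \<cdot> u" by auto
  have g: "g \<in> Hom B X Z" using insert.prems by simp
  obtain W p q where W: "atom B W" and p: "p \<in> Hom B W X'" and q: "q \<in> Hom B W Y"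
    and eq: "(g \<cdot> u) \<cdot> p = f \<cdot> q"
    using amalgamation[OF X' Y Z Comp_closed[OF u g] f] by blast
  have "\<exists>h \<in> Hom B W Y. f \<cdot> h = g' \<cdot> (u \<cdot> p)" if g': "g' \<in> insert g H" for g'
  proof (cases "g' = g")
    case True
    then show ?thesis using eq q Comp_assoc[OF p u g] by auto
  next
    case False
    then have "g' \<in> H" using g' by simp
    then obtain h where h: "h \<in> Hom B X' Y" "f \<cdot> h = g' \<cdot> u" using H by blast
    have "g' \<in> Hom B X Z" using insert.prems g' by blast
    then have "f \<cdot> (h \<cdot> p) = g' \<cdot> (u \<cdot> p)"
      using Comp_assoc[OF p h(1) f] Comp_assoc[OF p u] h(2) by simp
    then show ?thesis using Comp_closed[OF p h(1)] by blast
  qed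
  then show ?case using W Comp_closed[OF p u] by blast
qed

lemma generic_chain_exists:
  assumes s_atom: "\<And>k. atom B (s k)" and s_exhaustive: "\<And>A. atom B A \<Longrightarrow> \<exists>k. isomorphic B A (s k)"
  shows "\<exists>X \<pi>. generic_chain B X \<pi> s"
proof -
  define Ar where "Ar = (\<Union>k. \<Union>l. Hom B (s k) (s l))"
  have Ar: "countable Ar" unfolding Ar_def
    using finite_Hom[OF s_atom atom_obj[OF s_atom]] by (intro countable_UN) (auto intro: countable_finite)
  have "Ar \<noteq> {}" unfolding Ar_def using Idn_closed[OF atom_obj[OF s_atom]] by blast
  \<comment> \<open>Only the first component of the decoded index selects the arrow, so each arrow
    recurs at infinitely many steps; this gives the late stages in \<open>generic\<close>.\<close>
  define ar where "ar n = from_nat_into Ar (fst (prod_decode n))" for n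
  have "ar n \<in> Ar" for n unfolding ar_def by (rule from_nat_into[OF \<open>Ar \<noteq> {}\<close>])
  then have ar: "\<exists>k l. ar n \<in> Hom B (s k) (s l)" for n unfolding Ar_def by blast
  have often: "\<exists>m\<ge>n. ar m = f" if f: "f \<in> Ar" for f n
  proof -
    obtain i where "from_nat_into Ar i = f" using from_nat_into_surj[OF Ar f] by blast
    then show ?thesis
      using le_prod_encode_2[of n i] by (intro exI[of _ "prod_encode (i, n)"]) (simp add: ar_def)
  qed
  define good where "good n X X' u \<longleftrightarrow> u \<in> Hom B X' X \<and>
    (\<forall>g \<in> Hom B X (Cod B (ar n)). \<exists>h \<in> Hom B X' (Dom B (ar n)). ar n \<cdot> h = g \<cdot> u)" for n X X' u
  have "\<exists>X. \<forall>n. atom B (X n) \<and> (\<exists>u. good n (X n) (X (Suc n)) u)"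
  proof (rule dependent_nat_choice)
    show "\<exists>X. atom B X" using s_atom by blast
    fix X n assume X: "atom B X"
    obtain k l where kl: "ar n \<in> Hom B (s k) (s l)" using ar by blast
    show "\<exists>X'. atom B X' \<and> (\<exists>u. good n X X' u)"
      using finite_lift[OF X s_atom s_atom kl finite_Hom[OF X atom_obj[OF s_atom]] subset_refl] Hom_D[OF kl]
      by (auto simp: good_def)
  qed
  then obtain X where X: "\<And>n. atom B (X n)" "\<forall>n. \<exists>u. good n (X n) (X (Suc n)) u" by blast
  from choice[OF X(2)] obtain \<pi> where \<pi>: "\<And>n. good n (X n) (X (Suc n)) (\<pi> n)" by blast
  have "generic_chain B X \<pi> s"
  proof
    show "atom B (X n)" for n by (rule X(1))
    show "\<pi> n \<in> Hom B (X (Suc n)) (X n)" for n using \<pi>[of n] by (simp add: good_def)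
    show "atom B (s k)" for k by (rule s_atom)
    show "\<exists>k. isomorphic B A (s k)" if "atom B A" for A by (rule s_exhaustive[OF that])
    fix f k l n assume f: "f \<in> Hom B (s k) (s l)"
    then have "f \<in> Ar" by (auto simp: Ar_def)
    then obtain m where "m \<ge> n" "ar m = f" using often by blast
    then show "\<exists>m\<ge>n. \<forall>g \<in> Hom B (X m) (s l). \<exists>h \<in> Hom B (X (Suc m)) (s k). f \<cdot> h = g \<cdot> \<pi> m"
      using \<pi>[of m] Hom_D[OF f] by (auto simp: good_def)
  qed
  then show ?thesis by blast
qed

lemma enumeration_of_atoms:
  assumes "countable (iso_classes B)"
  shows "\<exists>s :: nat \<Rightarrow> _. (\<forall>k. atom B (s k)) \<and> (\<forall>A. atom B A \<longrightarrow> (\<exists>k. isomorphic B A (s k)))"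
proof -
  obtain T where T: "atom B T" using final_object final_atom by blast
  \<comment> \<open>From a class that contains an atom one is chosen; any other class contributes
    the final object \<open>T\<close>, which is itself an atom.\<close>
  define s where "s k = (if \<exists>A \<in> from_nat_into (iso_classes B) k. atom B A
    then SOME A. A \<in> from_nat_into (iso_classes B) k \<and> atom B A else T)" for k
  have s: "s k \<in> from_nat_into (iso_classes B) k \<and> atom B (s k)"
    if "A \<in> from_nat_into (iso_classes B) k" "atom B A" for A k
    using someI[of "\<lambda>A. A \<in> from_nat_into (iso_classes B) k \<and> atom B A" A] that by (auto simp: s_def)
  have "atom B (s k)" for k
  proof (cases "\<exists>A \<in> from_nat_into (iso_classes B) k. atom B A")
    case True
    then show ?thesis using s by blast
  next
    case False
    then show ?thesis using T by (simp add: s_def)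
  qed
  moreover have "\<exists>k. isomorphic B A (s k)" if A: "atom B A" for A
  proof -
    let ?c = "{Y. Y \<in> Obj B \<and> isomorphic B A Y}"
    note A' = atom_obj[OF A]
    have "?c \<in> iso_classes B"
      unfolding iso_classes_def quotient_def using A' by auto
    then obtain k where "from_nat_into (iso_classes B) k = ?c" using from_nat_into_surj[OF assms] by blast
    then show ?thesis using s[of A k] A A' isomorphic_refl[OF A'] by auto
  qed
  ultimately show ?thesis by blast
qed

end

theorem theorem6p15:
  fixes B :: "('o, 'a) cat"
  assumes "nondegenerate_B_category B"
    and "countable (iso_classes B)"
  shows "\<exists>(G :: (nat \<Rightarrow> nat) monoid) T \<E>.
    admissible_group G T \<and> first_countable T \<and> stabilizer_class G T \<E> \<and>
    equivalent_categories B (smooth_gsets_class G T \<E>) \<and>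
    (effective_equivalence_relations B \<longrightarrow> equivalent_categories B (smooth_gsets G T))"
proof -
  interpret nondegenerate_B_category B by fact
  obtain s :: "nat \<Rightarrow> 'o" where s: "\<forall>k. atom B (s k)" "\<forall>A. atom B A \<longrightarrow> (\<exists>k. isomorphic B A (s k))"
    using enumeration_of_atoms[OF assms(2)] by (elim exE conjE) (rule that)
  have "\<exists>X \<pi>. generic_chain B X \<pi> s"
    by (rule generic_chain_exists) (simp_all add: s)
  then obtain X \<pi> where "generic_chain B X \<pi> s" by (elim exE) (rule that)
  then interpret generic_chain B X \<pi> s .
  show ?thesis by (rule fiber_functor.fiber_functor_reconstruction[OF fiber_functor_F])
qed

end
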